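(* Let $\nu_u$ be a centered free Gibbs measure with potential $u:\mathbb{R}\to\mathbb{R}$ of class $\mathcal{C}^2$ such that, for some $\epsilon>0$, the function $x\mapsto u(x)-\frac{\epsilon}{2}x^2$ is convex. Let $\varphi$ be the free moment map of $\nu_u$. If $\varphi$ is $\mathcal{C}^4$, then $\varphi'$ is $\epsilon^{-1}$-Lipschitz on $\mathbb{R}$, and thus $$\|\mathscr{J}\varphi'\|_\infty:=\sup_{(x,y)\in\mathbb{R}^2}|\mathscr{J}\varphi'(x,y)|\le\epsilon^{-1}.$$
   Context: For a $\mathcal{C}^1$ function $f$ on $\mathbb{R}$, the free difference quotient is $\mathscr{J}f(x,y)=\frac{f(x)-f(y)}{x-y}$ if $x\neq y$ and $\mathscr{J}f(x,x)=f'(x)$. Free Gibbs measure: for a convex function $v:\mathbb{R}\to\mathbb{R}$, the free Gibbs measure $\nu_v$ is the unique minimizer, over Borel probability measures $\rho$ on $\mathbb{R}$, of $-\iint\log|t-s|\,d\rho(t)\,d\rho(s)+\int v(s)\,d\rho(s)$. It is centered if $\int x\,d\nu_v(x)=0$. Free moment map: for a centered probability measure $\mu\neq\delta_0$ on $\mathbb{R}$ with finite second moment, the free moment map of $\mu$ is the convex lower semicontinuous function $\varphi$ (considered up to translations) such that $\mu=(\varphi')_\sharp\nu_\varphi$, where $\nu_\varphi$ is the free Gibbs measure associated with $\varphi$.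
   Formalization: φ is determined only on supp ν_φ, and the bound on ℝ can fail elsewhere (u=x²/2, φ=x²/2+max(0,|x|−3)⁶); so it is proved that φ' is 1/ε-Lipschitz with |Jφ'| ≤ 1/ε on supp ν_φ, and that some C² free moment map ψ=φ on supp ν_φ, same Gibbs measure, has both bounds on all of ℝ. *)

theory Defs
  imports "HOL-Probability.Probability"
begin

section \<open>Functions of class \<open>C\<^sup>k\<close> and the free difference quotient\<close>

definition C_class :: "nat \<Rightarrow> (real \<Rightarrow> real) \<Rightarrow> bool" where
  "C_class k f \<longleftrightarrow>
     (\<forall>j<k. (deriv ^^ j) f differentiable_on UNIV) \<and> continuous_on UNIV ((deriv ^^ k) f)"

definition free_dq :: "(real \<Rightarrow> real) \<Rightarrow> real \<Rightarrow> real \<Rightarrow> real" where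
  "free_dq f x y = (if x = y then deriv f x else (f x - f y) / (x - y))"


section \<open>Free Gibbs measures\<close>

text \<open>
  The integral of an extended-real function is the integral of its positive part minus that of its
  negative part.  On \<^typ>\<open>ereal\<close> one has \<open>\<infinity> + (-\<infinity>) = \<infinity>\<close> and \<open>\<infinity> - \<infinity> = \<infinity>\<close>, so an integral or an
  energy that is not defined counts as \<open>\<infinity>\<close>; the corresponding measures do not compete in the
  minimization.
\<close>

definition ereal_integral :: "'a measure \<Rightarrow> ('a \<Rightarrow> ereal) \<Rightarrow> ereal" where
  "ereal_integral M f =
     enn2ereal (\<integral>\<^sup>+ x. e2ennreal (f x) \<partial>M) - enn2ereal (\<integral>\<^sup>+ x. e2ennreal (- f x) \<partial>M)"

text \<open>In HOL \<^term>\<open>ln (0::real)\<close> is \<open>0\<close>, so the value \<open>\<infinity>\<close> on the diagonal has to be given explicitly.\<close>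

definition neg_log_dist :: "real \<Rightarrow> real \<Rightarrow> ereal" where
  "neg_log_dist t s = (if t = s then \<infinity> else ereal (- ln \<bar>t - s\<bar>))"

definition free_energy :: "(real \<Rightarrow> real) \<Rightarrow> real measure \<Rightarrow> ereal" where
  "free_energy v \<rho> =
     ereal_integral (\<rho> \<Otimes>\<^sub>M \<rho>) (\<lambda>(t, s). neg_log_dist t s) + ereal_integral \<rho> (\<lambda>s. ereal (v s))"

definition free_gibbs :: "(real \<Rightarrow> real) \<Rightarrow> real measure \<Rightarrow> bool" where
  "free_gibbs v \<nu> \<longleftrightarrow> real_distribution \<nu> \<and>
     (\<forall>\<rho>. real_distribution \<rho> \<and> \<rho> \<noteq> \<nu> \<longrightarrow> free_energy v \<nu> < free_energy v \<rho>)"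

definition centered :: "real measure \<Rightarrow> bool" where
  "centered \<mu> \<longleftrightarrow> integrable \<mu> (\<lambda>x. x) \<and> (\<integral>x. x \<partial>\<mu>) = 0"

definition msupport :: "real measure \<Rightarrow> real set" where
  "msupport \<mu> = {x. \<forall>U. open U \<and> x \<in> U \<longrightarrow> emeasure \<mu> U > 0}"


section \<open>Free moment maps\<close>

text \<open>
  A real-valued convex function is differentiable off a countable set, which is negligible for a
  free Gibbs measure because that measure has finite energy and hence no atoms.  Lower
  semicontinuity is stated as closedness of the sublevel sets.
\<close>

definition free_moment_map :: "real measure \<Rightarrow> (real \<Rightarrow> real) \<Rightarrow> bool" where
  "free_moment_map \<mu> \<phi> \<longleftrightarrow>
     convex_on UNIV \<phi> \<and> (\<forall>a. closed {x. \<phi> x \<le> a}) \<and>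
     (\<exists>\<nu>. free_gibbs \<phi> \<nu> \<and> \<mu> = distr \<nu> borel (deriv \<phi>))"

lemma free_gibbs_unique:
  assumes "free_gibbs v \<nu>" "free_gibbs v \<nu>'"
  shows "\<nu> = \<nu>'"
  using assms unfolding free_gibbs_def by (metis less_asym)

text \<open>
  A free moment map is determined by \<open>\<mu>\<close> (up to translations) only on the support of its free Gibbs
  measure \<open>\<nu>\<close>.  By the lemmas below, increasing \<open>\<phi>\<close> off a set of full \<open>\<nu>\<close>-measure, while keeping
  it convex and lower semicontinuous, changes neither \<open>\<nu>\<close> nor the pushforward.  For instance, both
  \<open>x\<^sup>2 / 2\<close> and \<open>x\<^sup>2 / 2 + max 0 (\<bar>x\<bar> - 3) ^ 6\<close> are \<open>C\<^sup>4\<close> free moment maps of the semicircle law on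
  \<open>[-2, 2]\<close>, and the derivative of the second one is not Lipschitz on the line.
\<close>

lemma free_gibbs_increase:
  assumes G: "free_gibbs v \<nu>" and le: "\<And>x. v x \<le> w x" and AE: "AE x in \<nu>. w x = v x"
  shows "free_gibbs w \<nu>"
proof -
  have mono: "free_energy v \<rho> \<le> free_energy w \<rho>" for \<rho>
    unfolding free_energy_def ereal_integral_def
    by (intro add_left_mono ereal_minus_mono less_eq_ennreal.rep_eq[THEN iffD1]
        nn_integral_mono e2ennreal_mono) (auto simp: le)
  have "(\<integral>\<^sup>+x. e2ennreal (ereal (w x)) \<partial>\<nu>) = (\<integral>\<^sup>+x. e2ennreal (ereal (v x)) \<partial>\<nu>)"
    "(\<integral>\<^sup>+x. e2ennreal (- ereal (w x)) \<partial>\<nu>) = (\<integral>\<^sup>+x. e2ennreal (- ereal (v x)) \<partial>\<nu>)"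
    using AE by (auto intro!: nn_integral_cong_AE)
  then have "free_energy w \<nu> = free_energy v \<nu>"
    by (simp add: free_energy_def ereal_integral_def)
  with G mono show ?thesis
    unfolding free_gibbs_def by (metis order_less_le_trans)
qed

lemma free_moment_map_increase:
  assumes "free_gibbs \<phi> \<nu>" "\<mu> = distr \<nu> borel (deriv \<phi>)"
    and "convex_on UNIV \<psi>" "\<And>a. closed {x. \<psi> x \<le> a}" "\<And>x. \<phi> x \<le> \<psi> x"
    and "AE x in \<nu>. \<psi> x = \<phi> x \<and> deriv \<psi> x = deriv \<phi> x"
    and "deriv \<phi> \<in> borel_measurable borel" "deriv \<psi> \<in> borel_measurable borel"
  shows "free_moment_map \<mu> \<psi>"
proof -
  have "free_gibbs \<psi> \<nu>"
    by (rule free_gibbs_increase[OF assms(1)]) (use assms in auto)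
  moreover have [measurable_cong]: "sets \<nu> = sets borel"
    using assms(1) by (simp add: free_gibbs_def real_distribution.events_eq_borel)
  have "distr \<nu> borel (deriv \<phi>) = distr \<nu> borel (deriv \<psi>)"
    by (rule distr_cong_AE) (use assms in auto)
  ultimately show ?thesis
    using assms by (auto simp: free_moment_map_def)
qed

end

theory Submission
  imports Defs
begin

text \<open>
  Write \<open>\<nu>\<close> for the free Gibbs measure of \<open>\<phi>\<close>, \<open>T = \<phi>'\<close>, and \<open>\<mu>\<close> for the push-forward of \<open>\<nu>\<close> under
  \<open>T\<close>, which is the free Gibbs measure of \<open>u\<close>.  The proof is a maximum principle for \<open>T'\<close> on the
  support of \<open>\<nu>\<close>, in the spirit of Caffarelli's contraction theorem.

  Both measures minimize an energy, so each satisfies an Euler--Lagrange equation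
  (\<open>free_gibbs_euler_lagrange\<close>): for \<open>\<nu>\<close>-almost every \<open>x\<close>,
  \<open>\<phi> x = 2 \<integral> ln \<bar>x - y\<bar> d\<nu>(y) + c\<close> and \<open>u (T x) = 2 \<integral> ln \<bar>T x - T y\<bar> d\<nu>(y) + c'\<close>.  In the difference

    \<open>u (T x) - \<phi> x = 2 \<integral> ln ((T x - T y) / (x - y)) d\<nu>(y) + C\<close>

  (\<open>moment_map_euler_lagrange\<close>) the logarithmic singularities cancel, and near a point with \<open>T' > 0\<close>
  the kernel is as smooth as \<open>T'\<close>.  So the identity can be differentiated twice under the integral,
  with no principal values and no knowledge of the density of \<open>\<nu>\<close>.  At a point \<open>x0\<close> where \<open>T'\<close>
  attains its maximum \<open>L\<close> over the support, the second derivative of the kernel is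

    \<open>T'' x0 / (T x0 - T y) - L\<^sup>2 / (T x0 - T y)\<^sup>2 + 1 / (x0 - y)\<^sup>2\<close>,

  and the last two terms together are at most \<open>0\<close>, because \<open>\<bar>T x0 - T y\<bar> \<le> L \<bar>x0 - y\<bar>\<close>.  If
  \<open>T'' x0 = 0\<close> this gives \<open>u'' (T x0) L\<^sup>2 - L \<le> 0\<close>, hence \<open>\<epsilon> L \<le> 1\<close>
  (\<open>second_order_maximum_principle\<close>).

  Two facts about the support are needed.  The bound on difference quotients requires the support to
  be an interval (\<open>free_gibbs_support_interval\<close>): across a gap, moving mass from both sides into the
  gap would lower the energy of a convex potential.  And the maximum may sit at an end point, where
  \<open>T''\<close> need not vanish; the terms with \<open>T''\<close> then have the right sign because pushing the extreme
  mass outwards cannot lower the energy (\<open>free_gibbs_endpoint\<close>).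

  Off the support \<open>\<phi>\<close> is arbitrary, so the global statement is about another potential: \<open>\<phi>\<close> on the
  support, continued by its osculating parabolas.  This potential may be smaller than \<open>\<phi>\<close>, so that
  minimality of \<open>\<nu>\<close> has to be proved anew (\<open>free_gibbs_change_potential\<close>).  It follows from
  displacement convexity: along the monotone coupling of \<open>\<nu>\<close> with a competitor the energy of a convex
  potential is convex, and its derivative at \<open>\<nu>\<close> involves the potential on the support only, where
  the minimality for \<open>\<phi>\<close> can be used (\<open>coupling_first_variation\<close>).
\<close>

section \<open>Differentiable and convex functions on the line\<close>

lemma continuous_on_of_derivative:
  fixes f f' :: "real \<Rightarrow> real"
  assumes "\<And>x. (f has_real_derivative f' x) (at x)"
  shows "continuous_on UNIV f"
  using DERIV_isCont[OF assms] by (simp add: continuous_at_imp_continuous_on)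

lemma continuous_bounded_interval:
  fixes g :: "real \<Rightarrow> real"
  assumes "continuous_on UNIV g"
  obtains B where "\<And>x. x \<in> {a..b} \<Longrightarrow> \<bar>g x\<bar> \<le> B"
proof -
  have "compact (g ` {a..b})"
    by (intro compact_continuous_image continuous_on_subset[OF assms]) auto
  then obtain B where "\<forall>x\<in>g ` {a..b}. norm x \<le> B"
    using compact_imp_bounded bounded_iff by blast
  then show thesis by (intro that[of B]) auto
qed

lemma abs_diff_le_of_deriv_le:
  fixes f f' :: "real \<Rightarrow> real"
  assumes "\<And>x. x \<in> {a..b} \<Longrightarrow> (f has_real_derivative f' x) (at x)"
    and "\<And>x. x \<in> {a..b} \<Longrightarrow> \<bar>f' x\<bar> \<le> B" and "x \<in> {a..b}" "y \<in> {a..b}"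
  shows "\<bar>f x - f y\<bar> \<le> B * \<bar>x - y\<bar>"
  using field_differentiable_bound[of "{a..b}" f f' B x y] assms
  by (auto simp: has_field_derivative_at_within)

lemma convex_tangent:
  fixes f :: "real \<Rightarrow> real"
  assumes "convex_on UNIV f" "(f has_real_derivative d) (at x)"
  shows "f x + d * (z - x) \<le> f z"
  using convex_on_imp_above_tangent[of UNIV f x z d] assms by auto

lemma convex_deriv_mono:
  fixes f f' :: "real \<Rightarrow> real"
  assumes cv: "convex_on UNIV f" and f: "\<And>x. (f has_real_derivative f' x) (at x)"
  shows "mono f'"
proof (rule monoI)
  fix x y :: real assume "x \<le> y"
  have "f' x * (y - x) \<le> f' y * (y - x)"
    using convex_tangent[OF cv f[of x], of y] convex_tangent[OF cv f[of y], of x]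
    by (simp add: algebra_simps)
  then show "f' x \<le> f' y" using \<open>x \<le> y\<close> by (cases "x = y") auto
qed

section \<open>Energies as Bochner integrals\<close>

text \<open>
  The energy of a measure is an extended real number.  All variations below take place among the
  measures of \<open>finite_energy\<close>, for which both parts of the energy are absolutely convergent and the
  value \<open>ln 0 = 0\<close> on the diagonal does not matter because the diagonal is a null set.
\<close>

definition finite_energy :: "(real \<Rightarrow> real) \<Rightarrow> real measure \<Rightarrow> bool" where
  "finite_energy v \<rho> \<longleftrightarrow> real_distribution \<rho> \<and> (AE (x, y) in \<rho> \<Otimes>\<^sub>M \<rho>. x \<noteq> y) \<and>
     integrable (\<rho> \<Otimes>\<^sub>M \<rho>) (\<lambda>(x, y). ln \<bar>x - y\<bar>) \<and> integrable \<rho> v"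

definition energy :: "(real \<Rightarrow> real) \<Rightarrow> real measure \<Rightarrow> real" where
  "energy v \<rho> = (\<integral>x. v x \<partial>\<rho>) - (\<integral>(x, y). ln \<bar>x - y\<bar> \<partial>(\<rho> \<Otimes>\<^sub>M \<rho>))"

text \<open>
  Linear growth suffices for everything: it dominates the logarithm, hence it makes the energy bounded
  below and confines Gibbs measures to bounded sets, and a convex function has it as soon as its
  slopes take both signs.
\<close>

definition coercive :: "(real \<Rightarrow> real) \<Rightarrow> bool" where
  "coercive v \<longleftrightarrow> (\<exists>\<kappa>>0. \<exists>C. \<forall>x. \<kappa> * \<bar>x\<bar> - C \<le> v x)"

lemma ereal_integral_eq_integral:
  assumes "AE x in M. f x = ereal (g x)" "integrable M g"
  shows "ereal_integral M f = ereal (\<integral>x. g x \<partial>M)"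
proof -
  have "(\<integral>\<^sup>+x. e2ennreal (f x) \<partial>M) = (\<integral>\<^sup>+x. ennreal (g x) \<partial>M)"
    using assms(1) by (intro nn_integral_cong_AE) (auto simp: e2ennreal_ereal)
  moreover have "(\<integral>\<^sup>+x. e2ennreal (- f x) \<partial>M) = (\<integral>\<^sup>+x. ennreal (- g x) \<partial>M)"
    using assms(1) by (intro nn_integral_cong_AE) (auto simp: e2ennreal_ereal)
  moreover obtain p where p: "(\<integral>\<^sup>+x. ennreal (g x) \<partial>M) = ennreal p" "p \<ge> 0"
    using assms(2) unfolding real_integrable_def
    by (metis ennreal_cases infinity_ennreal_def)
  moreover obtain q where q: "(\<integral>\<^sup>+x. ennreal (- g x) \<partial>M) = ennreal q" "q \<ge> 0"
    using assms(2) unfolding real_integrable_def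
    by (metis ennreal_cases infinity_ennreal_def)
  moreover have "(\<integral>x. g x \<partial>M) = p - q"
    using real_lebesgue_integral_def[OF assms(2)] p q by simp
  ultimately show ?thesis
    by (simp add: ereal_integral_def enn2ereal_ennreal)
qed

lemma free_energy_eq_energy:
  assumes "finite_energy v \<rho>"
  shows "free_energy v \<rho> = ereal (energy v \<rho>)"
proof -
  have "ereal_integral (\<rho> \<Otimes>\<^sub>M \<rho>) (\<lambda>(t, s). neg_log_dist t s)
      = ereal (\<integral>p. - (case p of (x, y) \<Rightarrow> ln \<bar>x - y\<bar>) \<partial>(\<rho> \<Otimes>\<^sub>M \<rho>))"
    using assms unfolding finite_energy_def
    by (intro ereal_integral_eq_integral) (auto simp: neg_log_dist_def elim!: eventually_mono)
  moreover have "ereal_integral \<rho> (\<lambda>s. ereal (v s)) = ereal (\<integral>x. v x \<partial>\<rho>)"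
    using assms unfolding finite_energy_def by (intro ereal_integral_eq_integral) auto
  ultimately show ?thesis
    by (simp add: free_energy_def energy_def)
qed

lemma ln_abs_diff_le: "ln \<bar>x - y\<bar> \<le> \<bar>x\<bar> + \<bar>y :: real\<bar>"
proof (cases "x = y")
  case False
  then have "ln \<bar>x - y\<bar> \<le> \<bar>x - y\<bar> - 1"
    by (intro ln_le_minus_one) auto
  then show ?thesis by linarith
qed auto

lemma integrable_abs_of_coercive:
  assumes "coercive v" "real_distribution \<rho>" "integrable \<rho> v"
  shows "integrable \<rho> (\<lambda>x. \<bar>x\<bar>)"
proof -
  interpret real_distribution \<rho> by fact
  obtain \<kappa> C where \<kappa>: "\<kappa> > 0" "\<And>x. \<kappa> * \<bar>x\<bar> - C \<le> v x"
    using assms(1) unfolding coercive_def by blast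
  have "integrable \<rho> (\<lambda>x. (\<bar>v x\<bar> + \<bar>C\<bar>) / \<kappa>)"
    using assms(3) by auto
  then show ?thesis
  proof (rule Bochner_Integration.integrable_bound)
    show "AE x in \<rho>. norm \<bar>x\<bar> \<le> norm ((\<bar>v x\<bar> + \<bar>C\<bar>) / \<kappa>)"
    proof (intro AE_I2)
      fix x
      have "\<kappa> * \<bar>x\<bar> \<le> \<bar>v x\<bar> + \<bar>C\<bar>" using \<kappa>(2)[of x] by linarith
      then show "norm \<bar>x\<bar> \<le> norm ((\<bar>v x\<bar> + \<bar>C\<bar>) / \<kappa>)"
        using \<kappa>(1) by (simp add: field_simps)
    qed
  qed measurable
qed

text \<open>
  An energy below \<open>\<infinity>\<close> could still be \<open>-\<infinity>\<close>.  Coercivity excludes this: the integral of the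
  potential is bounded below, so it is finite; then \<open>\<bar>x\<bar>\<close> is integrable as well, and this bounds the
  positive part of \<open>ln \<bar>x - y\<bar>\<close>.
\<close>

lemma finite_energy_of_free_energy:
  assumes "coercive v" "v \<in> borel_measurable borel" "real_distribution \<rho>" "free_energy v \<rho> < \<infinity>"
  shows "finite_energy v \<rho>"
proof -
  let ?N = "\<rho> \<Otimes>\<^sub>M \<rho>"
  interpret real_distribution \<rho> by fact
  interpret P: pair_prob_space \<rho> \<rho> ..
  obtain \<kappa> C where \<kappa>: "\<kappa> > 0" "\<And>x. \<kappa> * \<bar>x\<bar> - C \<le> v x"
    using assms(1) unfolding coercive_def by blast
  define A where "A = ereal_integral ?N (\<lambda>(t, s). neg_log_dist t s)"
  define B where "B = ereal_integral \<rho> (\<lambda>s. ereal (v s))"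
  have AB: "A \<noteq> \<infinity>" "B \<noteq> \<infinity>"
    using assms(4) by (auto simp: free_energy_def A_def[symmetric] B_def[symmetric])
  have vm: "v \<in> borel_measurable \<rho>" using assms(2) by simp
  have v: "integrable \<rho> v"
    unfolding real_integrable_def
  proof (intro conjI vm)
    have "- v x \<le> \<bar>C\<bar>" for x
    proof -
      have "0 \<le> \<kappa> * \<bar>x\<bar>" using \<kappa>(1) by simp
      then show ?thesis using \<kappa>(2)[of x] by linarith
    qed
    then have "(\<integral>\<^sup>+x. ennreal (- v x) \<partial>\<rho>) \<le> (\<integral>\<^sup>+x. ennreal \<bar>C\<bar> \<partial>\<rho>)"
      by (intro nn_integral_mono ennreal_leI)
    also have "\<dots> < \<infinity>" by (simp add: emeasure_space_1[unfolded space_eq_univ])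
    finally show "(\<integral>\<^sup>+x. ennreal (- v x) \<partial>\<rho>) \<noteq> \<infinity>" by simp
    show "(\<integral>\<^sup>+x. ennreal (v x) \<partial>\<rho>) \<noteq> \<infinity>"
    proof
      assume "(\<integral>\<^sup>+x. ennreal (v x) \<partial>\<rho>) = \<infinity>"
      then have "B = \<infinity>" unfolding B_def ereal_integral_def
        by (simp add: e2ennreal_ereal)
      with AB show False by simp
    qed
  qed
  have ia: "integrable \<rho> (\<lambda>x. \<bar>x\<bar>)"
    by (rule integrable_abs_of_coercive) fact+
  have lnm: "(\<lambda>(x, y). ln \<bar>x - y :: real\<bar>) \<in> borel_measurable ?N"
    by measurable
  have i1: "integrable ?N (\<lambda>p. \<bar>fst p\<bar>)"
    by (rule P.Fubini_integrable) (use ia in \<open>auto simp: prob_space[unfolded space_eq_univ]\<close>)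
  have i2: "integrable ?N (\<lambda>p. \<bar>snd p\<bar>)"
    by (rule P.Fubini_integrable) (use ia in auto)
  have "integrable ?N (\<lambda>p. \<bar>fst p\<bar> + \<bar>snd p\<bar>)"
    by (rule Bochner_Integration.integrable_add[OF i1 i2])
  then have fin: "(\<integral>\<^sup>+p. ennreal (\<bar>fst p\<bar> + \<bar>snd p\<bar>) \<partial>?N) < \<infinity>"
    by (subst (asm) integrable_iff_bounded) simp
  have neg: "(\<integral>\<^sup>+p. ennreal (case p of (x, y) \<Rightarrow> ln \<bar>x - y\<bar>) \<partial>?N) < \<infinity>"
    by (rule le_less_trans[OF _ fin], intro nn_integral_mono ennreal_leI)
       (auto simp: ln_abs_diff_le split: prod.split)
  have pos: "(\<integral>\<^sup>+p. e2ennreal (case p of (x, y) \<Rightarrow> neg_log_dist x y) \<partial>?N) \<noteq> \<infinity>"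
  proof
    assume "(\<integral>\<^sup>+p. e2ennreal (case p of (x, y) \<Rightarrow> neg_log_dist x y) \<partial>?N) = \<infinity>"
    then have "A = \<infinity>" unfolding A_def ereal_integral_def by simp
    with AB show False by simp
  qed
  have nlm: "(\<lambda>p. e2ennreal (case p of (x, y) \<Rightarrow> neg_log_dist x y)) \<in> borel_measurable ?N"
    unfolding neg_log_dist_def by measurable
  have "AE p in ?N. e2ennreal (case p of (x, y) \<Rightarrow> neg_log_dist x y) \<noteq> \<infinity>"
    by (rule nn_integral_PInf_AE[OF nlm pos])
  then have diag: "AE (x, y) in ?N. x \<noteq> y"
    by (auto elim!: eventually_mono simp: neg_log_dist_def)
  have "(\<integral>\<^sup>+p. ennreal (- (case p of (x, y) \<Rightarrow> ln \<bar>x - y\<bar>)) \<partial>?N)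
      \<le> (\<integral>\<^sup>+p. e2ennreal (case p of (x, y) \<Rightarrow> neg_log_dist x y) \<partial>?N)"
    by (intro nn_integral_mono) (auto simp: neg_log_dist_def e2ennreal_ereal)
  then have "(\<integral>\<^sup>+p. ennreal (- (case p of (x, y) \<Rightarrow> ln \<bar>x - y\<bar>)) \<partial>?N) \<noteq> \<infinity>"
    using pos by (auto simp: top_unique)
  then have "integrable ?N (\<lambda>(x, y). ln \<bar>x - y\<bar>)"
    unfolding real_integrable_def using lnm neg by (auto simp: less_top)
  with v diag show ?thesis
    unfolding finite_energy_def using assms(3) by simp
qed

text \<open>
  A strict minimizer has energy below \<open>\<infinity>\<close>, since there is more than one probability measure.
\<close>

lemma free_gibbs_finite_energy:
  assumes "free_gibbs v \<nu>" "coercive v" "v \<in> borel_measurable borel"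
  shows "finite_energy v \<nu>"
proof (rule finite_energy_of_free_energy)
  have "\<exists>\<rho>. real_distribution \<rho> \<and> \<rho> \<noteq> \<nu>"
  proof -
    have d: "real_distribution (return borel (a::real))" for a
      unfolding real_distribution_def real_distribution_axioms_def by (auto intro: prob_space_return)
    have "emeasure (return borel (0::real)) {0} = 1" "emeasure (return borel (1::real)) {0} = 0"
      by (auto simp: emeasure_return)
    then have "return borel (0::real) \<noteq> return borel 1" by (metis zero_neq_one)
    then show ?thesis using d by metis
  qed
  then obtain \<rho> where "free_energy v \<nu> < free_energy v \<rho>"
    using assms(1) unfolding free_gibbs_def by blast
  then show "free_energy v \<nu> < \<infinity>"
    by (rule less_le_trans) simp
qed (use assms in \<open>auto simp: free_gibbs_def\<close>)

lemma free_gibbs_energy_le: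
  assumes "free_gibbs v \<nu>" "finite_energy v \<nu>" "finite_energy v \<rho>"
  shows "energy v \<nu> \<le> energy v \<rho>"
proof (cases "\<rho> = \<nu>")
  case False
  then have "free_energy v \<nu> < free_energy v \<rho>"
    using assms(1,3) unfolding free_gibbs_def finite_energy_def by auto
  then show ?thesis
    using assms(2,3) by (simp add: free_energy_eq_energy)
qed auto

text \<open>
  An atom would give the diagonal positive mass.
\<close>

lemma finite_energy_no_atoms:
  assumes "finite_energy v \<nu>"
  shows "AE y in \<nu>. y \<noteq> x"
proof -
  interpret real_distribution \<nu> using assms by (simp add: finite_energy_def)
  interpret P: pair_prob_space \<nu> \<nu> ..
  have "AE a in \<nu>. AE y in \<nu>. a \<noteq> y"
    using P.AE_pair[of "\<lambda>(x, y). x \<noteq> y"] assms by (auto simp: finite_energy_def)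
  then have "AE a in \<nu>. a = x \<longrightarrow> measure \<nu> {x} = 0"
  proof eventually_elim
    case (elim a)
    show ?case
    proof
      assume "a = x"
      then have "AE y in \<nu>. y \<notin> {x}" using elim by (auto elim!: eventually_mono)
      then show "measure \<nu> {x} = 0" by (subst prob_eq_0) auto
    qed
  qed
  then have "AE a in \<nu>. a \<notin> {x}"
    by (cases "measure \<nu> {x} = 0") (auto simp: prob_eq_0 elim: eventually_mono)
  then show ?thesis by auto
qed

section \<open>Push-forwards and the variations of the energy\<close>

lemma finite_energy_distr:
  assumes M: "prob_space M" and Z[measurable]: "Z \<in> borel_measurable M"
    and v[measurable]: "v \<in> borel_measurable borel"
  shows "finite_energy v (distr M borel Z) \<longleftrightarrow> (AE (x, y) in M \<Otimes>\<^sub>M M. Z x \<noteq> Z y) \<and>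
      integrable (M \<Otimes>\<^sub>M M) (\<lambda>(x, y). ln \<bar>Z x - Z y\<bar>) \<and> integrable M (\<lambda>x. v (Z x))"
    and "energy v (distr M borel Z)
      = (\<integral>x. v (Z x) \<partial>M) - (\<integral>(x, y). ln \<bar>Z x - Z y\<bar> \<partial>(M \<Otimes>\<^sub>M M))"
proof -
  interpret prob_space M by fact
  interpret Z: real_distribution "distr M borel Z" by (rule real_distribution_distr) fact
  have *: "distr M borel Z \<Otimes>\<^sub>M distr M borel Z
      = distr (M \<Otimes>\<^sub>M M) (borel \<Otimes>\<^sub>M borel) (\<lambda>(x, y). (Z x, Z y))"
    by (rule pair_measure_distr) (auto intro: Z.sigma_finite_measure_axioms)
  have rd: "real_distribution (distr M borel Z)" by (rule Z.real_distribution_axioms)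
  show "finite_energy v (distr M borel Z) \<longleftrightarrow> (AE (x, y) in M \<Otimes>\<^sub>M M. Z x \<noteq> Z y) \<and>
      integrable (M \<Otimes>\<^sub>M M) (\<lambda>(x, y). ln \<bar>Z x - Z y\<bar>) \<and> integrable M (\<lambda>x. v (Z x))"
    unfolding finite_energy_def * using rd
    by (simp add: integrable_distr_eq AE_distr_iff case_prod_unfold)
  show "energy v (distr M borel Z)
      = (\<integral>x. v (Z x) \<partial>M) - (\<integral>(x, y). ln \<bar>Z x - Z y\<bar> \<partial>(M \<Otimes>\<^sub>M M))"
    unfolding energy_def * by (simp add: integral_distr case_prod_unfold)
qed

text \<open>
  Multiplying by a bounded density keeps all integrals finite, so these perturbations can be used to
  differentiate the energy at a minimizer.
\<close>

lemma energy_density: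
  assumes fin: "finite_energy v \<nu>" and [measurable]: "v \<in> borel_measurable borel"
    and h[measurable]: "h \<in> borel_measurable borel" and hb: "\<And>x. 0 \<le> h x" "\<And>x. h x \<le> B"
    and h1: "(\<integral>x. h x \<partial>\<nu>) = 1"
  shows "finite_energy v (density \<nu> h)"
    and "energy v (density \<nu> h)
      = (\<integral>x. h x * v x \<partial>\<nu>) - (\<integral>(x, y). h x * h y * ln \<bar>x - y\<bar> \<partial>(\<nu> \<Otimes>\<^sub>M \<nu>))"
proof -
  let ?N = "\<nu> \<Otimes>\<^sub>M \<nu>"
  have rd: "real_distribution \<nu>" and diag: "AE (x, y) in ?N. x \<noteq> y"
    and il: "integrable ?N (\<lambda>(x, y). ln \<bar>x - y\<bar>)" and iv: "integrable \<nu> v"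
    using fin by (auto simp: finite_energy_def)
  interpret real_distribution \<nu> by fact
  interpret P: pair_prob_space \<nu> \<nu> ..
  have B0: "B \<ge> 0" using hb[of 0] by linarith
  have ih: "integrable \<nu> h"
    by (rule integrable_const_bound[of _ B]) (use hb in auto)
  have "(\<integral>\<^sup>+x. ennreal (h x) \<partial>\<nu>) = 1"
    using ih h1 hb by (subst nn_integral_eq_integral) auto
  then have pr: "prob_space (density \<nu> h)"
    by (intro prob_spaceI) (simp add: emeasure_density)
  then have rd': "real_distribution (density \<nu> h)"
    by (auto simp: real_distribution_def real_distribution_axioms_def)
  interpret d: real_distribution "density \<nu> h" by fact
  have *: "density \<nu> h \<Otimes>\<^sub>M density \<nu> h = density ?N (\<lambda>p. h (fst p) * h (snd p))"
    using hb by (subst pair_measure_density)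
      (auto simp: case_prod_unfold ennreal_mult intro: sigma_finite_measure_axioms d.sigma_finite_measure_axioms)
  have "integrable ?N (\<lambda>p. (h (fst p) * h (snd p)) *\<^sub>R (case p of (x, y) \<Rightarrow> ln \<bar>x - y\<bar>))"
  proof (rule Bochner_Integration.integrable_bound)
    show "integrable ?N (\<lambda>p. (B * B) * (case p of (x, y) \<Rightarrow> ln \<bar>x - y\<bar>))"
      using il by simp
    show "AE p in ?N. norm ((h (fst p) * h (snd p)) *\<^sub>R (case p of (x, y) \<Rightarrow> ln \<bar>x - y\<bar>))
        \<le> norm ((B * B) * (case p of (x, y) \<Rightarrow> ln \<bar>x - y\<bar>))"
      using hb B0 by (intro AE_I2) (auto simp: abs_mult intro!: mult_mono)
  qed measurable
  then have i1: "integrable (density \<nu> h \<Otimes>\<^sub>M density \<nu> h) (\<lambda>(x, y). ln \<bar>x - y\<bar>)"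
    unfolding * using hb by (subst integrable_density) auto
  have "integrable \<nu> (\<lambda>x. h x *\<^sub>R v x)"
  proof (rule Bochner_Integration.integrable_bound)
    show "integrable \<nu> (\<lambda>x. B * v x)" using iv by simp
    show "AE x in \<nu>. norm (h x *\<^sub>R v x) \<le> norm (B * v x)"
      using hb B0 by (intro AE_I2) (auto simp: abs_mult intro!: mult_mono)
  qed measurable
  then have i2: "integrable (density \<nu> h) v"
    using hb by (subst integrable_density) auto
  have "AE (x, y) in density \<nu> h \<Otimes>\<^sub>M density \<nu> h. x \<noteq> y"
    unfolding * using diag by (subst AE_density) (auto elim: eventually_mono)
  with i1 i2 rd' show "finite_energy v (density \<nu> h)"
    by (simp add: finite_energy_def)
  show "energy v (density \<nu> h)
      = (\<integral>x. h x * v x \<partial>\<nu>) - (\<integral>(x, y). h x * h y * ln \<bar>x - y\<bar> \<partial>?N)"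
    unfolding energy_def * using hb
    by (subst (1 2) integral_density) (auto simp: case_prod_unfold)
qed

text \<open>
  Let \<open>f\<close> be the function that should be constant and \<open>c\<close> its mean.  Removing mass where \<open>f > c\<close> and
  adding it proportionally to \<open>\<nu>\<close> changes the energy at first order by minus the integral of the
  positive part of \<open>f - c\<close>.  Minimality forces this integral to vanish, so \<open>f \<le> c\<close>, and \<open>f\<close> has
  mean \<open>c\<close>.
\<close>

lemma free_gibbs_euler_lagrange:
  assumes G: "free_gibbs v \<nu>" and fin: "finite_energy v \<nu>"
    and vm[measurable]: "v \<in> borel_measurable borel"
  shows "\<exists>c. AE x in \<nu>. v x - 2 * (\<integral>y. ln \<bar>x - y\<bar> \<partial>\<nu>) = c"
proof -
  let ?N = "\<nu> \<Otimes>\<^sub>M \<nu>"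
  have rd: "real_distribution \<nu>"
    and il: "integrable ?N (\<lambda>(x, y). ln \<bar>x - y\<bar>)" and iv: "integrable \<nu> v"
    using fin by (auto simp: finite_energy_def)
  interpret real_distribution \<nu> by fact
  interpret P: pair_prob_space \<nu> \<nu> ..
  define f where "f x = v x - 2 * (\<integral>y. ln \<bar>x - y\<bar> \<partial>\<nu>)" for x
  have fm[measurable]: "f \<in> borel_measurable borel"
    unfolding f_def by measurable
  have iU: "integrable \<nu> (\<lambda>x. \<integral>y. ln \<bar>x - y\<bar> \<partial>\<nu>)"
    using P.integrable_fst[OF il] by simp
  have fi: "integrable \<nu> f" unfolding f_def using iv iU by simp
  define c where "c = (\<integral>x. f x \<partial>\<nu>)"
  define p where "p = measure \<nu> {x. f x > c}"
  define g where "g x = indicator {x. f x > c} x - p" for x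
  have pb: "0 \<le> p" "p \<le> 1" unfolding p_def by (auto intro: prob_le_1)
  have gb: "\<bar>g x\<bar> \<le> 1" for x unfolding g_def using pb by (auto simp: indicator_def)
  have gm[measurable]: "g \<in> borel_measurable borel" unfolding g_def by measurable
  have gi: "integrable \<nu> g"
    by (rule integrable_const_bound[of _ 1]) (use gb in auto)
  have bnd: "integrable M (\<lambda>x. k x * w x)"
    if "integrable M w" "k \<in> borel_measurable M" "\<And>x. \<bar>k x\<bar> \<le> 1" for M :: "'c measure" and k w :: "'c \<Rightarrow> real"
  proof (rule Bochner_Integration.integrable_bound[OF that(1)])
    show "AE x in M. norm (k x * w x) \<le> norm (w x)"
      using that(3) by (intro AE_I2) (auto simp: abs_mult intro!: mult_left_le_one_le)
  qed (use that in auto)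
  have g0: "(\<integral>x. g x \<partial>\<nu>) = 0"
  proof -
    have "integrable \<nu> (indicator {x. f x > c} :: real \<Rightarrow> real)"
      by (rule integrable_const_bound[of _ 1]) auto
    then show ?thesis
      unfolding g_def by (subst Bochner_Integration.integral_diff) (auto simp: p_def prob_space[unfolded space_eq_univ])
  qed
  define L where "L = (\<lambda>(x, y). ln \<bar>x - y :: real\<bar>)"
  have Lm[measurable]: "L \<in> borel_measurable (borel \<Otimes>\<^sub>M borel)" unfolding L_def by measurable
  have iL: "integrable ?N L" using il by (simp add: L_def)
  have ig1: "integrable ?N (\<lambda>p. g (fst p) * L p)"
    and ig2: "integrable ?N (\<lambda>p. g (snd p) * L p)"
    by (auto intro!: bnd iL gb)
  have ig3: "integrable ?N (\<lambda>p. g (fst p) * g (snd p) * L p)"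
    by (intro bnd iL) (auto simp: abs_mult intro!: mult_le_one gb)
  have igv: "integrable \<nu> (\<lambda>x. g x * v x)" by (intro bnd iv) (auto intro: gb)
  define A where "A = (\<integral>x. g x * v x \<partial>\<nu>) - 2 * (\<integral>p. g (fst p) * L p \<partial>?N)"
  define B where "B = (\<integral>p. g (fst p) * g (snd p) * L p \<partial>?N)"
  have sym: "(\<integral>p. g (snd p) * L p \<partial>?N) = (\<integral>p. g (fst p) * L p \<partial>?N)"
    using P.integral_product_swap[of "\<lambda>p. g (fst p) * L p"]
    by (simp add: L_def case_prod_unfold abs_minus_commute)
  \<comment> \<open>\<open>- A\<close> is the derivative of the energy along the density \<open>1 - s g\<close>, and \<open>- B\<close> half the second one.\<close>
  have quad: "A \<le> - s * B" if s: "0 < s" "s < 1" for s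
  proof -
    have hb: "0 \<le> 1 - s * g x" "1 - s * g x \<le> 2" for x
    proof -
      have "\<bar>s * g x\<bar> \<le> 1" using gb[of x] s by (simp add: abs_mult mult_le_one)
      then show "0 \<le> 1 - s * g x" "1 - s * g x \<le> 2" by auto
    qed
    have h1: "(\<integral>x. 1 - s * g x \<partial>\<nu>) = 1"
      using gi g0 by (simp add: prob_space[unfolded space_eq_univ])
    have fin': "finite_energy v (density \<nu> (\<lambda>x. 1 - s * g x))"
      by (rule energy_density[OF fin vm _ hb h1]) measurable
    have "energy v (density \<nu> (\<lambda>x. 1 - s * g x)) = (\<integral>x. (1 - s * g x) * v x \<partial>\<nu>)
        - (\<integral>(x, y). (1 - s * g x) * (1 - s * g y) * ln \<bar>x - y\<bar> \<partial>?N)"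
      by (rule energy_density[OF fin vm _ hb h1]) measurable
    also have "(\<integral>x. (1 - s * g x) * v x \<partial>\<nu>) = (\<integral>x. v x \<partial>\<nu>) - s * (\<integral>x. g x * v x \<partial>\<nu>)"
    proof -
      have "(\<integral>x. (1 - s * g x) * v x \<partial>\<nu>) = (\<integral>x. v x - s * (g x * v x) \<partial>\<nu>)"
        by (simp add: algebra_simps)
      also have "\<dots> = (\<integral>x. v x \<partial>\<nu>) - s * (\<integral>x. g x * v x \<partial>\<nu>)"
        using iv igv by simp
      finally show ?thesis .
    qed
    also have "(\<integral>(x, y). (1 - s * g x) * (1 - s * g y) * ln \<bar>x - y\<bar> \<partial>?N)
        = (\<integral>p. L p - s * (g (fst p) * L p) - s * (g (snd p) * L p)
            + s\<^sup>2 * (g (fst p) * g (snd p) * L p) \<partial>?N)"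
      by (intro Bochner_Integration.integral_cong) (auto simp: L_def algebra_simps power2_eq_square)
    also have "\<dots> = (\<integral>p. L p \<partial>?N) - 2 * s * (\<integral>p. g (fst p) * L p \<partial>?N) + s\<^sup>2 * B"
      using iL ig1 ig2 ig3 by (simp add: sym B_def)
    finally have "energy v (density \<nu> (\<lambda>x. 1 - s * g x)) = energy v \<nu> - s * A - s\<^sup>2 * B"
      by (simp add: energy_def A_def L_def algebra_simps)
    moreover have "energy v \<nu> \<le> energy v (density \<nu> (\<lambda>x. 1 - s * g x))"
      by (rule free_gibbs_energy_le[OF G fin fin'])
    ultimately have "s * (A + s * B) \<le> 0" by (simp add: power2_eq_square algebra_simps)
    with s have "A + s * B \<le> 0" by (simp add: mult_le_0_iff)
    then show ?thesis by simp
  qed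
  have "A \<le> 0"
  proof (rule tendsto_lowerbound)
    show "((\<lambda>s. - s * B) \<longlongrightarrow> 0) (at_right 0)" by (auto intro!: tendsto_eq_intros)
    have "\<forall>\<^sub>F s in at_right (0::real). s < 1 \<and> s > 0"
      by (auto simp: eventually_at_right_field intro!: exI[of _ 1])
    then show "\<forall>\<^sub>F s in at_right 0. A \<le> - s * B" by eventually_elim (use quad in auto)
  qed simp
  have igf: "integrable \<nu> (\<lambda>x. g x * f x)" by (intro bnd fi) (auto intro: gb)
  have "A = (\<integral>x. g x * f x \<partial>\<nu>)"
  proof -
    have "(\<integral>p. g (fst p) * L p \<partial>?N) = (\<integral>x. \<integral>y. g x * L (x, y) \<partial>\<nu> \<partial>\<nu>)"
      using P.integral_fst'[OF ig1] by simp
    also have "\<dots> = (\<integral>x. g x * (\<integral>y. ln \<bar>x - y\<bar> \<partial>\<nu>) \<partial>\<nu>)" by (simp add: L_def)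
    finally have 1: "(\<integral>p. g (fst p) * L p \<partial>?N) = (\<integral>x. g x * (\<integral>y. ln \<bar>x - y\<bar> \<partial>\<nu>) \<partial>\<nu>)" .
    have i: "integrable \<nu> (\<lambda>x. g x * (\<integral>y. ln \<bar>x - y\<bar> \<partial>\<nu>))" by (intro bnd iU) (auto intro: gb)
    have "(\<integral>x. g x * f x \<partial>\<nu>) = (\<integral>x. g x * v x - 2 * (g x * (\<integral>y. ln \<bar>x - y\<bar> \<partial>\<nu>)) \<partial>\<nu>)"
      by (simp add: f_def algebra_simps)
    also have "\<dots> = (\<integral>x. g x * v x \<partial>\<nu>) - 2 * (\<integral>x. g x * (\<integral>y. ln \<bar>x - y\<bar> \<partial>\<nu>) \<partial>\<nu>)"
      using igv i by simp
    finally show ?thesis using 1 by (simp add: A_def)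
  qed
  moreover have "(\<integral>x. max 0 (f x - c) \<partial>\<nu>) = (\<integral>x. g x * f x \<partial>\<nu>)"
  proof -
    have "(\<integral>x. max 0 (f x - c) \<partial>\<nu>) = (\<integral>x. (g x * f x - c * g x) + p * (f x - c) \<partial>\<nu>)"
      by (intro Bochner_Integration.integral_cong) (auto simp: g_def indicator_def algebra_simps)
    also have "\<dots> = (\<integral>x. g x * f x \<partial>\<nu>)"
      using igf gi fi g0 by (simp add: c_def prob_space[unfolded space_eq_univ])
    finally show ?thesis .
  qed
  moreover have ic: "integrable \<nu> (\<lambda>x. max 0 (f x - c))" using fi by auto
  moreover have "(\<integral>x. max 0 (f x - c) \<partial>\<nu>) \<ge> 0" by (rule Bochner_Integration.integral_nonneg) simp
  ultimately have "(\<integral>x. max 0 (f x - c) \<partial>\<nu>) = 0" using \<open>A \<le> 0\<close> by simp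
  then have "AE x in \<nu>. max 0 (f x - c) = 0"
    using integral_nonneg_eq_0_iff_AE[OF ic] by simp
  then have le: "AE x in \<nu>. 0 \<le> c - f x" by eventually_elim (simp add: max_def split: if_splits)
  moreover have "(\<integral>x. c - f x \<partial>\<nu>) = 0"
    using fi by (simp add: c_def prob_space[unfolded space_eq_univ])
  ultimately have "AE x in \<nu>. c - f x = 0"
    using fi by (subst (asm) integral_nonneg_eq_0_iff_AE) auto
  then have "AE x in \<nu>. f x = c" by auto
  then show ?thesis unfolding f_def by blast
qed

text \<open>
  Translating the part of \<open>\<nu>\<close> on \<open>A\<close> by \<open>t\<close> does not lower the energy.  The interaction inside \<open>A\<close>
  is unchanged, so only the interaction between \<open>A\<close> and its complement and the potential on \<open>A\<close>
  contribute.  The inequality holds on average over \<open>A\<close>; it is stated for a single point of \<open>A\<close>,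
  which may be chosen in any set \<open>P\<close> of full measure.
\<close>

lemma free_gibbs_push:
  assumes G: "free_gibbs v \<nu>" and fin: "finite_energy v \<nu>"
    and vm[measurable]: "v \<in> borel_measurable borel"
    and A[measurable]: "A \<in> sets borel" and Apos: "measure \<nu> A > 0" and P: "AE x in \<nu>. P x"
    and sep: "AE (x, y) in \<nu> \<Otimes>\<^sub>M \<nu>. x \<in> A \<longrightarrow> y \<notin> A \<longrightarrow>
      x + t \<noteq> y \<and> \<bar>ln \<bar>x + t - y\<bar>\<bar> \<le> \<bar>ln \<bar>x - y\<bar>\<bar> + C"
    and vb: "AE x in \<nu>. x \<in> A \<longrightarrow> \<bar>v (x + t)\<bar> \<le> C"
  obtains x where "x \<in> A" "P x"
    "integrable \<nu> (\<lambda>y. indicator (- A) y * (ln \<bar>x + t - y\<bar> - ln \<bar>x - y\<bar>))"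
    "2 * (\<integral>y. indicator (- A) y * (ln \<bar>x + t - y\<bar> - ln \<bar>x - y\<bar>) \<partial>\<nu>) \<le> v (x + t) - v x"
proof -
  let ?N = "\<nu> \<Otimes>\<^sub>M \<nu>"
  have rd: "real_distribution \<nu>" and diag: "AE (x, y) in ?N. x \<noteq> y"
    and il: "integrable ?N (\<lambda>(x, y). ln \<bar>x - y\<bar>)" and iv: "integrable \<nu> v"
    using fin by (auto simp: finite_energy_def)
  interpret real_distribution \<nu> by fact
  interpret P: pair_prob_space \<nu> \<nu> ..
  define L where "L = (\<lambda>p. ln \<bar>fst p - snd p :: real\<bar>)"
  define E where "E = (\<lambda>p. indicator A (fst p) * (indicator (- A) (snd p) *
     (ln \<bar>fst p + t - snd p\<bar> - ln \<bar>fst p - snd p\<bar>)) :: real)"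
  have Em[measurable]: "E \<in> borel_measurable (borel \<Otimes>\<^sub>M borel)" unfolding E_def by measurable
  have iL: "integrable ?N L" using il by (simp add: L_def case_prod_unfold)
  have iE: "integrable ?N E"
  proof (rule Bochner_Integration.integrable_bound)
    show "integrable ?N (\<lambda>p. 2 * \<bar>L p\<bar> + \<bar>C\<bar>)" using iL by simp
    show "AE p in ?N. norm (E p) \<le> norm (2 * \<bar>L p\<bar> + \<bar>C\<bar>)"
      using sep by eventually_elim
        (auto simp: E_def L_def indicator_def intro!: order_trans[OF abs_triangle_ineq4])
  qed measurable
  have iE': "integrable ?N (\<lambda>p. E (snd p, fst p))"
    using P.integrable_product_swap[OF iE] by (simp add: case_prod_unfold)
  have sym: "(\<integral>p. E (snd p, fst p) \<partial>?N) = (\<integral>p. E p \<partial>?N)"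
    using P.integral_product_swap[of E] by (simp add: case_prod_unfold)
  define W where "W x = indicator A x * (v (x + t) - v x)" for x
  have iW: "integrable \<nu> W"
  proof (rule Bochner_Integration.integrable_bound)
    show "integrable \<nu> (\<lambda>x. \<bar>v x\<bar> + \<bar>C\<bar>)" using iv by simp
    show "AE x in \<nu>. norm (W x) \<le> norm (\<bar>v x\<bar> + \<bar>C\<bar>)"
      using vb by eventually_elim (auto simp: W_def indicator_def)
    show "W \<in> borel_measurable \<nu>" unfolding W_def by measurable
  qed
  define Z where "Z x = x + t * indicator A x" for x
  have Zm[measurable]: "Z \<in> borel_measurable borel" unfolding Z_def by measurable
  have Zm': "Z \<in> borel_measurable \<nu>" by measurable
  have lnZ: "ln \<bar>Z (fst p) - Z (snd p)\<bar> = L p + E p + E (snd p, fst p)" for p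
    by (auto simp: Z_def L_def E_def indicator_def abs_minus_commute algebra_simps)
  have vZ: "v (Z x) = v x + W x" for x by (auto simp: Z_def W_def indicator_def)
  have sep': "AE p in ?N. snd p \<in> A \<longrightarrow> fst p \<notin> A \<longrightarrow> snd p + t \<noteq> fst p"
  proof -
    have S: "{p \<in> space ?N. fst p \<in> A \<longrightarrow> snd p \<notin> A \<longrightarrow> fst p + t \<noteq> snd p}
        \<in> sets ?N"
      by measurable
    have "AE p in distr ?N ?N (\<lambda>(x, y). (y, x)). fst p \<in> A \<longrightarrow> snd p \<notin> A \<longrightarrow> fst p + t \<noteq> snd p"
      unfolding P.distr_pair_swap[symmetric] using sep by eventually_elim auto
    then show ?thesis
      unfolding AE_distr_iff[OF measurable_pair_swap' S] by (simp add: case_prod_unfold)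
  qed
  have finZ: "finite_energy v (distr \<nu> borel Z)"
    unfolding finite_energy_distr(1)[OF prob_space_axioms Zm' vm]
  proof (intro conjI)
    show "AE (x, y) in ?N. Z x \<noteq> Z y"
      using diag sep sep' by eventually_elim (auto simp: Z_def split: split_indicator_asm)
    show "integrable ?N (\<lambda>(x, y). ln \<bar>Z x - Z y\<bar>)"
      using lnZ iL iE iE' by (simp add: case_prod_unfold)
    show "integrable \<nu> (\<lambda>x. v (Z x))" using iv iW by (simp add: vZ)
  qed
  have iI: "integrable \<nu> (\<lambda>x. \<integral>y. E (x, y) \<partial>\<nu>)"
    using P.integrable_fst'[OF iE] by simp
  define g where "g x = W x - 2 * (\<integral>y. E (x, y) \<partial>\<nu>)" for x
  have ig: "integrable \<nu> g" unfolding g_def using iW iI by simp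
  have "energy v \<nu> \<le> energy v (distr \<nu> borel Z)"
    by (rule free_gibbs_energy_le[OF G fin finZ])
  also have "\<dots> = energy v \<nu> + (\<integral>x. g x \<partial>\<nu>)"
    unfolding finite_energy_distr(2)[OF prob_space_axioms Zm' vm] energy_def[of v \<nu>] g_def
    using iv iW iL iE iE' iI P.integral_fst'[OF iE] lnZ
    by (simp add: vZ case_prod_unfold sym L_def)
  finally have g0: "(\<integral>x. g x \<partial>\<nu>) \<ge> 0" by simp
  have gA: "g x = 0" if "x \<notin> A" for x using that by (simp add: g_def W_def E_def)
  have "\<not> (AE x in \<nu>. x \<in> A \<longrightarrow> g x < 0)"
  proof
    assume *: "AE x in \<nu>. x \<in> A \<longrightarrow> g x < 0"
    then have le: "AE x in \<nu>. 0 \<le> - g x"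
      by eventually_elim (use gA in force)
    then have "(\<integral>x. - g x \<partial>\<nu>) \<ge> 0" by (rule integral_nonneg_AE)
    then have "(\<integral>x. - g x \<partial>\<nu>) = 0" using g0 ig by simp
    then have "AE x in \<nu>. - g x = 0"
      using ig le by (subst (asm) integral_nonneg_eq_0_iff_AE) auto
    then have "AE x in \<nu>. x \<notin> A" using * by eventually_elim auto
    then have "measure \<nu> A = 0" by (subst prob_eq_0) auto
    with Apos show False by simp
  qed
  moreover have "AE x in \<nu>. P x \<and> integrable \<nu> (\<lambda>y. E (x, y))"
    using P P.AE_integrable_fst'[OF iE] by eventually_elim auto
  ultimately have "\<exists>x. (P x \<and> integrable \<nu> (\<lambda>y. E (x, y))) \<and> x \<in> A \<and> g x \<ge> 0"
    by (smt (verit, best) eventually_mono)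
  then obtain x where x: "x \<in> A" "P x" "integrable \<nu> (\<lambda>y. E (x, y))" "g x \<ge> 0" by blast
  show thesis
    by (rule that[of x]) (use x in \<open>auto simp: g_def W_def E_def\<close>)
qed

section \<open>The support of a free Gibbs measure\<close>

text \<open>
  In the Euler--Lagrange equation the potential grows linearly and the logarithmic potential of \<open>\<nu>\<close>
  only logarithmically, so the equation cannot hold far away from the origin.
\<close>

lemma free_gibbs_bounded_support:
  assumes G: "free_gibbs v \<nu>" and fin: "finite_energy v \<nu>"
    and vm: "v \<in> borel_measurable borel" and co: "coercive v"
  obtains R where "AE x in \<nu>. \<bar>x\<bar> \<le> R"
proof -
  have rd: "real_distribution \<nu>"
    and il: "integrable (\<nu> \<Otimes>\<^sub>M \<nu>) (\<lambda>(x, y). ln \<bar>x - y\<bar>)" and iv: "integrable \<nu> v"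
    using fin by (auto simp: finite_energy_def)
  interpret real_distribution \<nu> by fact
  interpret P: pair_prob_space \<nu> \<nu> ..
  obtain c where c: "AE x in \<nu>. v x - 2 * (\<integral>y. ln \<bar>x - y\<bar> \<partial>\<nu>) = c"
    using free_gibbs_euler_lagrange[OF G fin vm] by blast
  obtain \<kappa> C where \<kappa>: "\<kappa> > 0" "\<And>x. \<kappa> * \<bar>x\<bar> - C \<le> v x"
    using co unfolding coercive_def by blast
  have ia: "integrable \<nu> (\<lambda>x. \<bar>x\<bar>)" by (rule integrable_abs_of_coercive[OF co rd iv])
  have ilog: "integrable \<nu> (\<lambda>y. ln (1 + \<bar>y\<bar>))"
  proof (rule Bochner_Integration.integrable_bound[OF ia])
    show "AE y in \<nu>. norm (ln (1 + \<bar>y\<bar>)) \<le> norm \<bar>y\<bar>"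
      by (intro AE_I2) (auto simp: ln_add_one_self_le_self)
  qed measurable
  define J where "J = (\<integral>y. ln (1 + \<bar>y\<bar>) \<partial>\<nu>)"
  \<comment> \<open>\<open>R\<close> solves \<open>\<kappa> R - C = c + 2 J + l\<close>, where \<open>l\<close> bounds \<open>2 ln (1 + R)\<close> by its tangent of slope \<open>\<kappa> / 2\<close>.\<close>
  define R where "R = (C + c + 2 * J + \<kappa> / 2 - 2 - 2 * ln (\<kappa> / 4)) / (\<kappa> / 2)"
  have "AE x in \<nu>. \<bar>x\<bar> \<le> R"
    using c P.AE_integrable_fst[OF il]
  proof eventually_elim
    case (elim x)
    have ln_le: "ln \<bar>x - y\<bar> \<le> ln (1 + \<bar>x\<bar>) + ln (1 + \<bar>y\<bar>)" for y
    proof (cases "x = y")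
      case False
      have "\<bar>x - y\<bar> \<le> (1 + \<bar>x\<bar>) * (1 + \<bar>y\<bar>)"
      proof -
        have "0 \<le> \<bar>x\<bar> * \<bar>y\<bar>" by simp
        moreover have "(1 + \<bar>x\<bar>) * (1 + \<bar>y\<bar>) = 1 + \<bar>x\<bar> + \<bar>y\<bar> + \<bar>x\<bar> * \<bar>y\<bar>"
          by (simp add: algebra_simps)
        ultimately show ?thesis by linarith
      qed
      then have "ln \<bar>x - y\<bar> \<le> ln ((1 + \<bar>x\<bar>) * (1 + \<bar>y\<bar>))"
        using False by (intro ln_mono) auto
      also have "\<dots> = ln (1 + \<bar>x\<bar>) + ln (1 + \<bar>y\<bar>)" by (intro ln_mult_pos) auto
      finally show ?thesis .
    qed simp
    have "(\<integral>y. ln \<bar>x - y\<bar> \<partial>\<nu>) \<le> (\<integral>y. ln (1 + \<bar>x\<bar>) + ln (1 + \<bar>y\<bar>) \<partial>\<nu>)"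
      using elim(2) ilog ln_le by (intro integral_mono) auto
    also have "\<dots> = ln (1 + \<bar>x\<bar>) + J"
      using ilog by (simp add: J_def prob_space[unfolded space_eq_univ])
    finally have 1: "\<kappa> * \<bar>x\<bar> - C \<le> c + 2 * J + 2 * ln (1 + \<bar>x\<bar>)"
      using elim(1) \<kappa>(2)[of x] by linarith
    have "ln ((1 + \<bar>x\<bar>) * (\<kappa> / 4)) \<le> (1 + \<bar>x\<bar>) * (\<kappa> / 4) - 1"
      using \<kappa>(1) by (intro ln_le_minus_one mult_pos_pos) auto
    moreover have "ln ((1 + \<bar>x\<bar>) * (\<kappa> / 4)) = ln (1 + \<bar>x\<bar>) + ln (\<kappa> / 4)"
      using \<kappa>(1) by (intro ln_mult_pos) auto
    moreover have "(1 + \<bar>x\<bar>) * (\<kappa> / 4) = \<kappa> / 4 + \<kappa> * \<bar>x\<bar> / 4" by (simp add: algebra_simps)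
    ultimately have "\<kappa> * \<bar>x\<bar> / 2 \<le> C + c + 2 * J + \<kappa> / 2 - 2 - 2 * ln (\<kappa> / 4)"
      using 1 by linarith
    then show ?case using \<kappa>(1) by (simp add: R_def pos_le_divide_eq mult.commute)
  qed
  then show thesis by (rule that)
qed

lemma atomless_small_mass:
  assumes rd: "real_distribution \<nu>" and atoms: "AE y in \<nu>. y \<noteq> x" and "\<eta> > 0" "t > 0"
  obtains h where "0 < h" "h \<le> t" "measure \<nu> {x - h<..<x + h} < \<eta>"
proof -
  interpret real_distribution \<nu> by fact
  define A where "A n = {x - t / real (Suc n)<..<x + t / real (Suc n)}" for n
  have "(\<lambda>n. measure \<nu> (A n)) \<longlonglongrightarrow> measure \<nu> (\<Inter>n. A n)"
  proof (rule finite_Lim_measure_decseq)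
    show "range A \<subseteq> events" by (auto simp: A_def)
    show "decseq A"
    proof (rule decseq_SucI)
      fix n
      have "t / real (Suc (Suc n)) \<le> t / real (Suc n)" using \<open>t > 0\<close> by (intro divide_left_mono) auto
      then show "A (Suc n) \<subseteq> A n" by (auto simp: A_def)
    qed
  qed
  also have "(\<Inter>n. A n) = {x}"
  proof -
    have "y = x" if "\<And>n. y \<in> A n" for y
    proof (rule ccontr)
      assume "y \<noteq> x"
      then have "\<bar>y - x\<bar> / t > 0" using \<open>t > 0\<close> by simp
      then obtain n where "inverse (real (Suc n)) < \<bar>y - x\<bar> / t" using reals_Archimedean by blast
      then have "t / real (Suc n) < \<bar>y - x\<bar>" using \<open>t > 0\<close> by (simp add: field_simps)
      then show False using that[of n] by (auto simp: A_def abs_if split: if_splits)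
    qed
    then show ?thesis using \<open>t > 0\<close> by (auto simp: A_def)
  qed
  also have "measure \<nu> {x} = 0"
    using atoms by (subst prob_eq_0) (auto elim: eventually_mono)
  finally have "\<forall>\<^sub>F n in sequentially. measure \<nu> (A n) < \<eta>"
    using \<open>\<eta> > 0\<close> by (rule order_tendstoD)
  then obtain n where "measure \<nu> (A n) < \<eta>" by (auto simp: eventually_sequentially)
  moreover have "t / real (Suc n) \<le> t" using \<open>t > 0\<close> by (simp add: divide_le_eq)
  ultimately show thesis using \<open>t > 0\<close> by (intro that[of "t / real (Suc n)"]) (auto simp: A_def)
qed

text \<open>
  If two points at distances \<open>p < r\<close> on the same side of a third one approach each other by \<open>t\<close>
  each, the product of the distances grows at least by \<open>t\<^sup>2\<close>.
\<close>

lemma contraction_log_gain: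
  fixes p r t D :: real
  assumes "0 < p" "0 < r" "p \<le> D" "r \<le> D" "0 < t" "r - p \<ge> 2 * t"
  shows "ln (1 + t\<^sup>2 / D\<^sup>2) \<le> (ln (p + t) - ln p) + (ln (r - t) - ln r)"
proof -
  have rt: "r - t > 0" using assms by linarith
  have pr: "p * r \<le> D\<^sup>2" "p * r > 0" using assms by (auto simp: power2_eq_square intro: mult_mono)
  have "t * t \<le> t * (r - p - t)" using assms by (intro mult_left_mono) auto
  then have *: "p * r + t\<^sup>2 \<le> (p + t) * (r - t)" by (simp add: algebra_simps power2_eq_square)
  have "1 + t\<^sup>2 / D\<^sup>2 \<le> 1 + t\<^sup>2 / (p * r)"
    using assms pr(1) by (intro add_left_mono divide_left_mono mult_pos_pos) auto
  also have "\<dots> = (p * r + t\<^sup>2) / (p * r)" using assms(1,2) by (simp add: add_divide_distrib)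
  also have "\<dots> \<le> ((p + t) * (r - t)) / (p * r)" using * pr by (intro divide_right_mono) auto
  finally have "ln (1 + t\<^sup>2 / D\<^sup>2) \<le> ln (((p + t) * (r - t)) / (p * r))"
    by (intro ln_mono) (auto intro: add_pos_nonneg)
  also have "\<dots> = (ln (p + t) - ln p) + (ln (r - t) - ln r)"
    using assms rt by (simp add: ln_div ln_mult)
  finally show ?thesis .
qed

lemma convex_contract:
  fixes v :: "real \<Rightarrow> real"
  assumes "convex_on UNIV v" "0 < t" "t \<le> y - x"
  shows "v (x + t) + v (y - t) \<le> v x + v y"
proof -
  define l where "l = t / (y - x)"
  have l: "0 \<le> l" "l \<le> 1" "l * (y - x) = t" using assms by (auto simp: l_def)
  have "v ((1 - l) *\<^sub>R x + l *\<^sub>R y) \<le> (1 - l) * v x + l * v y"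
    by (rule convex_onD[OF assms(1)]) (use l in auto)
  moreover have "v ((1 - l) *\<^sub>R y + l *\<^sub>R x) \<le> (1 - l) * v y + l * v x"
    by (rule convex_onD[OF assms(1)]) (use l in auto)
  moreover have "(1 - l) *\<^sub>R x + l *\<^sub>R y = x + t" "(1 - l) *\<^sub>R y + l *\<^sub>R x = y - t"
    using l(3) by (simp_all add: algebra_simps)
  ultimately show ?thesis by (simp add: algebra_simps)
qed

text \<open>
  Small masses \<open>A\<close> and \<open>B\<close> at the two ends of the gap are moved to its middle.  By convexity the
  potential energy of a point of \<open>A\<close> and a point of \<open>B\<close> together does not increase.  The interaction
  with the mass outside \<open>A\<close> and \<open>B\<close> improves by a fixed amount \<open>\<kappa>\<close> per unit of mass
  (\<open>contraction_log_gain\<close>), and the loss in the interaction between \<open>A\<close> and \<open>B\<close> is of the order of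
  their mass, which can be made as small as desired because there are no atoms.
\<close>

lemma free_gibbs_no_gap:
  assumes G: "free_gibbs v \<nu>" and fin: "finite_energy v \<nu>"
    and cv: "convex_on UNIV v" and cont: "continuous_on UNIV v"
    and bdd: "AE x in \<nu>. \<bar>x\<bar> \<le> R" and gap: "AE x in \<nu>. x \<notin> {c<..<d}" and cd: "c < d"
    and left: "\<And>h. h > 0 \<Longrightarrow> measure \<nu> {c - h<..c} > 0"
    and right: "\<And>h. h > 0 \<Longrightarrow> measure \<nu> {d..<d + h} > 0"
  shows False
proof -
  let ?N = "\<nu> \<Otimes>\<^sub>M \<nu>"
  have rd: "real_distribution \<nu>" using fin by (simp add: finite_energy_def)
  interpret real_distribution \<nu> by fact
  interpret P: pair_prob_space \<nu> \<nu> ..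
  have vm: "v \<in> borel_measurable borel" using cont by (rule borel_measurable_continuous_onI)
  define t where "t = (d - c) / 2"
  have t: "t > 0" using cd by (simp add: t_def)
  define D where "D = 2 * \<bar>R\<bar> + 1"
  define \<kappa> where "\<kappa> = ln (1 + t\<^sup>2 / D\<^sup>2)"
  have D: "D > 0" by (simp add: D_def)
  have \<kappa>: "\<kappa> > 0" unfolding \<kappa>_def using t D by (intro ln_gt_zero) (simp add: zero_less_divide_iff)
  \<comment> \<open>The mass \<open>\<eta>\<close> is so small that the loss \<open>2 \<eta> (\<kappa> + ln 4)\<close> is at most half of the gain \<open>\<kappa>\<close>.\<close>
  define \<eta> where "\<eta> = \<kappa> / (4 * (\<kappa> + ln 4))"
  have ln4: "ln 4 > (0::real)" by simp
  have \<eta>: "\<eta> > 0" using \<kappa> ln4 by (auto simp: \<eta>_def intro!: divide_pos_pos add_pos_pos)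
  note atoms = finite_energy_no_atoms[OF fin]
  obtain h1 where h1: "0 < h1" "h1 \<le> t" "measure \<nu> {c - h1<..<c + h1} < \<eta>"
    by (rule atomless_small_mass[OF rd atoms \<eta> t])
  obtain h2 where h2: "0 < h2" "h2 \<le> t" "measure \<nu> {d - h2<..<d + h2} < \<eta>"
    by (rule atomless_small_mass[OF rd atoms \<eta> t])
  define h where "h = min h1 h2"
  have h: "0 < h" "h \<le> t" "h \<le> h1" "h \<le> h2" using h1 h2 by (auto simp: h_def)
  define A where "A = {c - h<..c}"
  define B where "B = {d..<d + h}"
  have AB[measurable]: "A \<in> sets borel" "B \<in> sets borel" by (auto simp: A_def B_def)
  have mA: "measure \<nu> A < \<eta>"
    by (rule le_less_trans[OF finite_measure_mono h1(3)]) (use h h1 in \<open>auto simp: A_def\<close>)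
  have mB: "measure \<nu> B < \<eta>"
    by (rule le_less_trans[OF finite_measure_mono h2(3)]) (use h h2 in \<open>auto simp: B_def\<close>)
  obtain C1 where C1: "\<And>x. x \<in> {- \<bar>R\<bar> - t..\<bar>R\<bar> + t} \<Longrightarrow> \<bar>v x\<bar> \<le> C1"
    using continuous_bounded_interval[OF cont] by blast
  define C where "C = max C1 (\<bar>ln t\<bar> + \<bar>ln (D + t)\<bar>)"
  have lnb: "w \<noteq> 0 \<and> \<bar>ln \<bar>w\<bar>\<bar> \<le> \<bar>ln z\<bar> + C" if "t \<le> \<bar>w\<bar>" "\<bar>w\<bar> \<le> D + t" for w z
  proof -
    have "ln t \<le> ln \<bar>w\<bar>" "ln \<bar>w\<bar> \<le> ln (D + t)" using that t by (auto intro!: ln_mono)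
    then have "\<bar>ln \<bar>w\<bar>\<bar> \<le> \<bar>ln t\<bar> + \<bar>ln (D + t)\<bar>" by linarith
    also have "\<dots> \<le> C" by (simp add: C_def)
    finally show ?thesis using that t by auto
  qed
  have vb: "\<bar>v (x + s)\<bar> \<le> C" if "\<bar>x\<bar> \<le> R" "\<bar>s\<bar> \<le> t" for x s
  proof -
    have "x + s \<in> {- \<bar>R\<bar> - t..\<bar>R\<bar> + t}" using that by auto
    from C1[OF this] show ?thesis by (simp add: C_def)
  qed
  have AE2: "AE p in ?N. (\<bar>fst p\<bar> \<le> R \<and> fst p \<notin> {c<..<d}) \<and> \<bar>snd p\<bar> \<le> R \<and> snd p \<notin> {c<..<d}"
  proof (rule P.AE_pair_measure)
    show "{p \<in> space ?N. (\<bar>fst p\<bar> \<le> R \<and> fst p \<notin> {c<..<d}) \<and> \<bar>snd p\<bar> \<le> R \<and> snd p \<notin> {c<..<d}}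
      \<in> sets ?N" by measurable
    have 1: "AE x in \<nu>. \<bar>x\<bar> \<le> R \<and> x \<notin> {c<..<d}" using bdd gap by eventually_elim auto
    then show "AE x in \<nu>. AE y in \<nu>. (\<bar>fst (x, y)\<bar> \<le> R \<and> fst (x, y) \<notin> {c<..<d}) \<and>
        \<bar>snd (x, y)\<bar> \<le> R \<and> snd (x, y) \<notin> {c<..<d}"
      by eventually_elim (use 1 in \<open>auto elim: eventually_mono\<close>)
  qed
  have td: "d = c + 2 * t" by (simp add: t_def field_simps)
  obtain x where x: "x \<in> A" "\<bar>x\<bar> \<le> R"
    "integrable \<nu> (\<lambda>z. indicator (- A) z * (ln \<bar>x + t - z\<bar> - ln \<bar>x - z\<bar>))"
    "2 * (\<integral>z. indicator (- A) z * (ln \<bar>x + t - z\<bar> - ln \<bar>x - z\<bar>) \<partial>\<nu>) \<le> v (x + t) - v x"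
  proof (rule free_gibbs_push[OF G fin vm AB(1) _ bdd])
    show "measure \<nu> A > 0" using left h by (simp add: A_def)
    show "AE (x, y) in ?N. x \<in> A \<longrightarrow> y \<notin> A \<longrightarrow> x + t \<noteq> y \<and> \<bar>ln \<bar>x + t - y\<bar>\<bar> \<le> \<bar>ln \<bar>x - y\<bar>\<bar> + C"
      using AE2
    proof eventually_elim
      case (elim p)
      show ?case
      proof (clarsimp split: prod.split)
        fix x y assume p: "p = (x, y)" and xy: "x \<in> A" "y \<notin> A"
        have "t \<le> \<bar>x + t - y\<bar>" using elim xy t by (auto simp: A_def p td)
        moreover have "\<bar>x + t - y\<bar> \<le> D + t" using elim t by (auto simp: p D_def)
        ultimately show "x + t \<noteq> y \<and> \<bar>ln \<bar>x + t - y\<bar>\<bar> \<le> \<bar>ln \<bar>x - y\<bar>\<bar> + C" using lnb by fastforce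
      qed
    qed
    show "AE x in \<nu>. x \<in> A \<longrightarrow> \<bar>v (x + t)\<bar> \<le> C"
      using bdd by eventually_elim (use vb t in auto)
  qed
  obtain y where y: "y \<in> B" "\<bar>y\<bar> \<le> R"
    "integrable \<nu> (\<lambda>z. indicator (- B) z * (ln \<bar>y + - t - z\<bar> - ln \<bar>y - z\<bar>))"
    "2 * (\<integral>z. indicator (- B) z * (ln \<bar>y + - t - z\<bar> - ln \<bar>y - z\<bar>) \<partial>\<nu>) \<le> v (y + - t) - v y"
  proof (rule free_gibbs_push[OF G fin vm AB(2) _ bdd])
    show "measure \<nu> B > 0" using right h by (simp add: B_def)
    show "AE (x, y) in ?N. x \<in> B \<longrightarrow> y \<notin> B \<longrightarrow> x + - t \<noteq> y \<and> \<bar>ln \<bar>x + - t - y\<bar>\<bar> \<le> \<bar>ln \<bar>x - y\<bar>\<bar> + C"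
      using AE2
    proof eventually_elim
      case (elim p)
      show ?case
      proof (clarsimp split: prod.split)
        fix x y assume p: "p = (x, y)" and xy: "x \<in> B" "y \<notin> B"
        have "t \<le> \<bar>x - t - y\<bar>" using elim xy t by (auto simp: B_def p td)
        moreover have "\<bar>x - t - y\<bar> \<le> D + t" using elim t by (auto simp: p D_def)
        ultimately show "x - t \<noteq> y \<and> \<bar>ln \<bar>x - t - y\<bar>\<bar> \<le> \<bar>ln \<bar>x - y\<bar>\<bar> + C" using lnb by fastforce
      qed
    qed
    show "AE x in \<nu>. x \<in> B \<longrightarrow> \<bar>v (x + - t)\<bar> \<le> C"
      using bdd by eventually_elim (use vb[of _ "- t"] t in auto)
  qed
  define F where "F z = indicator (- A) z * (ln \<bar>x + t - z\<bar> - ln \<bar>x - z\<bar>)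
    + indicator (- B) z * (ln \<bar>y + - t - z\<bar> - ln \<bar>y - z\<bar>)" for z
  have iF: "integrable \<nu> F" unfolding F_def using x(3) y(3) by simp
  have "v (x + t) + v (y - t) \<le> v x + v y"
    by (rule convex_contract[OF cv t]) (use x(1) y(1) t in \<open>auto simp: A_def B_def td\<close>)
  then have le0: "(\<integral>z. F z \<partial>\<nu>) \<le> 0"
    unfolding F_def using x(3,4) y(3,4) by simp
  have iA: "integrable \<nu> (indicator A :: real \<Rightarrow> real)" "integrable \<nu> (indicator B :: real \<Rightarrow> real)"
    by (auto simp: emeasure_eq_measure)
  have "\<kappa> - (\<kappa> + ln 4) * (measure \<nu> A + measure \<nu> B) = (\<integral>z. \<kappa> - (\<kappa> + ln 4) * (indicator A z + indicator B z) \<partial>\<nu>)"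
    using iA by (simp add: prob_space[unfolded space_eq_univ])
  also have "\<dots> \<le> (\<integral>z. F z \<partial>\<nu>)"
  proof (rule integral_mono_AE[OF _ iF])
    show "integrable \<nu> (\<lambda>z. \<kappa> - (\<kappa> + ln 4) * (indicator A z + indicator B z))"
      using iA by simp
    have quarter: "ln \<bar>w\<bar> - ln \<bar>w'\<bar> \<ge> - ln 4" if "t \<le> \<bar>w\<bar>" "0 < \<bar>w'\<bar>" "\<bar>w'\<bar> \<le> 4 * t" for w w'
    proof -
      have "ln \<bar>w'\<bar> \<le> ln (4 * t)" "ln t \<le> ln \<bar>w\<bar>" using that t by (auto intro!: ln_mono)
      then show ?thesis using t by (simp add: ln_mult)
    qed
    show "AE z in \<nu>. \<kappa> - (\<kappa> + ln 4) * (indicator A z + indicator B z) \<le> F z"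
      using bdd gap
    proof eventually_elim
      case (elim z)
      have xb: "c - h < x" "x \<le> c" and yb: "d \<le> y" "y < d + h" using x(1) y(1) by (auto simp: A_def B_def)
      have D': "\<bar>x - z\<bar> \<le> D" "\<bar>y - z\<bar> \<le> D" using x(2) y(2) elim(1) by (auto simp: D_def)
      consider "z \<in> A" | "z \<in> B" | "z \<le> c - h" | "z \<ge> d + h"
        using elim(2) by (cases "z \<le> c - h"; cases "z \<ge> d + h"; cases "z \<le> c") (auto simp: A_def B_def)
      then show ?case
      proof cases
        case 1
        then have "z \<notin> B" using td t by (auto simp: A_def B_def)
        moreover have "ln \<bar>y + - t - z\<bar> - ln \<bar>y - z\<bar> \<ge> - ln 4"
          by (rule quarter) (use 1 yb td t h in \<open>auto simp: A_def\<close>)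
        ultimately show ?thesis using 1 by (simp add: F_def)
      next
        case 2
        then have "z \<notin> A" using td t by (auto simp: A_def B_def)
        moreover have "ln \<bar>x + t - z\<bar> - ln \<bar>x - z\<bar> \<ge> - ln 4"
          by (rule quarter) (use 2 xb td t h in \<open>auto simp: B_def\<close>)
        ultimately show ?thesis using 2 by (simp add: F_def)
      next
        case 3
        then have nm: "z \<notin> A" "z \<notin> B" using td t h by (auto simp: A_def B_def)
        have "\<kappa> \<le> (ln ((x - z) + t) - ln (x - z)) + (ln ((y - z) - t) - ln (y - z))"
          unfolding \<kappa>_def by (rule contraction_log_gain) (use 3 xb yb td t h D' in auto)
        moreover have "\<bar>x + t - z\<bar> = (x - z) + t" "\<bar>x - z\<bar> = x - z" "\<bar>y + - t - z\<bar> = (y - z) - t" "\<bar>y - z\<bar> = y - z"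
          using 3 xb yb td t h by auto
        ultimately show ?thesis using nm by (simp add: F_def)
      next
        case 4
        then have nm: "z \<notin> A" "z \<notin> B" using td t h by (auto simp: A_def B_def)
        have "\<kappa> \<le> (ln ((z - y) + t) - ln (z - y)) + (ln ((z - x) - t) - ln (z - x))"
          unfolding \<kappa>_def by (rule contraction_log_gain) (use 4 xb yb td t h D' in auto)
        moreover have "\<bar>x + t - z\<bar> = (z - x) - t" "\<bar>x - z\<bar> = z - x" "\<bar>y + - t - z\<bar> = (z - y) + t" "\<bar>y - z\<bar> = z - y"
          using 4 xb yb td t h by auto
        ultimately show ?thesis using nm by (simp add: F_def)
      qed
    qed
  qed
  finally have "\<kappa> \<le> (\<kappa> + ln 4) * (measure \<nu> A + measure \<nu> B)" using le0 by linarith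
  also have "\<dots> \<le> (\<kappa> + ln 4) * (2 * \<eta>)" using mA mB \<kappa> ln4 by (intro mult_left_mono) auto
  also have "\<dots> = \<kappa> / 2"
  proof -
    have "s * (2 * (k / (4 * s))) = k / 2" if "s > 0" for s k :: real using that by simp
    from this[of "\<kappa> + ln 4" \<kappa>] show ?thesis using \<kappa> ln4 by (simp only: \<eta>_def add_pos_pos)
  qed
  finally show False using \<kappa> by simp
qed

lemma msupport_iff:
  assumes "real_distribution \<nu>"
  shows "x \<in> msupport \<nu> \<longleftrightarrow> (\<forall>d>0. measure \<nu> {x - d<..<x + d} > 0)"
proof -
  interpret real_distribution \<nu> by fact
  have eq: "emeasure \<nu> U > 0 \<longleftrightarrow> measure \<nu> U > 0" for U
    by (simp add: emeasure_eq_measure)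
  show ?thesis
  proof (intro iffI allI impI)
    fix d :: real assume "x \<in> msupport \<nu>" "d > 0"
    then show "measure \<nu> {x - d<..<x + d} > 0"
      unfolding msupport_def eq by auto
  next
    assume *: "\<forall>d>0. measure \<nu> {x - d<..<x + d} > 0"
    show "x \<in> msupport \<nu>"
      unfolding msupport_def eq
    proof (clarsimp)
      fix U assume U: "open U" "x \<in> U"
      then obtain d where d: "d > 0" "ball x d \<subseteq> U" using open_contains_ball by blast
      have "{x - d<..<x + d} \<subseteq> U" using d(2) by (simp add: ball_eq_greaterThanLessThan)
      then have "measure \<nu> {x - d<..<x + d} \<le> measure \<nu> U"
        using U(1) by (intro finite_measure_mono) auto
      then show "measure \<nu> U > 0" using * d(1) by (meson less_le_trans)
    qed
  qed
qed

lemma closed_msupport: "closed (msupport \<nu>)"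
proof -
  have "open (- msupport \<nu>)"
  proof (subst open_subopen, intro ballI)
    fix x assume "x \<in> - msupport \<nu>"
    then obtain U where "open U" "x \<in> U" "\<not> emeasure \<nu> U > 0" by (auto simp: msupport_def)
    then show "\<exists>U. open U \<and> x \<in> U \<and> U \<subseteq> - msupport \<nu>"
      by (intro exI[of _ U]) (auto simp: msupport_def)
  qed
  then show ?thesis by (simp add: closed_def)
qed

lemma AE_msupport:
  assumes "real_distribution \<nu>"
  shows "AE x in \<nu>. x \<in> msupport \<nu>"
proof -
  interpret real_distribution \<nu> by fact
  have "AE x in \<nu>. \<forall>p\<in>\<rat>. \<forall>q\<in>\<rat>. measure \<nu> {p<..<q} = 0 \<longrightarrow> x \<notin> {p<..<q}"
  proof (intro AE_ball_countable[THEN iffD2] ballI countable_rat)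
    fix p q :: real
    show "AE x in \<nu>. measure \<nu> {p<..<q} = 0 \<longrightarrow> x \<notin> {p<..<q}"
      by (cases "measure \<nu> {p<..<q} = 0") (auto simp: prob_eq_0)
  qed
  then show ?thesis
  proof eventually_elim
    case (elim x)
    show ?case unfolding msupport_iff[OF assms]
    proof (intro allI impI)
      fix d :: real assume "d > 0"
      obtain p where p: "p \<in> \<rat>" "x - d < p" "p < x" using Rats_dense_in_real[of "x - d" x] \<open>d > 0\<close> by auto
      obtain q where q: "q \<in> \<rat>" "x < q" "q < x + d" using Rats_dense_in_real[of x "x + d"] \<open>d > 0\<close> by auto
      have "measure \<nu> {p<..<q} > 0" using elim p q by (auto simp: zero_less_measure_iff)
      also have "\<dots> \<le> measure \<nu> {x - d<..<x + d}"
        using p q by (intro finite_measure_mono) auto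
      finally show "measure \<nu> {x - d<..<x + d} > 0" .
    qed
  qed
qed

text \<open>
  The support is compact and carries the measure, so a point between its extremes but outside of it
  would lie in a maximal gap whose two ends belong to the support.
\<close>

lemma free_gibbs_support_interval:
  assumes G: "free_gibbs v \<nu>" and fin: "finite_energy v \<nu>"
    and cv: "convex_on UNIV v" and cont: "continuous_on UNIV v" and co: "coercive v"
  obtains a b where "a < b" "msupport \<nu> = {a..b}"
proof -
  have rd: "real_distribution \<nu>" using fin by (simp add: finite_energy_def)
  interpret real_distribution \<nu> by fact
  have vm: "v \<in> borel_measurable borel" using cont by (rule borel_measurable_continuous_onI)
  obtain R where R: "AE x in \<nu>. \<bar>x\<bar> \<le> R" by (rule free_gibbs_bounded_support[OF G fin vm co])
  define S where "S = msupport \<nu>"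
  have S: "closed S" "AE x in \<nu>. x \<in> S" using closed_msupport AE_msupport[OF rd] by (auto simp: S_def)
  note iff = msupport_iff[OF rd, folded S_def]
  note atoms = finite_energy_no_atoms[OF fin]
  have SR: "S \<subseteq> {-R..R}"
  proof
    fix x assume "x \<in> S"
    show "x \<in> {-R..R}"
    proof (rule ccontr)
      assume "x \<notin> {-R..R}"
      then have x: "\<bar>x\<bar> > R" by auto
      have "AE y in \<nu>. y \<notin> {x - (\<bar>x\<bar> - R)<..<x + (\<bar>x\<bar> - R)}" using R by eventually_elim auto
      then have "measure \<nu> {x - (\<bar>x\<bar> - R)<..<x + (\<bar>x\<bar> - R)} = 0" by (subst prob_eq_0) auto
      moreover have "measure \<nu> {x - (\<bar>x\<bar> - R)<..<x + (\<bar>x\<bar> - R)} > 0"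
        using iff[of x] \<open>x \<in> S\<close> x by simp
      ultimately show False by simp
    qed
  qed
  have ne: "S \<noteq> {}"
  proof
    assume "S = {}"
    then have "AE x in \<nu>. False" using S(2) by simp
    then show False by simp
  qed
  define a where "a = Inf S"
  define b where "b = Sup S"
  have bd: "bdd_below S" "bdd_above S"
    using SR by (auto intro!: bdd_belowI[of _ "-R"] bdd_aboveI[of _ R])
  have ab: "a \<in> S" "b \<in> S" "\<And>x. x \<in> S \<Longrightarrow> a \<le> x \<and> x \<le> b"
    using closed_contains_Inf[OF ne bd(1) S(1)] closed_contains_Sup[OF ne bd(2) S(1)]
      cInf_lower[OF _ bd(1)] cSup_upper[OF _ bd(2)]
    by (simp_all add: a_def b_def)
  have "S = {a..b}"
  proof (rule ccontr)
    assume ne': "S \<noteq> {a..b}"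
    have "S \<subseteq> {a..b}" using ab(3) by auto
    with ne' have "\<not> {a..b} \<subseteq> S" by blast
    then obtain x where "x \<in> {a..b}" and xS: "x \<notin> S" by blast
    then have x: "a \<le> x" "x \<le> b" "x \<notin> S" by auto
    define c where "c = Sup (S \<inter> {..x})"
    define d where "d = Inf (S \<inter> {x..})"
    have c1: "S \<inter> {..x} \<noteq> {}" "bdd_above (S \<inter> {..x})" "closed (S \<inter> {..x})"
      using ab(1) x(1) S(1) by (auto intro: bdd_aboveI[of _ x] closed_Int)
    have d1: "S \<inter> {x..} \<noteq> {}" "bdd_below (S \<inter> {x..})" "closed (S \<inter> {x..})"
      using ab(2) x(2) S(1) by (auto intro: bdd_belowI[of _ x] closed_Int)
    have c: "c \<in> S" "c < x" "\<And>y. y \<in> S \<Longrightarrow> y \<le> x \<Longrightarrow> y \<le> c"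
      using closed_contains_Sup[OF c1] x(3) cSup_upper[OF _ c1(2)]
      unfolding c_def[symmetric] by (auto simp: order_le_less)
    have d: "d \<in> S" "x < d" "\<And>y. y \<in> S \<Longrightarrow> x \<le> y \<Longrightarrow> d \<le> y"
      using closed_contains_Inf[OF d1] x(3) cInf_lower[OF _ d1(2)]
      unfolding d_def[symmetric] by (auto simp: order_le_less)
    have gapS: "S \<inter> {c<..<d} = {}" using c(3) d(3) by (force simp: not_le)
    have gap: "AE y in \<nu>. y \<notin> {c<..<d}" using S(2) by eventually_elim (use gapS in auto)
    show False
    proof (rule free_gibbs_no_gap[OF G fin cv cont R gap])
      show "c < d" using c d by simp
      fix h :: real assume "h > 0"
      define h' where "h' = min h (d - c)"
      have h': "h' > 0" "h' \<le> h" "h' \<le> d - c" using \<open>h > 0\<close> c d by (auto simp: h'_def)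
      have "0 < measure \<nu> {c - h'<..<c + h'}" using iff[of c] c(1) h' by simp
      also have "\<dots> \<le> measure \<nu> {c - h<..c}"
        by (rule finite_measure_mono_AE) (use gap h' in \<open>auto elim!: eventually_mono\<close>)
      finally show "measure \<nu> {c - h<..c} > 0" .
      have "0 < measure \<nu> {d - h'<..<d + h'}" using iff[of d] d(1) h' by simp
      also have "\<dots> \<le> measure \<nu> {d..<d + h}"
        by (rule finite_measure_mono_AE) (use gap h' in \<open>auto elim!: eventually_mono\<close>)
      finally show "measure \<nu> {d..<d + h} > 0" .
    qed
  qed
  moreover have "a < b"
  proof (rule ccontr)
    assume "\<not> a < b"
    then have "x = a" if "x \<in> S" for x using ab(3)[OF that] by simp
    then have "AE x in \<nu>. False" by (intro eventually_elim2[OF S(2) atoms[of a]]) auto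
    then show False by simp
  qed
  ultimately show thesis using that by (simp add: S_def)
qed

text \<open>
  At the right end point (\<open>\<sigma> = 1\<close>) of the support the force \<open>2 \<integral> 1 / (e - y) d\<nu>(y)\<close> that drives mass
  outwards is at most the restoring force \<open>T e\<close> of the potential, for otherwise the extreme mass
  would move outwards.  The sign \<open>\<sigma> = -1\<close> treats the left end point.
\<close>

lemma free_gibbs_endpoint:
  assumes G: "free_gibbs v \<nu>" and fin: "finite_energy v \<nu>" and cv: "convex_on UNIV v"
    and v: "\<And>x. (v has_real_derivative T x) (at x)" and T: "continuous_on UNIV T"
    and bdd: "AE x in \<nu>. \<bar>x\<bar> \<le> R" and \<sigma>: "\<sigma> = 1 \<or> \<sigma> = -1"
    and e: "e \<in> msupport \<nu>" and side: "AE y in \<nu>. \<sigma> * (e - y) \<ge> 0"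
  shows "integrable \<nu> (\<lambda>y. 1 / (e - y))" "2 * \<sigma> * (\<integral>y. 1 / (e - y) \<partial>\<nu>) \<le> \<sigma> * T e"
proof -
  have rd: "real_distribution \<nu>" using fin by (simp add: finite_energy_def)
  interpret real_distribution \<nu> by fact
  interpret P: pair_prob_space \<nu> \<nu> ..
  have cont: "continuous_on UNIV v"
    by (rule continuous_on_of_derivative[OF v])
  have vm: "v \<in> borel_measurable borel" using cont by (rule borel_measurable_continuous_onI)
  note atoms = finite_energy_no_atoms[OF fin]
  note tangent = convex_tangent[OF cv v]
  note mono = monoD[OF convex_deriv_mono[OF cv v]]
  define g where "g s y = indicator {y. \<sigma> * (e - y) \<ge> s} y * ln (1 + s / \<bar>e - y\<bar>)" for s y
  have gm[measurable]: "g s \<in> borel_measurable borel" for s unfolding g_def by measurable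
  \<comment> \<open>The mass within distance \<open>s\<close> of the end point is pushed outwards by \<open>s\<close>; then \<open>s\<close> tends to \<open>0\<close>.\<close>
  have key: "(\<integral>\<^sup>+y. ennreal (g s y / s) \<partial>\<nu>) \<le> ennreal (\<sigma> * T (e + \<sigma> * s) / 2)" if s: "s > 0" for s
  proof -
    define A where "A = {x. \<sigma> * (e - x) < s}"
    have A[measurable]: "A \<in> sets borel" unfolding A_def by measurable
    define D where "D = 2 * \<bar>R\<bar> + s"
    have D: "D > 0" using s by (simp add: D_def)
    obtain C1 where C1: "\<And>x. x \<in> {- \<bar>R\<bar> - s..\<bar>R\<bar> + s} \<Longrightarrow> \<bar>v x\<bar> \<le> C1"
      using continuous_bounded_interval[OF cont] by blast
    define C where "C = max C1 \<bar>ln D\<bar>"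
    have out: "\<bar>x + \<sigma> * s - y\<bar> = \<bar>x - y\<bar> + s" "x \<noteq> y" "\<bar>x - y\<bar> \<le> \<bar>e - y\<bar> \<or> \<sigma> * (e - x) < 0"
      if "x \<in> A" "y \<notin> A" for x y
      using that s \<sigma> by (auto simp: A_def)
    obtain x where x: "x \<in> A" "\<bar>x\<bar> \<le> R \<and> \<sigma> * (e - x) \<ge> 0"
      "integrable \<nu> (\<lambda>z. indicator (- A) z * (ln \<bar>x + \<sigma> * s - z\<bar> - ln \<bar>x - z\<bar>))"
      "2 * (\<integral>z. indicator (- A) z * (ln \<bar>x + \<sigma> * s - z\<bar> - ln \<bar>x - z\<bar>) \<partial>\<nu>) \<le> v (x + \<sigma> * s) - v x"
    proof (rule free_gibbs_push[OF G fin vm A])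
      have "0 < measure \<nu> {e - s<..<e + s}" using e msupport_iff[OF rd] s by simp
      also have "\<dots> \<le> measure \<nu> A"
        by (intro finite_measure_mono) (use \<sigma> in \<open>auto simp: A_def\<close>)
      finally show "measure \<nu> A > 0" .
      show "AE x in \<nu>. \<bar>x\<bar> \<le> R \<and> \<sigma> * (e - x) \<ge> 0" using bdd side by eventually_elim auto
      have AE2: "AE p in \<nu> \<Otimes>\<^sub>M \<nu>. \<bar>fst p\<bar> \<le> R \<and> \<bar>snd p\<bar> \<le> R"
      proof (rule P.AE_pair_measure)
        show "{p \<in> space (\<nu> \<Otimes>\<^sub>M \<nu>). \<bar>fst p\<bar> \<le> R \<and> \<bar>snd p\<bar> \<le> R} \<in> sets (\<nu> \<Otimes>\<^sub>M \<nu>)" by measurable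
        show "AE x in \<nu>. AE y in \<nu>. \<bar>fst (x, y)\<bar> \<le> R \<and> \<bar>snd (x, y)\<bar> \<le> R"
          using bdd by eventually_elim (use bdd in \<open>auto elim: eventually_mono\<close>)
      qed
      then show "AE (x, y) in \<nu> \<Otimes>\<^sub>M \<nu>. x \<in> A \<longrightarrow> y \<notin> A \<longrightarrow>
          x + \<sigma> * s \<noteq> y \<and> \<bar>ln \<bar>x + \<sigma> * s - y\<bar>\<bar> \<le> \<bar>ln \<bar>x - y\<bar>\<bar> + C"
      proof eventually_elim
        case (elim p)
        show ?case
        proof (clarsimp split: prod.split)
          fix x y assume p: "p = (x, y)" and xy: "x \<in> A" "y \<notin> A"
          note o = out[OF xy]
          have "\<bar>x - y\<bar> + s \<le> D" using elim by (auto simp: p D_def)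
          then have "ln \<bar>x - y\<bar> \<le> ln (\<bar>x - y\<bar> + s)" "ln (\<bar>x - y\<bar> + s) \<le> ln D"
            using o s D by (auto intro!: ln_mono)
          then have "\<bar>ln (\<bar>x - y\<bar> + s)\<bar> \<le> \<bar>ln \<bar>x - y\<bar>\<bar> + \<bar>ln D\<bar>" by linarith
          also have "\<dots> \<le> \<bar>ln \<bar>x - y\<bar>\<bar> + C" by (simp add: C_def)
          finally show "x + \<sigma> * s \<noteq> y \<and> \<bar>ln \<bar>x + \<sigma> * s - y\<bar>\<bar> \<le> \<bar>ln \<bar>x - y\<bar>\<bar> + C"
            using o s by auto
        qed
      qed
      show "AE x in \<nu>. x \<in> A \<longrightarrow> \<bar>v (x + \<sigma> * s)\<bar> \<le> C"
        using bdd
      proof eventually_elim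
        case (elim x)
        have "x + \<sigma> * s \<in> {- \<bar>R\<bar> - s..\<bar>R\<bar> + s}" using elim \<sigma> s by auto
        from C1[OF this] show ?case by (simp add: C_def le_max_iff_disj)
      qed
    qed
    define F where "F z = indicator (- A) z * (ln \<bar>x + \<sigma> * s - z\<bar> - ln \<bar>x - z\<bar>)" for z
    have gF: "g s z \<le> F z" for z
    proof (cases "z \<in> A")
      case True
      then show ?thesis by (auto simp: g_def F_def A_def)
    next
      case False
      note o = out[OF x(1) False]
      have le: "\<bar>x - z\<bar> \<le> \<bar>e - z\<bar>" using o(3) x(2) by auto
      have xz: "\<bar>x - z\<bar> > 0" using o(2) by simp
      have "ln (1 + s / \<bar>e - z\<bar>) \<le> ln (1 + s / \<bar>x - z\<bar>)"
        using le xz s by (intro ln_mono add_left_mono divide_left_mono) (auto intro!: add_pos_nonneg)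
      also have "1 + s / \<bar>x - z\<bar> = (\<bar>x - z\<bar> + s) / \<bar>x - z\<bar>"
        using xz by (simp add: add_divide_distrib)
      also have "ln \<dots> = ln (\<bar>x - z\<bar> + s) - ln \<bar>x - z\<bar>"
        using xz s by (intro ln_divide_pos) auto
      finally show ?thesis using False o(1) by (auto simp: g_def F_def A_def)
    qed
    have g0: "g s z \<ge> 0" for z
      unfolding g_def using s by (intro mult_nonneg_nonneg) (auto intro!: ln_ge_zero)
    have "v (x + \<sigma> * s) - v x \<le> T (x + \<sigma> * s) * (\<sigma> * s)"
      using tangent[where x = "x + \<sigma> * s" and z = x] by (simp add: algebra_simps)
    also have "\<dots> = s * (\<sigma> * T (x + \<sigma> * s))" by simp
    also have "\<dots> \<le> s * (\<sigma> * T (e + \<sigma> * s))"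
      by (rule mult_left_mono) (use \<sigma> x(2) s mono in auto)
    finally have 1: "(\<integral>z. F z / s \<partial>\<nu>) \<le> \<sigma> * T (e + \<sigma> * s) / 2"
      using x(4) s by (simp add: F_def field_simps)
    have "(\<integral>\<^sup>+y. ennreal (g s y / s) \<partial>\<nu>) \<le> (\<integral>\<^sup>+z. ennreal (F z / s) \<partial>\<nu>)"
      using gF s by (intro nn_integral_mono ennreal_leI divide_right_mono) auto
    also have "\<dots> = ennreal (\<integral>z. F z / s \<partial>\<nu>)"
    proof (rule nn_integral_eq_integral)
      show "integrable \<nu> (\<lambda>z. F z / s)" using x(3) by (simp add: F_def[symmetric])
      have "0 \<le> F z / s" for z using order_trans[OF g0 gF, of z] s by simp
      then show "AE z in \<nu>. 0 \<le> F z / s" by simp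
    qed
    also have "\<dots> \<le> ennreal (\<sigma> * T (e + \<sigma> * s) / 2)" by (rule ennreal_leI[OF 1])
    finally show ?thesis .
  qed
  define s where "s n = 1 / real (Suc n)" for n
  have s: "s \<longlonglongrightarrow> 0" "\<And>n. s n > 0"
    unfolding s_def using LIMSEQ_Suc[OF lim_1_over_n[where 'a = real]] by auto
  have sat: "filterlim s (at 0) sequentially"
    using s by (auto simp: filterlim_at intro!: always_eventually) (metis less_irrefl)
  have lim: "(\<lambda>n. g (s n) y / s n) \<longlonglongrightarrow> 1 / \<bar>e - y\<bar>" if "y \<noteq> e" "\<sigma> * (e - y) \<ge> 0" for y
  proof -
    have pos: "\<sigma> * (e - y) > 0" "\<bar>e - y\<bar> > 0" using that \<sigma> by auto
    have "((\<lambda>h. ln (1 + h / w)) has_real_derivative 1 / w) (at 0)" if "w > 0" for w :: real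
      using that by (auto intro!: derivative_eq_intros)
    from this[OF pos(2)] have "((\<lambda>h. ln (1 + h / \<bar>e - y\<bar>) / h) \<longlongrightarrow> 1 / \<bar>e - y\<bar>) (at 0)"
      by (simp add: DERIV_def)
    then have "(\<lambda>n. ln (1 + s n / \<bar>e - y\<bar>) / s n) \<longlonglongrightarrow> 1 / \<bar>e - y\<bar>"
      by (rule filterlim_compose[OF _ sat])
    moreover have "\<forall>\<^sub>F n in sequentially. ln (1 + s n / \<bar>e - y\<bar>) / s n = g (s n) y / s n"
      using order_tendstoD(2)[OF s(1) pos(1)] by eventually_elim (simp add: g_def)
    ultimately show ?thesis by (rule Lim_transform_eventually)
  qed
  have Tlim: "(\<lambda>n. \<sigma> * T (e + \<sigma> * s n) / 2) \<longlonglongrightarrow> \<sigma> * T e / 2"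
  proof -
    have "isCont T e" using T by (simp add: continuous_on_eq_continuous_at)
    moreover have "(\<lambda>n. e + \<sigma> * s n) \<longlonglongrightarrow> e" using s(1) by (auto intro!: tendsto_eq_intros)
    ultimately have "(\<lambda>n. T (e + \<sigma> * s n)) \<longlonglongrightarrow> T e" by (rule isCont_tendsto_compose)
    then show ?thesis by (intro tendsto_intros) auto
  qed
  \<comment> \<open>Integrability of \<open>1 / (e - y)\<close> is part of the claim, so the limit is taken with Fatou's lemma.\<close>
  have "(\<integral>\<^sup>+y. ennreal (1 / \<bar>e - y\<bar>) \<partial>\<nu>) = (\<integral>\<^sup>+y. liminf (\<lambda>n. ennreal (g (s n) y / s n)) \<partial>\<nu>)"
  proof (rule nn_integral_cong_AE)
    show "AE y in \<nu>. ennreal (1 / \<bar>e - y\<bar>) = liminf (\<lambda>n. ennreal (g (s n) y / s n))"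
      using side atoms[of e]
    proof eventually_elim
      case (elim y)
      have "(\<lambda>n. ennreal (g (s n) y / s n)) \<longlonglongrightarrow> ennreal (1 / \<bar>e - y\<bar>)"
        by (intro tendsto_ennrealI lim elim)
      then show ?case by (simp add: lim_imp_Liminf)
    qed
  qed
  also have "\<dots> \<le> liminf (\<lambda>n. \<integral>\<^sup>+y. ennreal (g (s n) y / s n) \<partial>\<nu>)"
    by (rule nn_integral_liminf) measurable
  also have "\<dots> \<le> liminf (\<lambda>n. ennreal (\<sigma> * T (e + \<sigma> * s n) / 2))"
    by (intro Liminf_mono always_eventually allI key s)
  also have "\<dots> = ennreal (\<sigma> * T e / 2)"
    by (intro lim_imp_Liminf tendsto_ennrealI Tlim) simp
  finally have le: "(\<integral>\<^sup>+y. ennreal (1 / \<bar>e - y\<bar>) \<partial>\<nu>) \<le> ennreal (\<sigma> * T e / 2)" .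
  have i: "integrable \<nu> (\<lambda>y. 1 / \<bar>e - y\<bar>)"
    by (rule integrableI_nonneg) (use le in \<open>auto intro: le_less_trans\<close>)
  have eq: "AE y in \<nu>. \<sigma> * (1 / \<bar>e - y\<bar>) = 1 / (e - y)"
    using side atoms[of e]
  proof eventually_elim
    case (elim y)
    then show ?case using \<sigma> minus_divide_right[of 1 "y - e"] by auto
  qed
  have "integrable \<nu> (\<lambda>y. \<sigma> * (1 / \<bar>e - y\<bar>))" by (rule integrable_mult_right[OF i])
  then show i': "integrable \<nu> (\<lambda>y. 1 / (e - y))"
    by (subst (asm) integrable_cong_AE[OF _ _ eq]) auto
  have "(\<integral>y. 1 / (e - y) \<partial>\<nu>) = (\<integral>y. \<sigma> * (1 / \<bar>e - y\<bar>) \<partial>\<nu>)"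
    by (rule integral_cong_AE) (use eq in auto)
  also have "\<dots> = \<sigma> * (\<integral>y. 1 / \<bar>e - y\<bar> \<partial>\<nu>)" by (rule integral_mult_right_zero)
  finally have *: "\<sigma> * (\<integral>y. 1 / (e - y) \<partial>\<nu>) = (\<integral>y. 1 / \<bar>e - y\<bar> \<partial>\<nu>)" using \<sigma> by auto
  have "ennreal (\<integral>y. 1 / \<bar>e - y\<bar> \<partial>\<nu>) \<le> ennreal (\<sigma> * T e / 2)"
    using le i by (subst (asm) nn_integral_eq_integral) auto
  moreover have "(\<integral>y. 1 / \<bar>e - y\<bar> \<partial>\<nu>) > 0"
  proof -
    have "(\<integral>y. 1 / \<bar>e - y\<bar> \<partial>\<nu>) \<ge> 0" by (rule Bochner_Integration.integral_nonneg) simp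
    moreover have "(\<integral>y. 1 / \<bar>e - y\<bar> \<partial>\<nu>) \<noteq> 0"
    proof
      assume "(\<integral>y. 1 / \<bar>e - y\<bar> \<partial>\<nu>) = 0"
      then have "AE y in \<nu>. 1 / \<bar>e - y\<bar> = 0" using integral_nonneg_eq_0_iff_AE[OF i] by simp
      then have "AE y in \<nu>. False" by (rule eventually_elim2[OF _ atoms[of e]]) auto
      then show False by simp
    qed
    ultimately show ?thesis by linarith
  qed
  ultimately have "(\<integral>y. 1 / \<bar>e - y\<bar> \<partial>\<nu>) \<le> \<sigma> * T e / 2"
    by (metis ennreal_le_iff2 not_le)
  then show "2 * \<sigma> * (\<integral>y. 1 / (e - y) \<partial>\<nu>) \<le> \<sigma> * T e" using * by (simp add: mult.assoc)
qed

section \<open>Second-order expansion of logarithmic difference quotients\<close>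

lemma second_order_expansion:
  fixes f f' :: "real \<Rightarrow> real"
  assumes f': "\<And>x. \<bar>x - x0\<bar> < d \<Longrightarrow> (f has_real_derivative f' x) (at x)"
    and f'': "(f' has_real_derivative D) (at x0)" and d: "d > 0"
  shows "((\<lambda>h. (f (x0 + h) - f x0 - h * f' x0) / h\<^sup>2) \<longlongrightarrow> D / 2) (at 0)"
proof (rule lhopital)
  have ev: "\<forall>\<^sub>F h in at 0. \<bar>h\<bar> < d \<and> h \<noteq> (0::real)"
    using d by (auto simp: eventually_at dist_real_def)
  have fd: "((\<lambda>h. f (x0 + h)) has_real_derivative f' (x0 + h)) (at h)" if "\<bar>h\<bar> < d" for h
  proof -
    have "((\<lambda>h. x0 + h) has_real_derivative 1) (at h)" by (auto intro!: derivative_eq_intros)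
    from DERIV_chain2[OF f' this] that show ?thesis by simp
  qed
  have "isCont (\<lambda>h. f (x0 + h)) 0" using DERIV_isCont[OF fd[of 0]] d by simp
  then have "((\<lambda>h. f (x0 + h)) \<longlongrightarrow> f x0) (at 0)" by (simp add: isCont_def)
  then show "((\<lambda>h. f (x0 + h) - f x0 - h * f' x0) \<longlongrightarrow> 0) (at 0)"
    by (auto intro!: tendsto_eq_intros)
  show "((\<lambda>h::real. h\<^sup>2) \<longlongrightarrow> 0) (at 0)" by (auto intro!: tendsto_eq_intros)
  show "\<forall>\<^sub>F h in at 0. h\<^sup>2 \<noteq> (0::real)" using ev by eventually_elim simp
  show "\<forall>\<^sub>F h in at 0. 2 * h \<noteq> (0::real)" using ev by eventually_elim simp
  show "\<forall>\<^sub>F h in at 0. ((\<lambda>h. f (x0 + h) - f x0 - h * f' x0) has_real_derivative f' (x0 + h) - f' x0) (at h)"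
    using ev by eventually_elim (auto intro!: derivative_eq_intros fd)
  show "\<forall>\<^sub>F h in at 0. ((\<lambda>h::real. h\<^sup>2) has_real_derivative 2 * h) (at h)"
    by (auto intro!: always_eventually derivative_eq_intros)
  have "((\<lambda>h. (f' (x0 + h) - f' x0) / h) \<longlongrightarrow> D) (at 0)"
    using f'' by (simp add: DERIV_def)
  then have "((\<lambda>h. (f' (x0 + h) - f' x0) / h / 2) \<longlongrightarrow> D / 2) (at 0)"
    by (intro tendsto_divide) auto
  then show "((\<lambda>h. (f' (x0 + h) - f' x0) / (2 * h)) \<longlongrightarrow> D / 2) (at 0)"
    by (simp add: field_simps)
qed

lemma segment_mem:
  fixes a b x y s :: real
  assumes "x \<in> {a..b}" "y \<in> {a..b}" "s \<in> {0..1}"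
  shows "y + s * (x - y) \<in> {a..b}"
proof -
  have "(1 - s) *\<^sub>R y + s *\<^sub>R x \<in> {a..b}"
    using assms by (intro convexD) auto
  then show ?thesis by (simp add: algebra_simps)
qed

context
  fixes T T1 T2 T3 :: "real \<Rightarrow> real" and a b M2 M3 :: real
  assumes T: "\<And>x. (T has_real_derivative T1 x) (at x)"
    and T1: "\<And>x. (T1 has_real_derivative T2 x) (at x)"
    and T2: "\<And>x. (T2 has_real_derivative T3 x) (at x)"
    and M2: "\<And>x. x \<in> {a..b} \<Longrightarrow> \<bar>T2 x\<bar> \<le> M2"
    and M3: "\<And>x. x \<in> {a..b} \<Longrightarrow> \<bar>T3 x\<bar> \<le> M3"
begin

lemma deriv_increment_bounds:
  assumes "p \<in> {a..b}" "p + k \<in> {a..b}"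
  shows "\<bar>T1 (p + k) - T1 p\<bar> \<le> M2 * \<bar>k\<bar>"
    and "\<bar>T1 (p + k) - T1 p - k * T2 p\<bar> \<le> M3 * k\<^sup>2"
proof -
  show "\<bar>T1 (p + k) - T1 p\<bar> \<le> M2 * \<bar>k\<bar>"
    using abs_diff_le_of_deriv_le[of a b T1 T2 M2 "p + k" p] T1 M2 assms by simp
  have M3': "M3 \<ge> 0" using M3[OF assms(1)] by linarith
  define l where "l = min p (p + k)"
  define r where "r = max p (p + k)"
  have lr: "{l..r} \<subseteq> {a..b}" "p \<in> {l..r}" "p + k \<in> {l..r}"
    using assms by (auto simp: l_def r_def)
  have "\<bar>(T1 (p + k) - (p + k) * T2 p) - (T1 p - p * T2 p)\<bar> \<le> (M3 * \<bar>k\<bar>) * \<bar>p + k - p\<bar>"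
  proof (rule abs_diff_le_of_deriv_le[of l r _ "\<lambda>x. T2 x - T2 p"])
    fix x assume x: "x \<in> {l..r}"
    show "((\<lambda>x. T1 x - x * T2 p) has_real_derivative T2 x - T2 p) (at x)"
      by (auto intro!: derivative_eq_intros T1)
    have "\<bar>T2 x - T2 p\<bar> \<le> M3 * \<bar>x - p\<bar>"
      using abs_diff_le_of_deriv_le[of a b T2 T3 M3 x p] T2 M3 assms x lr by auto
    also have "\<dots> \<le> M3 * \<bar>k\<bar>"
      using x M3' by (intro mult_left_mono) (auto simp: l_def r_def min_def max_def split: if_splits)
    finally show "\<bar>T2 x - T2 p\<bar> \<le> M3 * \<bar>k\<bar>" .
  qed (use lr in auto)
  also have "(M3 * \<bar>k\<bar>) * \<bar>p + k - p\<bar> = M3 * k\<^sup>2"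
    by (simp add: power2_eq_square abs_mult_self_eq mult.assoc)
  finally show "\<bar>T1 (p + k) - T1 p - k * T2 p\<bar> \<le> M3 * k\<^sup>2"
    by (simp add: algebra_simps)
qed

text \<open>
  The difference quotient \<open>q\<close> is the integral of \<open>T1 (y + s * (z - y))\<close> over \<open>s \<in> {0..1}\<close>, which
  explains why it is as smooth as \<open>T1\<close>, uniformly in \<open>y\<close>.  Instead of integrating, each bound is the
  mean value theorem for an antiderivative in \<open>s\<close>.
\<close>

lemma difference_quotient_bounds:
  assumes mem: "x \<in> {a..b}" "x + h \<in> {a..b}" "y \<in> {a..b}" and ne: "y \<noteq> x" "y \<noteq> x + h"
  defines "q \<equiv> \<lambda>z. (T z - T y) / (z - y)"
    and "q' \<equiv> T1 x / (x - y) - (T x - T y) / (x - y)\<^sup>2"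
  shows "\<bar>q (x + h) - q x\<bar> \<le> M2 * \<bar>h\<bar>"
    and "\<bar>q'\<bar> \<le> M2"
    and "\<bar>q (x + h) - q x - h * q'\<bar> \<le> M3 * h\<^sup>2"
proof -
  have M0: "M2 \<ge> 0" "M3 \<ge> 0" using M2[OF mem(1)] M3[OF mem(1)] by linarith+
  have TD: "((\<lambda>s. T (y + s * c)) has_real_derivative T1 (y + s * c) * c) (at s)" for s c
    by (rule DERIV_chain2[OF T]) (auto intro!: derivative_eq_intros)
  have T1D: "((\<lambda>s. T1 (y + s * c)) has_real_derivative T2 (y + s * c) * c) (at s)" for s c
    by (rule DERIV_chain2[OF T1]) (auto intro!: derivative_eq_intros)
  have A: "((\<lambda>s. T (y + s * c) / c) has_real_derivative T1 (y + s * c)) (at s)" if "c \<noteq> 0" for s c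
    using that by (auto intro!: derivative_eq_intros TD)
  have B: "((\<lambda>s. s * T1 (y + s * c) / c - T (y + s * c) / c\<^sup>2) has_real_derivative s * T2 (y + s * c)) (at s)"
    if "c \<noteq> 0" for s c
    using that by (auto intro!: derivative_eq_intros TD T1D simp: field_simps power2_eq_square)
  have c: "x + h - y \<noteq> 0" "x - y \<noteq> 0" using ne by auto
  have pt: "y + s * (x - y) \<in> {a..b}" "y + s * (x - y) + s * h \<in> {a..b}"
    "y + s * (x + h - y) = y + s * (x - y) + s * h" if "s \<in> {0..1}" for s
  proof -
    show "y + s * (x - y) \<in> {a..b}" using segment_mem[OF mem(1,3) that] .
    show *: "y + s * (x + h - y) = y + s * (x - y) + s * h" by (simp add: algebra_simps)
    show "y + s * (x - y) + s * h \<in> {a..b}" using segment_mem[OF mem(2,3) that] * by simp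
  qed
  have sh: "\<bar>s * h\<bar> \<le> \<bar>h\<bar>" if "s \<in> {0..1}" for s
    using that by (auto simp: abs_mult intro: mult_left_le_one_le)
  have sh2: "(s * h)\<^sup>2 \<le> h\<^sup>2" if "s \<in> {0..1}" for s
    using sh[OF that] by (simp add: abs_le_square_iff)
  have "\<bar>(T (y + 1 * (x + h - y)) / (x + h - y) - T (y + 1 * (x - y)) / (x - y))
      - (T (y + 0 * (x + h - y)) / (x + h - y) - T (y + 0 * (x - y)) / (x - y))\<bar> \<le> (M2 * \<bar>h\<bar>) * \<bar>1 - 0\<bar>"
  proof (rule abs_diff_le_of_deriv_le[of 0 1 _ "\<lambda>s. T1 (y + s * (x + h - y)) - T1 (y + s * (x - y))"])
    fix s :: real assume s: "s \<in> {0..1}"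
    show "((\<lambda>s. T (y + s * (x + h - y)) / (x + h - y) - T (y + s * (x - y)) / (x - y))
        has_real_derivative T1 (y + s * (x + h - y)) - T1 (y + s * (x - y))) (at s)"
      by (intro DERIV_diff A c)
    have "\<bar>T1 (y + s * (x + h - y)) - T1 (y + s * (x - y))\<bar> \<le> M2 * \<bar>s * h\<bar>"
      using deriv_increment_bounds(1)[OF pt(1,2)[OF s]] unfolding pt(3)[OF s] .
    also have "\<dots> \<le> M2 * \<bar>h\<bar>" using sh[OF s] M0 by (intro mult_left_mono)
    finally show "\<bar>T1 (y + s * (x + h - y)) - T1 (y + s * (x - y))\<bar> \<le> M2 * \<bar>h\<bar>" .
  qed auto
  then show "\<bar>q (x + h) - q x\<bar> \<le> M2 * \<bar>h\<bar>"
    by (simp add: q_def diff_divide_distrib algebra_simps)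
  have "\<bar>(1 * T1 (y + 1 * (x - y)) / (x - y) - T (y + 1 * (x - y)) / (x - y)\<^sup>2)
      - (0 * T1 (y + 0 * (x - y)) / (x - y) - T (y + 0 * (x - y)) / (x - y)\<^sup>2)\<bar> \<le> M2 * \<bar>1 - 0\<bar>"
  proof (rule abs_diff_le_of_deriv_le[of 0 1 _ "\<lambda>s. s * T2 (y + s * (x - y))"])
    fix s :: real assume s: "s \<in> {0..1}"
    show "((\<lambda>s. s * T1 (y + s * (x - y)) / (x - y) - T (y + s * (x - y)) / (x - y)\<^sup>2)
        has_real_derivative s * T2 (y + s * (x - y))) (at s)" by (rule B[OF c(2)])
    have "\<bar>s * T2 (y + s * (x - y))\<bar> \<le> 1 * M2"
      unfolding abs_mult using s M2[OF pt(1)[OF s]] by (intro mult_mono) auto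
    then show "\<bar>s * T2 (y + s * (x - y))\<bar> \<le> M2" by simp
  qed auto
  then show "\<bar>q'\<bar> \<le> M2" by (simp add: q'_def diff_divide_distrib)
  have "\<bar>(T (y + 1 * (x + h - y)) / (x + h - y) - T (y + 1 * (x - y)) / (x - y)
        - h * (1 * T1 (y + 1 * (x - y)) / (x - y) - T (y + 1 * (x - y)) / (x - y)\<^sup>2))
      - (T (y + 0 * (x + h - y)) / (x + h - y) - T (y + 0 * (x - y)) / (x - y)
        - h * (0 * T1 (y + 0 * (x - y)) / (x - y) - T (y + 0 * (x - y)) / (x - y)\<^sup>2))\<bar> \<le> (M3 * h\<^sup>2) * \<bar>1 - 0\<bar>"
  proof (rule abs_diff_le_of_deriv_le[of 0 1 _
        "\<lambda>s. T1 (y + s * (x + h - y)) - T1 (y + s * (x - y)) - h * (s * T2 (y + s * (x - y)))"])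
    fix s :: real assume s: "s \<in> {0..1}"
    show "((\<lambda>s. T (y + s * (x + h - y)) / (x + h - y) - T (y + s * (x - y)) / (x - y)
        - h * (s * T1 (y + s * (x - y)) / (x - y) - T (y + s * (x - y)) / (x - y)\<^sup>2))
        has_real_derivative T1 (y + s * (x + h - y)) - T1 (y + s * (x - y)) - h * (s * T2 (y + s * (x - y)))) (at s)"
      by (intro DERIV_diff A c DERIV_cmult B)
    have "\<bar>T1 (y + s * (x + h - y)) - T1 (y + s * (x - y)) - h * (s * T2 (y + s * (x - y)))\<bar> \<le> M3 * (s * h)\<^sup>2"
      using deriv_increment_bounds(2)[OF pt(1,2)[OF s]] unfolding pt(3)[OF s] by (simp add: mult_ac)
    also have "\<dots> \<le> M3 * h\<^sup>2" using sh2[OF s] M0 by (intro mult_left_mono)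
    finally show "\<bar>T1 (y + s * (x + h - y)) - T1 (y + s * (x - y)) - h * (s * T2 (y + s * (x - y)))\<bar>
        \<le> M3 * h\<^sup>2" .
  qed auto
  then show "\<bar>q (x + h) - q x - h * q'\<bar> \<le> M3 * h\<^sup>2"
    by (simp add: q_def q'_def diff_divide_distrib algebra_simps)
qed

end

lemma ln_expansion_bound:
  fixes p r c :: real
  assumes "c > 0" "p \<ge> c" "r \<ge> c"
  shows "\<bar>ln r - ln p - (r - p) / p\<bar> \<le> (r - p)\<^sup>2 / c\<^sup>2"
proof -
  have pr: "p > 0" "r > 0" using assms by auto
  have 1: "ln r - ln p \<le> r / p - 1"
    using ln_le_minus_one[of "r / p"] pr by (simp add: ln_div)
  have 2: "ln p - ln r \<le> p / r - 1"
    using ln_le_minus_one[of "p / r"] pr by (simp add: ln_div)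
  have "(r - p) / p - (1 - p / r) = (r - p)\<^sup>2 / (p * r)"
    using pr by (simp add: field_simps power2_eq_square)
  also have "\<dots> \<le> (r - p)\<^sup>2 / c\<^sup>2"
    using assms pr by (intro divide_left_mono) (auto simp: power2_eq_square intro: mult_mono)
  finally show ?thesis using 1 2 pr by (simp add: diff_divide_distrib)
qed

text \<open>
  Only \<open>T1 \<ge> m\<close> near \<open>x0\<close> is assumed: for \<open>y\<close> further away, monotonicity turns the increment of \<open>T\<close>
  between \<open>x\<close> and the nearest point at distance \<open>d\<close> into a lower bound.
\<close>

lemma difference_quotient_lower_bound:
  fixes T T1 :: "real \<Rightarrow> real"
  assumes T: "\<And>x. (T has_real_derivative T1 x) (at x)" and T1: "\<And>x. T1 x \<ge> 0"
    and m: "m > 0" "d > 0" "\<And>x. \<bar>x - x0\<bar> \<le> 2 * d \<Longrightarrow> T1 x \<ge> m"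
    and x: "\<bar>x - x0\<bar> \<le> d" and y: "y \<noteq> x" "\<bar>x - y\<bar> \<le> D"
  shows "(T x - T y) / (x - y) \<ge> min m (m * d / D)"
proof -
  have mono: "T r \<le> T s" if "r \<le> s" for r s
    using that T T1 by (intro DERIV_nonneg_imp_nondecreasing[OF that]) blast
  have inc: "T s - T r \<ge> m * (s - r)" if "r \<le> s" "\<bar>r - x0\<bar> \<le> 2 * d" "\<bar>s - x0\<bar> \<le> 2 * d" for r s
  proof (cases "r = s")
    case False
    then have "r < s" using that by simp
    from MVT2[OF this, of T T1] T obtain z where z: "r < z" "z < s" "T s - T r = (s - r) * T1 z"
      by blast
    have "T1 z \<ge> m" using z that by (intro m(3)) auto
    then show ?thesis using z that by (simp add: mult.commute mult_left_mono)
  qed simp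
  have D: "D > 0" using y by auto
  show ?thesis
  proof (cases "\<bar>y - x0\<bar> \<le> 2 * d")
    case True
    have "m \<le> (T x - T y) / (x - y)"
    proof (cases "y < x")
      case True
      then show ?thesis using inc[of y x] x \<open>\<bar>y - x0\<bar> \<le> 2 * d\<close> by (simp add: le_divide_eq)
    next
      case False
      then have "(T x - T y) / (x - y) = (T y - T x) / (y - x)" using y
        by (metis minus_diff_eq minus_divide_divide)
      then show ?thesis using inc[of x y] x \<open>\<bar>y - x0\<bar> \<le> 2 * d\<close> False y(1) by (simp add: le_divide_eq)
    qed
    then show ?thesis by simp
  next
    case far: False
    have near: "\<bar>x - d - x0\<bar> \<le> 2 * d" "\<bar>x - x0\<bar> \<le> 2 * d" "\<bar>x + d - x0\<bar> \<le> 2 * d"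
      using x m(2) by linarith+
    have "m * d / D \<le> (T x - T y) / (x - y)"
    proof (cases "y < x")
      case True
      then have "y \<le> x - d" using far x by linarith
      then have "T x - T y \<ge> m * d" using mono[of y "x - d"] inc[OF _ near(1,2)] m(2) by simp
      then show ?thesis using True y m mono[of y x] by (intro frac_le) auto
    next
      case False
      then have "y \<ge> x + d" using far x y by linarith
      then have "T y - T x \<ge> m * d" using mono[of "x + d" y] inc[OF _ near(2,3)] m(2) by simp
      moreover have "(T x - T y) / (x - y) = (T y - T x) / (y - x)" using y
        by (metis minus_diff_eq minus_divide_divide)
      ultimately show ?thesis using False y m mono[of x y] by (auto intro!: frac_le)
    qed
    then show ?thesis by simp
  qed
qed

section \<open>The maximum principle\<close>

lemma quadratic_expansion_zero:
  fixes h d :: "nat \<Rightarrow> real"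
  assumes h: "h \<longlonglongrightarrow> 0" "\<And>n. h n \<noteq> 0" and d: "d \<longlonglongrightarrow> l"
    and eq: "\<And>n. p + h n * r + (h n)\<^sup>2 * d n = 0"
  shows "r = 0" "l = 0"
proof -
  have "(\<lambda>n. p + h n * r + (h n)\<^sup>2 * d n) \<longlonglongrightarrow> p + 0 * r + 0\<^sup>2 * l"
    by (intro tendsto_intros h d)
  then have p: "p = 0" by (simp add: eq LIMSEQ_const_iff)
  have eq2: "r + h n * d n = 0" for n
  proof -
    have "h n * (r + h n * d n) = 0" using eq[of n] p by (simp add: algebra_simps power2_eq_square)
    then show ?thesis using h(2)[of n] by simp
  qed
  have "(\<lambda>n. r + h n * d n) \<longlonglongrightarrow> r + 0 * l"
    by (intro tendsto_intros h d)
  then show r: "r = 0" by (simp add: eq2 LIMSEQ_const_iff)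
  have "d n = 0" for n using eq2[of n] h(2)[of n] r by simp
  then have "d = (\<lambda>n. 0)" by auto
  then show "l = 0" using d by (simp add: LIMSEQ_const_iff)
qed

text \<open>
  With \<open>k x y = ln ((T x - T y) / (x - y))\<close>, the expansion of \<open>k\<close> in \<open>x\<close> at \<open>x0\<close> is uniform in \<open>y\<close> up
  to the second order, so both sides of the identity can be expanded along any sequence of points
  at which it holds.  Comparing the coefficients gives the identity for the first and the second
  derivative at \<open>x0\<close>.

  In the second one, the terms without \<open>T2 x0\<close> yield the claim by maximality of \<open>T1 x0\<close>.  The
  remaining terms amount to \<open>T2 x0\<close> times \<open>u1 (T x0) - 2 * (\<integral>y. 1 / (T x0 - T y) \<partial>\<nu>)\<close>.  By the first
  identity, this factor is a positive multiple of \<open>T x0 - 2 * (\<integral>y. 1 / (x0 - y) \<partial>\<nu>)\<close>, whose product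
  with \<open>T2 x0\<close> is nonnegative by assumption unless \<open>T2 x0 = 0\<close>.
\<close>

lemma second_order_maximum_principle:
  fixes T T1 T2 T3 u u1 u2 \<phi> :: "real \<Rightarrow> real"
  assumes rd: "real_distribution \<nu>"
    and supp: "AE y in \<nu>. y \<in> {a..b}" and atoms: "\<And>x. AE y in \<nu>. y \<noteq> x"
    and \<phi>: "\<And>x. (\<phi> has_real_derivative T x) (at x)"
    and T: "\<And>x. (T has_real_derivative T1 x) (at x)"
    and T1: "\<And>x. (T1 has_real_derivative T2 x) (at x)"
    and T2: "\<And>x. (T2 has_real_derivative T3 x) (at x)"
    and T3: "continuous_on UNIV T3" and T1_nonneg: "\<And>x. T1 x \<ge> 0"
    and u: "\<And>x. (u has_real_derivative u1 x) (at x)"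
    and u1: "\<And>x. (u1 has_real_derivative u2 x) (at x)"
    and x0: "x0 \<in> {a..b}" and pos: "T1 x0 > 0" and max: "\<And>x. x \<in> {a..b} \<Longrightarrow> T1 x \<le> T1 x0"
    and mass: "\<And>d. d > 0 \<Longrightarrow> measure \<nu> {x0 - d<..<x0 + d} > 0"
    and ident: "AE x in \<nu>. u (T x) - \<phi> x = 2 * (\<integral>y. ln ((T x - T y) / (x - y)) \<partial>\<nu>) + C"
    and bdry: "T2 x0 = 0 \<or> (integrable \<nu> (\<lambda>y. 1 / (x0 - y)) \<and>
      T2 x0 * (T x0 - 2 * (\<integral>y. 1 / (x0 - y) \<partial>\<nu>)) \<ge> 0)"
  shows "u2 (T x0) * T1 x0 \<le> 1"
proof -
  interpret real_distribution \<nu> by fact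
  define L where "L = T1 x0"
  have L: "L > 0" using pos by (simp add: L_def)
  have cT: "continuous_on UNIV T" "continuous_on UNIV T1" "continuous_on UNIV T2"
    using continuous_on_of_derivative[OF T] continuous_on_of_derivative[OF T1]
      continuous_on_of_derivative[OF T2] .
  have [measurable]: "T \<in> borel_measurable borel" using cT by (intro borel_measurable_continuous_onI)
  obtain d where d: "d > 0" "\<And>x. \<bar>x - x0\<bar> \<le> 2 * d \<Longrightarrow> T1 x \<ge> L / 2"
  proof -
    have "isCont T1 x0" by (rule DERIV_isCont[OF T1])
    then have "\<forall>\<^sub>F x in at x0. T1 x > L / 2"
      using L by (intro order_tendstoD(1)[of T1 "T1 x0"]) (auto simp: isCont_def L_def)
    then obtain e where e: "e > 0" "\<And>x. x \<noteq> x0 \<Longrightarrow> dist x x0 < e \<Longrightarrow> L / 2 < T1 x"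
      unfolding eventually_at by auto
    show thesis
    proof (rule that[of "e / 3"])
      fix x assume "\<bar>x - x0\<bar> \<le> 2 * (e / 3)"
      then have "dist x x0 < e" using e(1) by (simp add: dist_real_def)
      then show "T1 x \<ge> L / 2" using e(2)[of x] L by (cases "x = x0") (auto simp: L_def)
    qed (use e in auto)
  qed
  \<comment> \<open>The points \<open>x0 + h\<close> may leave the support, but not the enlarged interval \<open>I\<close>.\<close>
  define I where "I = {a - d..b + d}"
  obtain M1 where M1: "\<And>x. x \<in> I \<Longrightarrow> \<bar>T1 x\<bar> \<le> M1" unfolding I_def using continuous_bounded_interval[OF cT(2)] by blast
  obtain M2 where M2: "\<And>x. x \<in> I \<Longrightarrow> \<bar>T2 x\<bar> \<le> M2" unfolding I_def using continuous_bounded_interval[OF cT(3)] by blast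
  obtain M3 where M3: "\<And>x. x \<in> I \<Longrightarrow> \<bar>T3 x\<bar> \<le> M3" unfolding I_def using continuous_bounded_interval[OF T3] by blast
  have x0I: "x0 \<in> I" using x0 d by (auto simp: I_def)
  have M0: "M1 \<ge> 0" "M2 \<ge> 0" "M3 \<ge> 0" using M1[OF x0I] M2[OF x0I] M3[OF x0I] by linarith+
  define q where "q x y = (T x - T y) / (x - y)" for x y
  define q' where "q' y = T1 x0 / (x0 - y) - (T x0 - T y) / (x0 - y)\<^sup>2" for y
  define c where "c = min (L / 2) (L / 2 * d / (b - a + 2 * d))"
  have ab: "a \<le> b" using x0 by auto
  have c: "c > 0" using L d ab by (auto simp: c_def intro!: divide_pos_pos mult_pos_pos)
  have qc: "q x y \<ge> c" if "\<bar>x - x0\<bar> \<le> d" "y \<in> {a..b}" "y \<noteq> x" for x y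
    unfolding q_def c_def
  proof (rule difference_quotient_lower_bound[where ?x0.0 = x0, OF T T1_nonneg _ d])
    show "L / 2 > 0" using L by simp
    show "\<bar>x - y\<bar> \<le> b - a + 2 * d" using that x0 d by (auto simp: abs_le_iff)
  qed (use that in auto)
  have qM: "q x y \<le> M1" if "\<bar>x - x0\<bar> \<le> d" "y \<in> {a..b}" "y \<noteq> x" for x y
  proof -
    have I: "x \<in> I" "y \<in> I" using that x0 d by (auto simp: I_def)
    have "\<bar>T x - T y\<bar> \<le> M1 * \<bar>x - y\<bar>"
      using abs_diff_le_of_deriv_le[of "a - d" "b + d" T T1 M1 x y] T M1 I by (auto simp: I_def)
    then have "\<bar>q x y\<bar> \<le> M1" using that by (simp add: q_def abs_divide divide_le_eq)
    then show ?thesis by simp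
  qed
  define k where "k x y = ln (q x y)" for x y
  define K1 where "K1 y = q' y / q x0 y" for y
  have km: "k x \<in> borel_measurable borel" for x unfolding k_def q_def by measurable
  have K1m: "K1 \<in> borel_measurable borel" unfolding K1_def q_def q'_def by measurable
  define M where "M = M2\<^sup>2 / c\<^sup>2 + M3 / c"
  have expand: "\<bar>k (x0 + h) y - k x0 y - h * K1 y\<bar> \<le> M * h\<^sup>2"
    and K1b: "\<bar>K1 y\<bar> \<le> M2 / c"
    if h: "\<bar>h\<bar> \<le> d" "y \<in> {a..b}" "y \<noteq> x0" "y \<noteq> x0 + h" for h y
  proof -
    have I: "x0 \<in> I" "x0 + h \<in> I" "y \<in> I" using that x0 d by (auto simp: I_def)
    note B = difference_quotient_bounds[OF T T1 T2 M2[unfolded I_def] M3[unfolded I_def]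
        I[unfolded I_def] h(3,4), folded q_def q'_def]
    have cc: "q x0 y \<ge> c" "q (x0 + h) y \<ge> c" using qc h d by auto
    have "\<bar>k (x0 + h) y - k x0 y - (q (x0 + h) y - q x0 y) / q x0 y\<bar> \<le> (q (x0 + h) y - q x0 y)\<^sup>2 / c\<^sup>2"
      unfolding k_def by (rule ln_expansion_bound[OF c cc])
    also have "\<dots> \<le> (M2 * \<bar>h\<bar>)\<^sup>2 / c\<^sup>2"
      using B(1) by (intro divide_right_mono) (auto simp: abs_le_square_iff[symmetric])
    finally have 1: "\<bar>k (x0 + h) y - k x0 y - (q (x0 + h) y - q x0 y) / q x0 y\<bar> \<le> M2\<^sup>2 / c\<^sup>2 * h\<^sup>2"
      by (simp add: power_mult_distrib)
    have "\<bar>(q (x0 + h) y - q x0 y) / q x0 y - h * K1 y\<bar> = \<bar>q (x0 + h) y - q x0 y - h * q' y\<bar> / q x0 y"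
      using cc c by (simp add: K1_def diff_divide_distrib[symmetric] abs_divide)
    also have "\<dots> \<le> (M3 * h\<^sup>2) / c"
      using B(3) cc c by (intro frac_le) auto
    finally have 2: "\<bar>(q (x0 + h) y - q x0 y) / q x0 y - h * K1 y\<bar> \<le> M3 / c * h\<^sup>2" by simp
    show "\<bar>k (x0 + h) y - k x0 y - h * K1 y\<bar> \<le> M * h\<^sup>2"
      using 1 2 unfolding M_def distrib_right by linarith
    have "\<bar>K1 y\<bar> = \<bar>q' y\<bar> / q x0 y" using cc c by (simp add: K1_def abs_divide)
    also have "\<dots> \<le> M2 / c" using B(2) cc c M0 by (intro frac_le) auto
    finally show "\<bar>K1 y\<bar> \<le> M2 / c" .
  qed
  have K1eq: "K1 y = L / (T x0 - T y) - 1 / (x0 - y)" if "y \<in> {a..b}" "y \<noteq> x0" for y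
  proof -
    have "(L / X - D / X\<^sup>2) / (D / X) = L / D - 1 / X" if "X \<noteq> 0" "D \<noteq> 0" for X D
      using that by (simp add: field_simps power2_eq_square)
    moreover have "q x0 y > 0" using qc[of x0 y] c d that by auto
    then have "T x0 - T y \<noteq> 0" by (auto simp: q_def)
    ultimately show ?thesis using that by (simp add: K1_def q'_def q_def L_def)
  qed
  have iK1: "integrable \<nu> K1"
  proof (rule integrable_const_bound[of _ "M2 / c"])
    show "AE y in \<nu>. norm (K1 y) \<le> M2 / c"
      using supp atoms[of x0] by eventually_elim (use K1b[of 0] d in auto)
  qed (use K1m in simp)
  have ik: "integrable \<nu> (k x)" if "\<bar>x - x0\<bar> \<le> d" for x
  proof (rule integrable_const_bound[of _ "\<bar>ln c\<bar> + \<bar>ln M1\<bar>"])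
    show "AE y in \<nu>. norm (k x y) \<le> \<bar>ln c\<bar> + \<bar>ln M1\<bar>"
      using supp atoms[of x]
    proof eventually_elim
      case (elim y)
      have "c \<le> q x y" "q x y \<le> M1" using qc[OF that elim] qM[OF that elim] .
      then have "ln c \<le> k x y" "k x y \<le> ln M1" using c by (auto simp: k_def)
      then show ?case by auto
    qed
  qed (use km in simp)
  \<comment> \<open>The identity holds almost everywhere only, so it is used along a sequence tending to \<open>x0\<close>.\<close>
  have "\<exists>h. 0 < \<bar>h\<bar> \<and> \<bar>h\<bar> < d / real (Suc n) \<and>
      u (T (x0 + h)) - \<phi> (x0 + h) = 2 * (\<integral>y. k (x0 + h) y \<partial>\<nu>) + C" for n
  proof (rule ccontr)
    assume no: "\<not> ?thesis"
    define e where "e = d / real (Suc n)"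
    have e: "e > 0" using d by (simp add: e_def)
    have "AE x in \<nu>. x \<notin> {x0 - e<..<x0 + e}"
      using ident atoms[of x0]
    proof eventually_elim
      case (elim x)
      show ?case
      proof
        assume "x \<in> {x0 - e<..<x0 + e}"
        then have "\<bar>x - x0\<bar> < d / real (Suc n)" by (auto simp: e_def abs_less_iff)
        moreover have "u (T (x0 + (x - x0))) - \<phi> (x0 + (x - x0)) = 2 * (\<integral>y. k (x0 + (x - x0)) y \<partial>\<nu>) + C"
          using elim(1) by (simp add: k_def q_def)
        ultimately show False using no elim(2) by (metis diff_eq_diff_eq diff_self zero_less_abs_iff)
      qed
    qed
    then have "measure \<nu> {x0 - e<..<x0 + e} = 0" by (subst prob_eq_0) auto
    then show False using mass[OF e] by simp
  qed
  then obtain h where h: "\<And>n. 0 < \<bar>h n\<bar>" "\<And>n. \<bar>h n\<bar> < d / real (Suc n)"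
    "\<And>n. u (T (x0 + h n)) - \<phi> (x0 + h n) = 2 * (\<integral>y. k (x0 + h n) y \<partial>\<nu>) + C"
    by metis
  have h0: "h \<longlonglongrightarrow> 0"
  proof (rule Lim_null_comparison)
    show "(\<lambda>n. d / real (Suc n)) \<longlonglongrightarrow> 0"
      by (rule LIMSEQ_Suc[OF lim_const_over_n])
    show "\<forall>\<^sub>F n in sequentially. norm (h n) \<le> d / real (Suc n)"
      using h(2) by (auto intro!: always_eventually less_imp_le)
  qed
  have hne: "h n \<noteq> 0" for n using h(1)[of n] by auto
  have hd: "\<bar>h n\<bar> \<le> d" for n
  proof -
    have "d / real (Suc n) \<le> d" using d by (simp add: divide_le_eq)
    then show ?thesis using h(2)[of n] by linarith
  qed
  have hat: "filterlim h (at 0) sequentially"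
    using h0 hne by (auto simp: filterlim_at intro!: always_eventually)
  define R where "R n y = (k (x0 + h n) y - k x0 y - h n * K1 y) / (h n)\<^sup>2" for n y
  define K2 where "K2 y = T2 x0 / (T x0 - T y) - L\<^sup>2 / (T x0 - T y)\<^sup>2 + 1 / (x0 - y)\<^sup>2" for y
  have K2m: "K2 \<in> borel_measurable \<nu>" unfolding K2_def by measurable
  have Rm: "R n \<in> borel_measurable \<nu>" for n unfolding R_def using km K1m by measurable
  have Rb: "AE y in \<nu>. norm (R n y) \<le> M" for n
    using supp atoms[of x0] atoms[of "x0 + h n"]
  proof eventually_elim
    case (elim y)
    have "\<bar>k (x0 + h n) y - k x0 y - h n * K1 y\<bar> \<le> M * (h n)\<^sup>2"
      using expand[OF hd elim(1) elim(2) elim(3)] .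
    then show ?case using hne[of n] by (simp add: R_def abs_divide divide_le_eq)
  qed
  have Rlim: "AE y in \<nu>. (\<lambda>n. R n y) \<longlonglongrightarrow> K2 y / 2"
    using supp atoms[of x0]
  proof eventually_elim
    case (elim y)
    define e where "e = min d \<bar>x0 - y\<bar>"
    have e: "e > 0" using elim d by (simp add: e_def)
    have near: "x \<noteq> y \<and> T x \<noteq> T y \<and> k x y = ln \<bar>T x - T y\<bar> - ln \<bar>x - y\<bar>" if "\<bar>x - x0\<bar> < e" for x
    proof -
      have x: "\<bar>x - x0\<bar> \<le> d" "y \<noteq> x" using that by (auto simp: e_def)
      have "q x y > 0" using qc[OF x(1) elim(1) x(2)] c by simp
      then have pos: "q x y = \<bar>q x y\<bar>" and ne: "T x \<noteq> T y"
        by (simp_all only: abs_of_pos) (auto simp: q_def)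
      have "q x y = \<bar>T x - T y\<bar> / \<bar>x - y\<bar>"
        unfolding abs_divide[symmetric] using pos by (simp only: q_def)
      then show ?thesis using x ne by (simp add: k_def ln_div)
    qed
    have D0: "((\<lambda>x. ln \<bar>x - y\<bar>) has_real_derivative 1 / (x - y)) (at x)" if "x \<noteq> y" for x y :: real
    proof (cases "x < y")
      case True
      have "((\<lambda>x. ln (y - x)) has_real_derivative 1 / (x - y)) (at x)"
        using True by (auto intro!: derivative_eq_intros simp: divide_simps)
      then show ?thesis
        by (rule has_field_derivative_transform_within_open[of _ _ _ "{..<y}"]) (use True in auto)
    next
      case False
      then have "x > y" using that by simp
      have "((\<lambda>x. ln (x - y)) has_real_derivative 1 / (x - y)) (at x)"
        using \<open>x > y\<close> by (auto intro!: derivative_eq_intros simp: divide_simps)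
      then show ?thesis
        by (rule has_field_derivative_transform_within_open[of _ _ _ "{y<..}"]) (use \<open>x > y\<close> in auto)
    qed
    have D1: "((\<lambda>x. ln \<bar>T x - T y\<bar> - ln \<bar>x - y\<bar>) has_real_derivative
        T1 x / (T x - T y) - 1 / (x - y)) (at x)" if "\<bar>x - x0\<bar> < e" for x
    proof -
      have "((\<lambda>x. ln \<bar>T x - T y\<bar>) has_real_derivative 1 / (T x - T y) * T1 x) (at x)"
        using near[OF that] by (intro DERIV_chain2[OF D0 T]) auto
      from DERIV_diff[OF this D0[of x y]] near[OF that] show ?thesis by simp
    qed
    have D2: "((\<lambda>x. T1 x / (T x - T y) - 1 / (x - y)) has_real_derivative K2 y) (at x0)"
    proof -
      define D where "D = T x0 - T y"
      have ne: "D \<noteq> 0" "x0 - y \<noteq> 0" using near[of x0] e by (auto simp: D_def)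
      have "((\<lambda>x. T1 x / (T x - T y)) has_real_derivative (T2 x0 * D - L * L) / (D * D)) (at x0)"
        unfolding D_def L_def using ne
        by (intro DERIV_divide T1) (auto intro!: derivative_eq_intros T simp: D_def)
      moreover have "((\<lambda>x. 1 / (x - y)) has_real_derivative - (1 / (x0 - y)\<^sup>2)) (at x0)"
        using ne by (auto intro!: derivative_eq_intros simp: power2_eq_square)
      ultimately have "((\<lambda>x. T1 x / (T x - T y) - 1 / (x - y)) has_real_derivative
          (T2 x0 * D - L * L) / (D * D) - - (1 / (x0 - y)\<^sup>2)) (at x0)"
        by (rule DERIV_diff)
      also have "(T2 x0 * D - L * L) / (D * D) - - (1 / (x0 - y)\<^sup>2) = K2 y"
        using ne by (simp add: K2_def D_def[symmetric] diff_divide_distrib power2_eq_square)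
      finally show ?thesis .
    qed
    have "((\<lambda>h. ((ln \<bar>T (x0 + h) - T y\<bar> - ln \<bar>x0 + h - y\<bar>) - (ln \<bar>T x0 - T y\<bar> - ln \<bar>x0 - y\<bar>)
        - h * (T1 x0 / (T x0 - T y) - 1 / (x0 - y))) / h\<^sup>2) \<longlongrightarrow> K2 y / 2) (at 0)"
      by (rule second_order_expansion[OF D1 D2 e])
    then have "(\<lambda>n. ((ln \<bar>T (x0 + h n) - T y\<bar> - ln \<bar>x0 + h n - y\<bar>) - (ln \<bar>T x0 - T y\<bar> - ln \<bar>x0 - y\<bar>)
        - h n * (T1 x0 / (T x0 - T y) - 1 / (x0 - y))) / (h n)\<^sup>2) \<longlonglongrightarrow> K2 y / 2"
      by (rule filterlim_compose[OF _ hat])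
    moreover have "\<forall>\<^sub>F n in sequentially. ((ln \<bar>T (x0 + h n) - T y\<bar> - ln \<bar>x0 + h n - y\<bar>) - (ln \<bar>T x0 - T y\<bar> - ln \<bar>x0 - y\<bar>)
        - h n * (T1 x0 / (T x0 - T y) - 1 / (x0 - y))) / (h n)\<^sup>2 = R n y"
    proof -
      have "\<forall>\<^sub>F n in sequentially. \<bar>h n\<bar> < e"
        using h0 e by (auto simp: tendsto_iff dist_real_def)
      then show ?thesis
        by eventually_elim (use near near[of x0] e K1eq[OF elim] in \<open>simp add: R_def L_def\<close>)
    qed
    ultimately show ?case by (rule Lim_transform_eventually)
  qed
  have iR: "integrable \<nu> (R n)" for n by (rule integrable_const_bound[OF Rb Rm])
  have DCT: "integrable \<nu> (\<lambda>y. K2 y / 2)" "(\<lambda>n. \<integral>y. R n y \<partial>\<nu>) \<longlonglongrightarrow> (\<integral>y. K2 y / 2 \<partial>\<nu>)"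
    using integrable_dominated_convergence[OF _ _ _ Rlim Rb]
      integral_dominated_convergence[OF _ _ _ Rlim Rb] K2m Rm by auto
  have "integrable \<nu> (\<lambda>y. 2 * (K2 y / 2))" by (intro integrable_mult_right DCT(1))
  then have iK2: "integrable \<nu> K2" by simp
  define w where "w x = u (T x) - \<phi> x" for x
  define w1 where "w1 x = u1 (T x) * T1 x - T x" for x
  define W2 where "W2 = u2 (T x0) * L\<^sup>2 + u1 (T x0) * T2 x0 - L"
  have wD: "(w has_real_derivative w1 x) (at x)" for x
    unfolding w_def w1_def by (intro DERIV_diff DERIV_chain2[OF u T] \<phi>)
  have w1D: "(w1 has_real_derivative W2) (at x0)"
    unfolding w1_def W2_def L_def
    using DERIV_chain2[OF u1 T[of x0]]
    by (auto intro!: derivative_eq_intros T T1 simp: power2_eq_square)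
  have "((\<lambda>h. (w (x0 + h) - w x0 - h * w1 x0) / h\<^sup>2) \<longlongrightarrow> W2 / 2) (at 0)"
    by (rule second_order_expansion[OF wD w1D zero_less_one])
  then have wlim: "(\<lambda>n. (w (x0 + h n) - w x0 - h n * w1 x0) / (h n)\<^sup>2) \<longlonglongrightarrow> W2 / 2"
    by (rule filterlim_compose[OF _ hat])
  have eq: "(w x0 - 2 * (\<integral>y. k x0 y \<partial>\<nu>) - C) + h n * (w1 x0 - 2 * (\<integral>y. K1 y \<partial>\<nu>))
      + (h n)\<^sup>2 * ((w (x0 + h n) - w x0 - h n * w1 x0) / (h n)\<^sup>2 - 2 * (\<integral>y. R n y \<partial>\<nu>)) = 0" for n
  proof -
    have "(\<integral>y. k (x0 + h n) y \<partial>\<nu>) = (\<integral>y. k x0 y + h n * K1 y + (h n)\<^sup>2 * R n y \<partial>\<nu>)"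
      using hne[of n] by (intro Bochner_Integration.integral_cong) (auto simp: R_def)
    also have "\<dots> = (\<integral>y. k x0 y \<partial>\<nu>) + h n * (\<integral>y. K1 y \<partial>\<nu>) + (h n)\<^sup>2 * (\<integral>y. R n y \<partial>\<nu>)"
      using ik[of x0] iK1 iR d by simp
    finally have "w (x0 + h n) = 2 * ((\<integral>y. k x0 y \<partial>\<nu>) + h n * (\<integral>y. K1 y \<partial>\<nu>) + (h n)\<^sup>2 * (\<integral>y. R n y \<partial>\<nu>)) + C"
      using h(3)[of n] by (simp add: w_def)
    moreover have *: "(h n)\<^sup>2 * (X / (h n)\<^sup>2 - r) = X - (h n)\<^sup>2 * r" for X r
      using hne[of n] by (simp add: right_diff_distrib)
    ultimately show ?thesis unfolding * by (simp only: algebra_simps)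
  qed
  have w1eq: "w1 x0 = 2 * (\<integral>y. K1 y \<partial>\<nu>)" and W2eq: "W2 = 2 * (\<integral>y. K2 y \<partial>\<nu>)"
    using quadratic_expansion_zero[OF h0 hne tendsto_diff[OF wlim tendsto_mult_left[OF DCT(2), of 2]] eq]
    by auto
  \<comment> \<open>At the maximum, difference quotients of \<open>T\<close> are at most \<open>L\<close>, so \<open>K2\<close> is at most its
     first summand.\<close>
  have K2le: "AE y in \<nu>. K2 y \<le> T2 x0 / (T x0 - T y)"
    using supp atoms[of x0]
  proof eventually_elim
    case (elim y)
    have "\<bar>T x0 - T y\<bar> \<le> L * \<bar>x0 - y\<bar>"
      by (rule abs_diff_le_of_deriv_le[of a b T T1]) (use T T1_nonneg max x0 elim in \<open>auto simp: L_def\<close>)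
    then have "(T x0 - T y)\<^sup>2 \<le> (L * (x0 - y))\<^sup>2"
      using L by (simp add: abs_le_square_iff[symmetric] abs_mult)
    moreover have "T x0 \<noteq> T y" using qc[of x0 y] c d elim by (auto simp: q_def)
    ultimately have "1 / (x0 - y)\<^sup>2 \<le> L\<^sup>2 / (T x0 - T y)\<^sup>2"
      using elim by (simp add: divide_simps power_mult_distrib mult.commute)
    then show ?case by (simp add: K2_def)
  qed
  have "u2 (T x0) * L\<^sup>2 \<le> L"
    using bdry
  proof
    assume t: "T2 x0 = 0"
    have "(\<integral>y. K2 y \<partial>\<nu>) \<le> (\<integral>y. 0 \<partial>\<nu>)"
      by (intro integral_mono_AE iK2) (use K2le t in auto)
    then show ?thesis using W2eq t by (simp add: W2_def)
  next
    assume B: "integrable \<nu> (\<lambda>y. 1 / (x0 - y)) \<and> T2 x0 * (T x0 - 2 * (\<integral>y. 1 / (x0 - y) \<partial>\<nu>)) \<ge> 0"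
    define J where "J = (\<integral>y. 1 / (x0 - y) \<partial>\<nu>)"
    have i: "integrable \<nu> (\<lambda>y. (K1 y + 1 / (x0 - y)) / L)" using iK1 B by auto
    have eqJ: "AE y in \<nu>. 1 / (T x0 - T y) = (K1 y + 1 / (x0 - y)) / L"
      using supp atoms[of x0] by eventually_elim (use K1eq L in auto)
    have "(\<integral>y. K2 y \<partial>\<nu>) \<le> (\<integral>y. T2 x0 * ((K1 y + 1 / (x0 - y)) / L) \<partial>\<nu>)"
    proof (intro integral_mono_AE iK2)
      show "integrable \<nu> (\<lambda>y. T2 x0 * ((K1 y + 1 / (x0 - y)) / L))"
        by (rule integrable_mult_right[OF i])
      show "AE y in \<nu>. K2 y \<le> T2 x0 * ((K1 y + 1 / (x0 - y)) / L)"
        using K2le eqJ by eventually_elim (metis mult.right_neutral times_divide_eq_right)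
    qed
    also have "\<dots> = T2 x0 * ((w1 x0 / 2 + J) / L)"
      using iK1 B w1eq by (simp add: J_def)
    finally have "L * W2 \<le> T2 x0 * (w1 x0 + 2 * J)"
      using W2eq L by (simp add: field_simps)
    also have "\<dots> \<le> T2 x0 * (u1 (T x0) * L)"
      using B by (simp add: w1_def J_def L_def algebra_simps)
    finally have "L * (u2 (T x0) * L\<^sup>2) \<le> L * L" by (simp add: W2_def algebra_simps)
    then show ?thesis using L by simp
  qed
  then have "L * (u2 (T x0) * L) \<le> L * 1" by (simp add: power2_eq_square algebra_simps)
  then show ?thesis using L unfolding L_def[symmetric] by (metis mult_le_cancel_left_pos)
qed

section \<open>Changing the potential off the support\<close>

text \<open>
  The quantile functions of both measures on the unit interval.
\<close>

lemma monotone_coupling: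
  assumes "real_distribution \<nu>" "real_distribution \<rho>"
  obtains \<Omega> :: "real measure" and X Y :: "real \<Rightarrow> real" where
    "prob_space \<Omega>" "X \<in> borel_measurable \<Omega>" "Y \<in> borel_measurable \<Omega>"
    "distr \<Omega> borel X = \<nu>" "distr \<Omega> borel Y = \<rho>"
    "\<And>s t. s \<in> space \<Omega> \<Longrightarrow> t \<in> space \<Omega> \<Longrightarrow> s \<le> t \<Longrightarrow> X s \<le> X t \<and> Y s \<le> Y t"
proof -
  interpret N: cdf_distribution \<nu> unfolding cdf_distribution_def by fact
  interpret R: cdf_distribution \<rho> unfolding cdf_distribution_def by fact
  define \<Omega> :: "real measure" where "\<Omega> = restrict_space lborel {0<..<1}"
  have sp: "space \<Omega> = {0<..<1}" by (simp add: \<Omega>_def space_restrict_space)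
  have "prob_space \<Omega>"
    by (rule prob_spaceI) (simp add: \<Omega>_def space_restrict_space emeasure_restrict_space)
  moreover have "N.I \<in> borel_measurable \<Omega>" "R.I \<in> borel_measurable \<Omega>"
    using N.measurable_CI R.measurable_CI by (simp_all add: \<Omega>_def cong: measurable_cong_sets)
  ultimately show thesis
  proof (rule that)
    show "distr \<Omega> borel N.I = \<nu>" "distr \<Omega> borel R.I = \<rho>"
      using N.distr_I_eq_M R.distr_I_eq_M by (simp_all add: \<Omega>_def)
    show "N.I s \<le> N.I t \<and> R.I s \<le> R.I t" if "s \<in> space \<Omega>" "t \<in> space \<Omega>" "s \<le> t" for s t
      using that mono_onD[OF N.mono_I, of s t] mono_onD[OF R.mono_I, of s t] by (simp add: sp)
  qed
qed

text \<open>
  Displacements are truncated by \<open>clip r\<close>.  It is monotone and does not expand distances, so it moves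
  every difference quotient of a displacement towards \<open>0\<close> without changing its sign
  (\<open>clip_quotient\<close>), and the truncated displacement is still order preserving.
\<close>

definition clip :: "real \<Rightarrow> real \<Rightarrow> real" where
  "clip r z = max (- r) (min r z)"

lemma clip_quotient:
  assumes "r \<ge> 0"
  shows "0 \<le> (clip r z - clip r w) / d \<and> (clip r z - clip r w) / d \<le> (z - w) / d \<or>
    (z - w) / d \<le> (clip r z - clip r w) / d \<and> (clip r z - clip r w) / d \<le> 0"
proof -
  have "0 \<le> clip r z - clip r w \<and> clip r z - clip r w \<le> z - w \<or>
      z - w \<le> clip r z - clip r w \<and> clip r z - clip r w \<le> 0"
    using assms unfolding clip_def by (auto simp: max_def min_def)
  then show ?thesis
    by (cases "d \<ge> 0") (auto intro: divide_right_mono divide_right_mono_neg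
        simp: divide_nonneg_nonneg divide_nonpos_nonneg divide_nonneg_nonpos divide_nonpos_nonpos)
qed

text \<open>
  These are the bounds that make the logarithmic energy along a truncated displacement of size \<open>s\<close>
  converge: the third one, a consequence of the concavity of \<open>ln\<close>, gives a lower bound for the
  difference quotient in \<open>s\<close> that does not depend on \<open>s\<close>.
\<close>

lemma ln_interpolation_bounds:
  fixes q q' s :: real
  assumes q: "- 1 < q" and q': "0 \<le> q' \<and> q' \<le> q \<or> q \<le> q' \<and> q' \<le> 0" and s: "0 < s" "s \<le> 1"
  shows "1 + s * q' > 0" "\<bar>ln (1 + s * q')\<bar> \<le> \<bar>ln (1 + q)\<bar>" "- \<bar>ln (1 + q)\<bar> \<le> ln (1 + s * q') / s"
proof -
  have "1 + s * q' > 0 \<and> \<bar>ln (1 + s * q')\<bar> \<le> \<bar>ln (1 + q)\<bar> \<and> - \<bar>ln (1 + q)\<bar> \<le> ln (1 + s * q') / s"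
    using q'
  proof
    assume "0 \<le> q' \<and> q' \<le> q"
    then have sq: "0 \<le> s * q'" "s * q' \<le> q"
      using s mult_left_le_one_le[of q' s] by auto
    then have l: "0 \<le> ln (1 + s * q')" "ln (1 + s * q') \<le> ln (1 + q)"
      using q by (auto intro!: ln_ge_zero ln_mono)
    then have "0 \<le> ln (1 + s * q') / s" "0 \<le> ln (1 + q)" using s by simp_all
    moreover have "1 + s * q' > 0" using sq by linarith
    ultimately show ?thesis using l by linarith
  next
    assume a: "q \<le> q' \<and> q' \<le> 0"
    then have sq: "s * q' \<le> 0" "q' \<le> s * q'"
      using s mult_left_le_one_le[of "- q'" s] by (auto simp: mult_nonneg_nonpos)
    then have pos: "1 + s * q' > 0" using a q by linarith
    have l: "ln (1 + s * q') \<le> 0" "ln (1 + q) \<le> ln (1 + q')" "ln (1 + q') \<le> ln (1 + s * q')"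
      using sq a q pos by (auto intro!: ln_mono)
    have "(1 - s) * ln 1 + s * ln (1 + q') \<le> ln ((1 - s) *\<^sub>R 1 + s *\<^sub>R (1 + q'))"
      using concave_onD[OF ln_concave, of s 1 "1 + q'"] s a q by simp
    then have "s * ln (1 + q') \<le> ln (1 + s * q')" by (simp add: algebra_simps)
    then have "ln (1 + q') \<le> ln (1 + s * q') / s" using s by (simp add: pos_le_divide_eq mult.commute)
    then show ?thesis using pos l by linarith
  qed
  then show "1 + s * q' > 0" "\<bar>ln (1 + s * q')\<bar> \<le> \<bar>ln (1 + q)\<bar>" "- \<bar>ln (1 + q)\<bar> \<le> ln (1 + s * q') / s"
    by auto
qed

lemma directional_difference_tendsto:
  fixes f :: "real \<Rightarrow> real"
  assumes f: "(f has_real_derivative D) (at x)" and s: "filterlim s (at 0) sequentially"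
  shows "(\<lambda>n. (f (x + s n * w) - f x) / s n) \<longlonglongrightarrow> D * w"
proof -
  have "((\<lambda>h. f (x + h * w)) has_real_derivative D * w) (at 0)"
    by (rule DERIV_chain2) (use f in \<open>auto intro!: derivative_eq_intros\<close>)
  then have "((\<lambda>h. (f (x + h * w) - f x) / h) \<longlongrightarrow> D * w) (at 0)"
    by (simp add: DERIV_def)
  then show ?thesis by (rule filterlim_compose[OF _ s])
qed

text \<open>
  If a convex function meets its tangent at \<open>x\<close> again in \<open>x + c\<close>, it is affine in between, which is
  impossible where the derivative is strictly increasing.
\<close>

lemma affine_on_translate_contradiction:
  fixes f f' :: "real \<Rightarrow> real"
  assumes tangent: "\<And>x z. f z \<ge> f x + f' x * (z - x)"
    and strict: "\<And>x z. x \<in> {p<..<r} \<Longrightarrow> z \<in> {p<..<r} \<Longrightarrow> x < z \<Longrightarrow> f' x < f' z"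
    and x: "x \<in> {p<..<r}" and c: "c \<noteq> 0" and eq: "f (x + c) = f x + f' x * c"
  shows False
proof (cases "c > 0")
  case True
  define z where "z = (x + min r (x + c)) / 2"
  have z: "z \<in> {p<..<r}" "x < z" "z < x + c" using x True by (auto simp: z_def)
  have "f (x + c) \<ge> f x + f' x * (z - x) + f' z * (x + c - z)"
    using tangent[where x = x and z = z] tangent[where x = z and z = "x + c"] by linarith
  then have "f' x * (x + c - z) \<ge> f' z * (x + c - z)" using eq by (simp add: algebra_simps)
  then show False using strict[OF x z(1,2)] z(3) by simp
next
  case False
  define z where "z = (x + max p (x + c)) / 2"
  have z: "z \<in> {p<..<r}" "z < x" "x + c < z" using x False c by (auto simp: z_def)
  have "f (x + c) \<ge> f x + f' x * (z - x) + f' z * (x + c - z)"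
    using tangent[where x = x and z = z] tangent[where x = z and z = "x + c"] by linarith
  then have "f' z * (z - (x + c)) \<ge> f' x * (z - (x + c))" using eq by (simp add: algebra_simps)
  then show False using strict[OF z(1) x z(2)] z(3) by simp
qed

text \<open>
  \<open>X\<close> and \<open>Y\<close> are the two ends of a monotone coupling, \<open>Y - X\<close> is the displacement and \<open>q\<close> its
  difference quotient.  Minimality of \<open>\<nu>\<close> is tested with the displacement \<open>s * clip r (Y - X)\<close> and
  \<open>s\<close> tends to \<open>0\<close>.  Truncation keeps the displaced points close to the support, so that the
  growth of \<open>\<phi>\<close> far away is irrelevant; the truncation level tends to \<open>\<infinity>\<close> more slowly than \<open>1 / s\<close>.
  Since no integrability of \<open>q\<close> is known beforehand, the limit of the logarithmic energy is taken
  with Fatou's lemma.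
\<close>

lemma coupling_first_variation:
  fixes X Y T :: "real \<Rightarrow> real"
  assumes G: "free_gibbs \<phi> \<nu>" and fin: "finite_energy \<phi> \<nu>"
    and \<phi>: "\<And>x. (\<phi> has_real_derivative T x) (at x)" and T: "continuous_on UNIV T"
    and \<Omega>: "prob_space \<Omega>" and X[measurable]: "X \<in> borel_measurable \<Omega>" and Y[measurable]: "Y \<in> borel_measurable \<Omega>"
    and dX: "distr \<Omega> borel X = \<nu>" and mono: "\<And>s t. s \<in> space \<Omega> \<Longrightarrow> t \<in> space \<Omega> \<Longrightarrow> s \<le> t \<Longrightarrow> X s \<le> X t \<and> Y s \<le> Y t"
    and supp: "AE s in \<Omega>. X s \<in> {a..b}" and iY: "integrable \<Omega> Y"
    and neY: "AE (s, t) in \<Omega> \<Otimes>\<^sub>M \<Omega>. Y s \<noteq> Y t"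
    and ilY: "integrable (\<Omega> \<Otimes>\<^sub>M \<Omega>) (\<lambda>(s, t). ln \<bar>Y s - Y t\<bar>)"
  defines "q \<equiv> \<lambda>p. ((Y (fst p) - X (fst p)) - (Y (snd p) - X (snd p))) / (X (fst p) - X (snd p))"
    and "l \<equiv> \<lambda>p. ln \<bar>Y (fst p) - Y (snd p)\<bar> - ln \<bar>X (fst p) - X (snd p)\<bar>"
  shows "AE p in \<Omega> \<Otimes>\<^sub>M \<Omega>. X (fst p) \<noteq> X (snd p) \<and> q p > - 1 \<and> l p = ln (1 + q p)"
    and "integrable (\<Omega> \<Otimes>\<^sub>M \<Omega>) q" and "integrable \<Omega> (\<lambda>s. T (X s) * (Y s - X s))"
    and "(\<integral>p. q p \<partial>(\<Omega> \<Otimes>\<^sub>M \<Omega>)) \<le> (\<integral>s. T (X s) * (Y s - X s) \<partial>\<Omega>)"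
proof -
  let ?W = "\<Omega> \<Otimes>\<^sub>M \<Omega>"
  interpret prob_space \<Omega> by fact
  interpret P: pair_prob_space \<Omega> \<Omega> ..
  have c\<phi>: "continuous_on UNIV \<phi>"
    by (rule continuous_on_of_derivative[OF \<phi>])
  have \<phi>m[measurable]: "\<phi> \<in> borel_measurable borel" using c\<phi> by (rule borel_measurable_continuous_onI)
  have [measurable]: "T \<in> borel_measurable borel" using T by (rule borel_measurable_continuous_onI)
  have neX: "AE (s, t) in ?W. X s \<noteq> X t"
    and ilX: "integrable ?W (\<lambda>(s, t). ln \<bar>X s - X t\<bar>)"
    and i\<phi>X: "integrable \<Omega> (\<lambda>s. \<phi> (X s))"
    using fin unfolding dX[symmetric] finite_energy_distr(1)[OF \<Omega> X \<phi>m] by auto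
  have il: "integrable ?W l"
    using ilX ilY unfolding l_def case_prod_unfold by simp
  have qm[measurable]: "q \<in> borel_measurable ?W" unfolding q_def by measurable
  show good: "AE p in ?W. X (fst p) \<noteq> X (snd p) \<and> q p > - 1 \<and> l p = ln (1 + q p)"
    using neX neY AE_space
  proof eventually_elim
    case (elim p)
    obtain s t where p: "p = (s, t)" by (cases p)
    have ne: "X s \<noteq> X t" "Y s \<noteq> Y t" and sp: "s \<in> space \<Omega>" "t \<in> space \<Omega>"
      using elim by (auto simp: p space_pair_measure)
    have "1 + q p = (Y s - Y t) / (X s - X t)" using ne(1) by (simp add: q_def p field_simps)
    moreover have pos: "(Y s - Y t) / (X s - X t) > 0"
      using mono[OF sp] mono[OF sp(2,1)] ne by (cases "s \<le> t") (auto simp: zero_less_divide_iff)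
    moreover have "(Y s - Y t) / (X s - X t) = \<bar>Y s - Y t\<bar> / \<bar>X s - X t\<bar>"
      unfolding abs_divide[symmetric] using pos by (simp only: abs_of_pos)
    moreover have "ln (\<bar>Y s - Y t\<bar> / \<bar>X s - X t\<bar>) = l p" using ne by (simp add: l_def p ln_div)
    ultimately show ?case using ne(1) by (simp add: p)
  qed
  define \<eta> where "\<eta> s = Y s - X s" for s
  have \<eta>m[measurable]: "\<eta> \<in> borel_measurable \<Omega>" unfolding \<eta>_def by measurable
  have iX: "integrable \<Omega> X"
    by (rule integrable_const_bound[of _ "\<bar>a\<bar> + \<bar>b\<bar>"], rule eventually_mono[OF supp]) auto
  have i\<eta>: "integrable \<Omega> \<eta>" unfolding \<eta>_def using iX iY by simp
  define r where "r n = real (Suc n)" for n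
  define s where "s n = 1 / (r n)\<^sup>2" for n
  have r1: "r n \<ge> 1" for n by (simp add: r_def)
  have s01: "0 < s n" "s n \<le> 1" "s n * r n \<le> 1" for n
    using r1[of n] by (auto simp: s_def power2_eq_square divide_le_eq mult_le_one one_le_mult_iff
        intro: mult_ge1_I)
  have "(\<lambda>n. (1 / r n) * (1 / r n)) \<longlonglongrightarrow> 0 * 0"
    unfolding r_def by (intro tendsto_mult LIMSEQ_Suc[OF lim_1_over_n])
  moreover have "s = (\<lambda>n. (1 / r n) * (1 / r n))" by (simp add: s_def fun_eq_iff power2_eq_square)
  ultimately have s0: "s \<longlonglongrightarrow> 0" by simp
  have sne: "s n \<noteq> 0" for n using s01(1)[of n] by simp
  have sat: "filterlim s (at 0) sequentially"
    using s0 sne by (auto simp: filterlim_at intro!: always_eventually)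
  have clip_ev: "\<forall>\<^sub>F n in sequentially. clip (r n) z = z" for z
  proof -
    obtain N where "\<bar>z\<bar> \<le> real N" using real_arch_simple by blast
    then have "clip (r n) z = z" if "n \<ge> N" for n
    proof -
      have "\<bar>z\<bar> \<le> r n" using that \<open>\<bar>z\<bar> \<le> real N\<close> by (simp add: r_def)
      then show ?thesis by (auto simp: clip_def max_def min_def)
    qed
    then show ?thesis by (auto simp: eventually_sequentially)
  qed
  have cm[measurable]: "clip x \<in> borel_measurable borel" for x unfolding clip_def by measurable
  define Z where "Z n t = X t + s n * clip (r n) (\<eta> t)" for n t
  have Zm[measurable]: "Z n \<in> borel_measurable \<Omega>" for n unfolding Z_def by measurable
  define Q where "Q n p = (clip (r n) (\<eta> (fst p)) - clip (r n) (\<eta> (snd p))) / (X (fst p) - X (snd p))" for n p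
  have Qm[measurable]: "Q n \<in> borel_measurable ?W" for n unfolding Q_def by measurable
  define k where "k n p = ln (1 + s n * Q n p)" for n p
  have km[measurable]: "k n \<in> borel_measurable ?W" for n unfolding k_def by measurable
  have kfacts: "AE p in ?W. Z n (fst p) \<noteq> Z n (snd p) \<and>
      ln \<bar>Z n (fst p) - Z n (snd p)\<bar> = ln \<bar>X (fst p) - X (snd p)\<bar> + k n p \<and>
      \<bar>k n p\<bar> \<le> \<bar>l p\<bar> \<and> - \<bar>l p\<bar> \<le> k n p / s n" for n
    using good
  proof eventually_elim
    case (elim p)
    have between: "0 \<le> Q n p \<and> Q n p \<le> q p \<or> q p \<le> Q n p \<and> Q n p \<le> 0"
      using clip_quotient[of "r n" "\<eta> (fst p)" "\<eta> (snd p)" "X (fst p) - X (snd p)"] r1[of n]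
      by (simp add: Q_def q_def \<eta>_def)
    note B = ln_interpolation_bounds[OF _ between s01(1,2)[of n]]
    have d: "Z n (fst p) - Z n (snd p) = (X (fst p) - X (snd p)) * (1 + s n * Q n p)"
      using elim by (simp add: Z_def Q_def field_simps)
    have pos: "1 + s n * Q n p > 0" using B(1) elim by auto
    have "\<bar>Z n (fst p) - Z n (snd p)\<bar> = \<bar>X (fst p) - X (snd p)\<bar> * (1 + s n * Q n p)"
      unfolding d abs_mult using pos by simp
    then have "ln \<bar>Z n (fst p) - Z n (snd p)\<bar> = ln \<bar>X (fst p) - X (snd p)\<bar> + k n p"
      using elim pos by (simp add: ln_mult k_def)
    moreover have "Z n (fst p) \<noteq> Z n (snd p)" using d elim pos by auto
    ultimately show ?case using B(2,3) elim by (simp add: k_def)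
  qed
  have ik: "integrable ?W (k n)" for n
    by (rule Bochner_Integration.integrable_bound[OF il km], rule eventually_mono[OF kfacts[of n]]) auto
  obtain C where C: "\<And>x. x \<in> {a - 1..b + 1} \<Longrightarrow> \<bar>\<phi> x\<bar> \<le> C"
    using continuous_bounded_interval[OF c\<phi>] by blast
  obtain M where M: "\<And>x. x \<in> {a - 1..b + 1} \<Longrightarrow> \<bar>T x\<bar> \<le> M"
    using continuous_bounded_interval[OF T] by blast
  have sclip: "\<bar>s n * clip (r n) z\<bar> \<le> 1" "\<bar>clip (r n) z\<bar> \<le> \<bar>z\<bar>" for n z
  proof -
    have "\<bar>clip (r n) z\<bar> \<le> r n" using r1[of n] by (auto simp: clip_def)
    then have "s n * \<bar>clip (r n) z\<bar> \<le> s n * r n" using s01(1)[of n] by (intro mult_left_mono) auto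
    from order_trans[OF this s01(3)] show "\<bar>s n * clip (r n) z\<bar> \<le> 1"
      unfolding abs_mult using s01(1)[of n] by (simp only: abs_of_pos)
    show "\<bar>clip (r n) z\<bar> \<le> \<bar>z\<bar>" using r1[of n] by (auto simp: clip_def)
  qed
  have Zin: "AE t in \<Omega>. X t \<in> {a - 1..b + 1} \<and> Z n t \<in> {a - 1..b + 1}" for n
    using supp
  proof eventually_elim
    case (elim t)
    then show ?case using sclip(1)[of n "\<eta> t"] by (auto simp: Z_def abs_le_iff)
  qed
  have i\<phi>Z: "integrable \<Omega> (\<lambda>t. \<phi> (Z n t))" for n
    by (rule integrable_const_bound[of _ C], rule eventually_mono[OF Zin[of n]]) (use C in auto)
  have ilZ: "integrable ?W (\<lambda>(t, t'). ln \<bar>Z n t - Z n t'\<bar>)"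
    and eqlZ: "(\<integral>(t, t'). ln \<bar>Z n t - Z n t'\<bar> \<partial>?W)
      = (\<integral>(t, t'). ln \<bar>X t - X t'\<bar> \<partial>?W) + (\<integral>p. k n p \<partial>?W)" for n
  proof -
    have ae: "AE p in ?W. (case p of (t, t') \<Rightarrow> ln \<bar>Z n t - Z n t'\<bar>)
        = (case p of (t, t') \<Rightarrow> ln \<bar>X t - X t'\<bar>) + k n p"
      using kfacts[of n] by eventually_elim (auto simp: case_prod_unfold)
    have i: "integrable ?W (\<lambda>p. (case p of (t, t') \<Rightarrow> ln \<bar>X t - X t'\<bar>) + k n p)"
      by (rule Bochner_Integration.integrable_add[OF ilX ik])
    show "integrable ?W (\<lambda>(t, t'). ln \<bar>Z n t - Z n t'\<bar>)"
      by (rule integrable_cong_AE[THEN iffD2, OF _ _ ae i]) measurable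
    have "(\<integral>(t, t'). ln \<bar>Z n t - Z n t'\<bar> \<partial>?W)
        = (\<integral>p. (case p of (t, t') \<Rightarrow> ln \<bar>X t - X t'\<bar>) + k n p \<partial>?W)"
      by (rule integral_cong_AE[OF _ _ ae]) measurable
    also have "\<dots> = (\<integral>(t, t'). ln \<bar>X t - X t'\<bar> \<partial>?W) + (\<integral>p. k n p \<partial>?W)"
      by (rule Bochner_Integration.integral_add[OF ilX ik])
    finally show "(\<integral>(t, t'). ln \<bar>Z n t - Z n t'\<bar> \<partial>?W)
      = (\<integral>(t, t'). ln \<bar>X t - X t'\<bar> \<partial>?W) + (\<integral>p. k n p \<partial>?W)" .
  qed
  define D where "D n t = (\<phi> (Z n t) - \<phi> (X t)) / s n" for n t
  have iD: "integrable \<Omega> (D n)" for n unfolding D_def using i\<phi>Z i\<phi>X by simp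
  have kD: "(\<integral>p. k n p / s n \<partial>?W) \<le> (\<integral>t. D n t \<partial>\<Omega>)" for n
  proof -
    have "finite_energy \<phi> (distr \<Omega> borel (Z n))"
      unfolding finite_energy_distr(1)[OF \<Omega> Zm \<phi>m]
      using ilZ i\<phi>Z eventually_mono[OF kfacts[of n], of "\<lambda>(t, t'). Z n t \<noteq> Z n t'"] by auto
    then have "energy \<phi> \<nu> \<le> energy \<phi> (distr \<Omega> borel (Z n))"
      by (rule free_gibbs_energy_le[OF G fin])
    then have "(\<integral>p. k n p \<partial>?W) \<le> (\<integral>t. \<phi> (Z n t) \<partial>\<Omega>) - (\<integral>t. \<phi> (X t) \<partial>\<Omega>)"
      unfolding dX[symmetric] finite_energy_distr(2)[OF \<Omega> X \<phi>m] finite_energy_distr(2)[OF \<Omega> Zm \<phi>m] eqlZ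
      by simp
    then have "(\<integral>p. k n p \<partial>?W) / s n \<le> ((\<integral>t. \<phi> (Z n t) \<partial>\<Omega>) - (\<integral>t. \<phi> (X t) \<partial>\<Omega>)) / s n"
      using s01(1)[of n] by (intro divide_right_mono) auto
    then show ?thesis unfolding D_def using i\<phi>Z i\<phi>X by simp
  qed
  have Dlim: "AE t in \<Omega>. (\<lambda>n. D n t) \<longlonglongrightarrow> T (X t) * \<eta> t"
  proof (rule AE_I2)
    fix t
    have "\<forall>\<^sub>F n in sequentially. (\<phi> (X t + s n * \<eta> t) - \<phi> (X t)) / s n = D n t"
      using clip_ev[of "\<eta> t"] by eventually_elim (simp add: D_def Z_def)
    then show "(\<lambda>n. D n t) \<longlonglongrightarrow> T (X t) * \<eta> t"
      by (rule Lim_transform_eventually[OF directional_difference_tendsto[OF \<phi> sat]])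
  qed
  have Db: "AE t in \<Omega>. norm (D n t) \<le> M * \<bar>\<eta> t\<bar>" for n
    using Zin[of n]
  proof eventually_elim
    case (elim t)
    have M0: "M \<ge> 0" using M[of "X t"] elim by auto
    have "\<bar>\<phi> (Z n t) - \<phi> (X t)\<bar> \<le> M * \<bar>Z n t - X t\<bar>"
      using abs_diff_le_of_deriv_le[of "a - 1" "b + 1" \<phi> T M "Z n t" "X t"] \<phi> M elim by auto
    also have "\<dots> = M * (s n * \<bar>clip (r n) (\<eta> t)\<bar>)" using s01(1)[of n] by (simp add: Z_def abs_mult)
    also have "\<dots> \<le> M * (s n * \<bar>\<eta> t\<bar>)"
      using sclip(2) s01(1)[of n] M0 by (intro mult_left_mono) auto
    finally show ?case using s01(1)[of n] by (simp add: D_def abs_divide divide_le_eq mult_ac)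
  qed
  have Dm: "D n \<in> borel_measurable \<Omega>" for n unfolding D_def by measurable
  have iM: "integrable \<Omega> (\<lambda>t. M * \<bar>\<eta> t\<bar>)" using i\<eta> by simp
  have DCT: "integrable \<Omega> (\<lambda>t. T (X t) * \<eta> t)" "(\<lambda>n. \<integral>t. D n t \<partial>\<Omega>) \<longlonglongrightarrow> (\<integral>t. T (X t) * \<eta> t \<partial>\<Omega>)"
    using integrable_dominated_convergence[OF _ _ iM Dlim Db]
      integral_dominated_convergence[OF _ _ iM Dlim Db] Dm by auto
  then show "integrable \<Omega> (\<lambda>s. T (X s) * (Y s - X s))" by (simp add: \<eta>_def)
  have lims: "AE p in ?W. (\<lambda>n. k n p / s n) \<longlonglongrightarrow> q p"
  proof (rule AE_I2)
    fix p
    have "((\<lambda>x. ln x) has_real_derivative 1) (at (1::real))" by (auto intro!: derivative_eq_intros)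
    from directional_difference_tendsto[OF this sat, of "q p"]
    have 1: "(\<lambda>n. ln (1 + s n * q p) / s n) \<longlonglongrightarrow> q p" by simp
    have "\<forall>\<^sub>F n in sequentially. ln (1 + s n * q p) / s n = k n p / s n"
      using clip_ev[of "\<eta> (fst p)"] clip_ev[of "\<eta> (snd p)"]
      by eventually_elim (simp add: k_def Q_def q_def \<eta>_def)
    then show "(\<lambda>n. k n p / s n) \<longlonglongrightarrow> q p" by (rule Lim_transform_eventually[OF 1])
  qed
  define c where "c = (\<integral>p. \<bar>l p\<bar> \<partial>?W)"
  define e where "e = (\<integral>t. T (X t) * \<eta> t \<partial>\<Omega>)"
  have ikl: "integrable ?W (\<lambda>p. k n p / s n + \<bar>l p\<bar>)" for n using ik il by simp
  have kl0: "AE p in ?W. 0 \<le> k n p / s n + \<bar>l p\<bar>" for n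
    using kfacts[of n] by eventually_elim linarith
  have kle: "(\<integral>p. k n p / s n + \<bar>l p\<bar> \<partial>?W) \<le> (\<integral>t. D n t \<partial>\<Omega>) + c" for n
  proof -
    have "integrable ?W (\<lambda>p. k n p / s n)" using ik by simp
    then have "(\<integral>p. k n p / s n + \<bar>l p\<bar> \<partial>?W) = (\<integral>p. k n p / s n \<partial>?W) + c"
      unfolding c_def by (intro Bochner_Integration.integral_add integrable_abs il)
    then show ?thesis using kD[of n] by simp
  qed
  have Dclim: "(\<lambda>n. (\<integral>t. D n t \<partial>\<Omega>) + c) \<longlonglongrightarrow> e + c"
    unfolding e_def by (intro tendsto_intros DCT)
  have ec: "e + c \<ge> 0"
  proof (rule LIMSEQ_le_const[OF Dclim], intro exI allI impI)
    fix n :: nat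
    have "0 \<le> (\<integral>p. k n p / s n + \<bar>l p\<bar> \<partial>?W)" by (rule integral_nonneg_AE[OF kl0])
    then show "0 \<le> (\<integral>t. D n t \<partial>\<Omega>) + c" using kle[of n] by linarith
  qed
  have q0: "AE p in ?W. 0 \<le> q p + \<bar>l p\<bar>"
    using good
  proof eventually_elim
    case (elim p)
    then have "l p \<le> q p" using ln_le_minus_one[of "1 + q p"] by simp
    then show ?case by linarith
  qed
  have "(\<integral>\<^sup>+p. ennreal (q p + \<bar>l p\<bar>) \<partial>?W)
      = (\<integral>\<^sup>+p. liminf (\<lambda>n. ennreal (k n p / s n + \<bar>l p\<bar>)) \<partial>?W)"
  proof (rule nn_integral_cong_AE)
    show "AE p in ?W. ennreal (q p + \<bar>l p\<bar>) = liminf (\<lambda>n. ennreal (k n p / s n + \<bar>l p\<bar>))"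
      using lims
    proof eventually_elim
      case (elim p)
      have "(\<lambda>n. ennreal (k n p / s n + \<bar>l p\<bar>)) \<longlonglongrightarrow> ennreal (q p + \<bar>l p\<bar>)"
        by (intro tendsto_ennrealI tendsto_add elim tendsto_const)
      then show ?case by (simp add: lim_imp_Liminf)
    qed
  qed
  also have "\<dots> \<le> liminf (\<lambda>n. \<integral>\<^sup>+p. ennreal (k n p / s n + \<bar>l p\<bar>) \<partial>?W)"
    by (rule nn_integral_liminf) (use ikl in auto)
  also have "\<dots> \<le> liminf (\<lambda>n. ennreal ((\<integral>t. D n t \<partial>\<Omega>) + c))"
  proof (intro Liminf_mono always_eventually allI)
    fix n
    show "(\<integral>\<^sup>+p. ennreal (k n p / s n + \<bar>l p\<bar>) \<partial>?W) \<le> ennreal ((\<integral>t. D n t \<partial>\<Omega>) + c)"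
      unfolding nn_integral_eq_integral[OF ikl kl0] by (intro ennreal_leI kle)
  qed
  also have "\<dots> = ennreal (e + c)"
    by (intro lim_imp_Liminf tendsto_ennrealI Dclim) simp
  finally have le: "(\<integral>\<^sup>+p. ennreal (q p + \<bar>l p\<bar>) \<partial>?W) \<le> ennreal (e + c)" .
  have iql: "integrable ?W (\<lambda>p. q p + \<bar>l p\<bar>)"
  proof (rule integrableI_nonneg[OF _ q0])
    show "(\<lambda>p. q p + \<bar>l p\<bar>) \<in> borel_measurable ?W" using il by measurable
    show "(\<integral>\<^sup>+p. ennreal (q p + \<bar>l p\<bar>) \<partial>?W) < \<infinity>"
      using le by (rule le_less_trans) simp
  qed
  then have "integrable ?W (\<lambda>p. (q p + \<bar>l p\<bar>) - \<bar>l p\<bar>)"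
    by (intro Bochner_Integration.integrable_diff integrable_abs il)
  then show iq: "integrable ?W q" by simp
  have "ennreal (\<integral>p. q p + \<bar>l p\<bar> \<partial>?W) \<le> ennreal (e + c)"
    using le unfolding nn_integral_eq_integral[OF iql q0] .
  then have "(\<integral>p. q p + \<bar>l p\<bar> \<partial>?W) \<le> e + c" using ec by (simp add: ennreal_le_iff)
  moreover have "(\<integral>p. q p + \<bar>l p\<bar> \<partial>?W) = (\<integral>p. q p \<partial>?W) + c"
    unfolding c_def by (intro Bochner_Integration.integral_add iq integrable_abs il)
  ultimately show "(\<integral>p. q p \<partial>?W) \<le> (\<integral>s. T (X s) * (Y s - X s) \<partial>\<Omega>)"
    by (simp add: e_def \<eta>_def)
qed

text \<open>
  Along the monotone coupling \<open>(X, Y)\<close> of \<open>\<nu>\<close> with a competitor \<open>\<rho>\<close>, the energy for \<open>\<psi>\<close> increases by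
  \<open>\<integral> \<theta> + \<integral> T X (Y - X) - \<integral> ln (1 + q)\<close>, where \<open>\<theta> \<ge> 0\<close> is the deviation of \<open>\<psi>\<close> from its tangents.  As
  \<open>ln (1 + q) \<le> q\<close> and \<open>\<integral> q \<le> \<integral> T X (Y - X)\<close>, this is nonnegative.  In the case of equality \<open>q\<close> and \<open>\<theta>\<close>
  vanish almost everywhere: the displacement is constant and \<open>\<psi>\<close> is affine along it, which the last
  two assumptions exclude unless \<open>\<rho> = \<nu>\<close>.
\<close>

lemma free_gibbs_change_potential:
  fixes \<phi> \<psi> T \<psi>' :: "real \<Rightarrow> real"
  assumes G: "free_gibbs \<phi> \<nu>" and fin: "finite_energy \<phi> \<nu>"
    and \<phi>: "\<And>x. (\<phi> has_real_derivative T x) (at x)" and T: "continuous_on UNIV T"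
    and supp: "AE x in \<nu>. x \<in> {a..b}"
    and \<psi>: "\<And>x. (\<psi> has_real_derivative \<psi>' x) (at x)" and cv: "convex_on UNIV \<psi>" and co: "coercive \<psi>"
    and agree: "\<And>x. x \<in> {a..b} \<Longrightarrow> \<psi> x = \<phi> x \<and> \<psi>' x = T x"
    and mass: "measure \<nu> {p<..<r} > 0"
    and strict: "\<And>x z. x \<in> {p<..<r} \<Longrightarrow> z \<in> {p<..<r} \<Longrightarrow> x < z \<Longrightarrow> \<psi>' x < \<psi>' z"
  shows "free_gibbs \<psi> \<nu>"
  unfolding free_gibbs_def
proof (intro conjI allI impI)
  show rd: "real_distribution \<nu>" using fin by (simp add: finite_energy_def)
  fix \<rho> assume \<rho>: "real_distribution \<rho> \<and> \<rho> \<noteq> \<nu>"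
  have c\<psi>: "continuous_on UNIV \<psi>"
    by (rule continuous_on_of_derivative[OF \<psi>])
  have \<psi>m[measurable]: "\<psi> \<in> borel_measurable borel" using c\<psi> by (rule borel_measurable_continuous_onI)
  have c\<phi>: "continuous_on UNIV \<phi>"
    by (rule continuous_on_of_derivative[OF \<phi>])
  have \<phi>m[measurable]: "\<phi> \<in> borel_measurable borel" using c\<phi> by (rule borel_measurable_continuous_onI)
  have [measurable]: "T \<in> borel_measurable borel" using T by (rule borel_measurable_continuous_onI)
  note tangent = convex_tangent[OF cv \<psi>]
  interpret N: real_distribution \<nu> by (rule rd)
  have AEeq: "AE x in \<nu>. \<phi> x = \<psi> x" using supp by eventually_elim (use agree in auto)
  have fin\<psi>: "finite_energy \<psi> \<nu>"
    using fin integrable_cong_AE[OF _ _ AEeq] by (simp add: finite_energy_def)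
  show "free_energy \<psi> \<nu> < free_energy \<psi> \<rho>"
  proof (cases "free_energy \<psi> \<rho> < \<infinity>")
    case False
    then show ?thesis using free_energy_eq_energy[OF fin\<psi>] by (simp add: less_le)
  next
    case True
    have fin\<rho>: "finite_energy \<psi> \<rho>"
      by (rule finite_energy_of_free_energy[OF co \<psi>m _ True]) (use \<rho> in simp)
    have "energy \<psi> \<nu> < energy \<psi> \<rho>"
    proof (rule ccontr)
      assume "\<not> energy \<psi> \<nu> < energy \<psi> \<rho>"
      then have E: "energy \<psi> \<rho> \<le> energy \<psi> \<nu>" by simp
      obtain \<Omega> :: "real measure" and X Y :: "real \<Rightarrow> real" where \<Omega>: "prob_space \<Omega>"
        and X[measurable]: "X \<in> borel_measurable \<Omega>" and Y[measurable]: "Y \<in> borel_measurable \<Omega>"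
        and dX: "distr \<Omega> borel X = \<nu>" and dY: "distr \<Omega> borel Y = \<rho>"
        and mono: "\<And>s t. s \<in> space \<Omega> \<Longrightarrow> t \<in> space \<Omega> \<Longrightarrow> s \<le> t \<Longrightarrow> X s \<le> X t \<and> Y s \<le> Y t"
        using monotone_coupling[OF rd, of \<rho>] \<rho> by blast
      interpret prob_space \<Omega> by fact
      let ?W = "\<Omega> \<Otimes>\<^sub>M \<Omega>"
      interpret P: pair_prob_space \<Omega> \<Omega> ..
      have fX: "AE (s, t) in ?W. X s \<noteq> X t"
        "integrable ?W (\<lambda>(s, t). ln \<bar>X s - X t\<bar>)" "integrable \<Omega> (\<lambda>s. \<psi> (X s))"
        using fin\<psi> unfolding dX[symmetric] finite_energy_distr(1)[OF \<Omega> X \<psi>m] by auto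
      have fY: "AE (s, t) in ?W. Y s \<noteq> Y t"
        "integrable ?W (\<lambda>(s, t). ln \<bar>Y s - Y t\<bar>)" "integrable \<Omega> (\<lambda>s. \<psi> (Y s))"
        using fin\<rho> unfolding dY[symmetric] finite_energy_distr(1)[OF \<Omega> Y \<psi>m] by auto
      have "integrable \<rho> (\<lambda>x. \<bar>x\<bar>)"
        by (rule integrable_abs_of_coercive[OF co]) (use \<rho> fin\<rho> in \<open>auto simp: finite_energy_def\<close>)
      then have "integrable \<Omega> (\<lambda>s. \<bar>Y s\<bar>)" unfolding dY[symmetric] by (simp add: integrable_distr_eq)
      then have iY: "integrable \<Omega> Y" by (simp add: integrable_abs_iff)
      have suppX: "AE s in \<Omega>. X s \<in> {a..b}"
        using supp unfolding dX[symmetric] by (subst (asm) AE_distr_iff) auto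
      define q where "q p = ((Y (fst p) - X (fst p)) - (Y (snd p) - X (snd p))) / (X (fst p) - X (snd p))" for p
      define l where "l p = ln \<bar>Y (fst p) - Y (snd p)\<bar> - ln \<bar>X (fst p) - X (snd p)\<bar>" for p
      note V = coupling_first_variation[OF G fin \<phi> T \<Omega> X Y dX mono suppX iY fY(1,2)]
      have good: "AE p in ?W. X (fst p) \<noteq> X (snd p) \<and> q p > - 1 \<and> l p = ln (1 + q p)"
        unfolding q_def l_def by (rule V(1)) assumption+
      have iq: "integrable ?W q" unfolding q_def[abs_def] by (rule V(2)) assumption+
      have iT: "integrable \<Omega> (\<lambda>s. T (X s) * (Y s - X s))" by (rule V(3)) assumption+
      have qle: "(\<integral>p. q p \<partial>?W) \<le> (\<integral>s. T (X s) * (Y s - X s) \<partial>\<Omega>)"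
        unfolding q_def by (rule V(4)) assumption+
      have il: "integrable ?W l"
        using fX(2) fY(2) unfolding l_def case_prod_unfold by simp
      define \<theta> where "\<theta> s = \<psi> (Y s) - \<psi> (X s) - T (X s) * (Y s - X s)" for s
      have i\<theta>: "integrable \<Omega> \<theta>" unfolding \<theta>_def using fX(3) fY(3) iT by simp
      have \<theta>0: "AE s in \<Omega>. 0 \<le> \<theta> s"
        using suppX
      proof eventually_elim
        case (elim s)
        then show ?case using tangent[where x = "X s" and z = "Y s"] agree[of "X s"] by (simp add: \<theta>_def)
      qed
      have ql0: "AE p in ?W. 0 \<le> q p - l p"
        using good
      proof eventually_elim
        case (elim p)
        then show ?case using ln_le_minus_one[of "1 + q p"] by simp
      qed
      have "energy \<psi> \<rho> - energy \<psi> \<nu> = (\<integral>s. \<theta> s \<partial>\<Omega>) + (\<integral>s. T (X s) * (Y s - X s) \<partial>\<Omega>)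
          - (\<integral>p. l p \<partial>?W)"
      proof -
        have "(\<integral>s. \<theta> s \<partial>\<Omega>) = (\<integral>s. \<psi> (Y s) \<partial>\<Omega>) - (\<integral>s. \<psi> (X s) \<partial>\<Omega>) - (\<integral>s. T (X s) * (Y s - X s) \<partial>\<Omega>)"
          unfolding \<theta>_def using fX(3) fY(3) iT by simp
        moreover have "(\<integral>p. l p \<partial>?W) = (\<integral>(s, t). ln \<bar>Y s - Y t\<bar> \<partial>?W)
            - (\<integral>(s, t). ln \<bar>X s - X t\<bar> \<partial>?W)"
          unfolding l_def using fX(2) fY(2) by (simp add: case_prod_unfold)
        ultimately show ?thesis
          unfolding dX[symmetric] dY[symmetric] finite_energy_distr(2)[OF \<Omega> X \<psi>m]
            finite_energy_distr(2)[OF \<Omega> Y \<psi>m] by simp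
      qed
      moreover have "(\<integral>p. q p - l p \<partial>?W) = (\<integral>p. q p \<partial>?W) - (\<integral>p. l p \<partial>?W)"
        using iq il by simp
      moreover have "(\<integral>s. \<theta> s \<partial>\<Omega>) \<ge> 0" by (rule integral_nonneg_AE[OF \<theta>0])
      moreover have "(\<integral>p. q p - l p \<partial>?W) \<ge> 0" by (rule integral_nonneg_AE[OF ql0])
      ultimately have z: "(\<integral>s. \<theta> s \<partial>\<Omega>) = 0" "(\<integral>p. q p - l p \<partial>?W) = 0"
        using qle E by linarith+
      have \<theta>z: "AE s in \<Omega>. \<theta> s = 0" using z(1) integral_nonneg_eq_0_iff_AE[OF i\<theta> \<theta>0] by simp
      have "AE p in ?W. q p - l p = 0"
        using z(2) integral_nonneg_eq_0_iff_AE[OF Bochner_Integration.integrable_diff[OF iq il] ql0] by simp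
      \<comment> \<open>Equality forces the coupling to be a translation.\<close>
      then have "AE p in ?W. Y (fst p) - X (fst p) = Y (snd p) - X (snd p)"
        using good
      proof eventually_elim
        case (elim p)
        then have "ln (1 + q p) = (1 + q p) - 1" by simp
        then have "1 + q p = 1" using elim ln_eq_minus_one[of "1 + q p"] by simp
        then show ?case using elim by (simp add: q_def)
      qed
      then have ae: "AE s in \<Omega>. AE t in \<Omega>. Y s - X s = Y t - X t"
        using P.AE_pair[of "\<lambda>p. Y (fst p) - X (fst p) = Y (snd p) - X (snd p)"] by simp
      have "\<exists>s0. AE t in \<Omega>. Y s0 - X s0 = Y t - X t"
      proof (rule ccontr)
        assume "\<not> ?thesis"
        then have "AE s in \<Omega>. False" by (intro eventually_mono[OF ae]) blast
        then show False by simp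
      qed
      then obtain s0 where s0: "AE t in \<Omega>. Y s0 - X s0 = Y t - X t" ..
      define c where "c = Y s0 - X s0"
      have tr: "AE t in \<Omega>. Y t = X t + c" using s0 by eventually_elim (simp add: c_def)
      have "c \<noteq> 0"
      proof
        assume "c = 0"
        then have "AE t in \<Omega>. Y t = X t" using tr by simp
        then have "distr \<Omega> borel Y = distr \<Omega> borel X" by (intro distr_cong_AE) auto
        then show False using \<rho> dX dY by simp
      qed
      have "AE s in \<Omega>. X s \<notin> {p<..<r}"
        using tr \<theta>z suppX
      proof eventually_elim
        case (elim s)
        have "\<psi> (X s + c) = \<psi> (X s) + \<psi>' (X s) * c"
          using elim agree[of "X s"] by (simp add: \<theta>_def)
        then show ?case
          using affine_on_translate_contradiction[of \<psi> \<psi>' p r "X s" c] tangent strict \<open>c \<noteq> 0\<close> by blast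
      qed
      then have "AE x in distr \<Omega> borel X. x \<notin> {p<..<r}" by (subst AE_distr_iff) auto
      then have "measure \<nu> {p<..<r} = 0" unfolding dX by (subst N.prob_eq_0) auto
      then show False using mass by simp
    qed
    then show ?thesis by (simp add: free_energy_eq_energy fin\<psi> fin\<rho>)
  qed
qed

section \<open>Convex potentials and their extension by parabolas\<close>

lemma coercive_of_slopes:
  fixes f f' :: "real \<Rightarrow> real"
  assumes tangent: "\<And>x z. f z \<ge> f x + f' x * (z - x)" and x: "f' x1 < 0" "f' x2 > 0"
  shows "coercive f"
proof -
  define k where "k = min (- f' x1) (f' x2)"
  define C where "C = \<bar>f x1 - f' x1 * x1\<bar> + \<bar>f x2 - f' x2 * x2\<bar>"
  have k: "k > 0" using x by (simp add: k_def)
  have "k * \<bar>z\<bar> - C \<le> f z" for z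
  proof (cases "z \<ge> 0")
    case True
    then have "k * z \<le> f' x2 * z" by (intro mult_right_mono) (auto simp: k_def)
    then show ?thesis using tangent[where x = x2 and z = z] True by (simp add: C_def algebra_simps)
  next
    case False
    then have "k * - z \<le> - f' x1 * - z" by (intro mult_right_mono) (auto simp: k_def)
    then show ?thesis using tangent[where x = x1 and z = z] False by (simp add: C_def algebra_simps)
  qed
  then show ?thesis unfolding coercive_def using k by blast
qed

lemma glue_has_derivative:
  fixes f g :: "real \<Rightarrow> real"
  assumes f: "\<And>x. (f has_real_derivative f' x) (at x)" and g: "\<And>x. (g has_real_derivative g' x) (at x)"
    and eq: "f c = g c" "f' c = g' c"
  shows "((\<lambda>x. if x \<le> c then f x else g x) has_real_derivative (if x \<le> c then f' x else g' x)) (at x)"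
proof -
  let ?h = "\<lambda>x. if x \<le> c then f x else g x"
  consider "x < c" | "x > c" | "x = c" by linarith
  then show ?thesis
  proof cases
    case 1
    have "(?h has_real_derivative f' x) (at x)"
      by (rule has_field_derivative_transform_within_open[OF f, of "{..<c}"]) (use 1 in auto)
    then show ?thesis using 1 by simp
  next
    case 2
    have "(?h has_real_derivative g' x) (at x)"
      by (rule has_field_derivative_transform_within_open[OF g, of "{c<..}"]) (use 2 in auto)
    then show ?thesis using 2 by simp
  next
    case 3
    have L: "((\<lambda>y. (f y - f c) / (y - c)) \<longlongrightarrow> f' c) (at_left c)"
      using f[of c] by (auto simp: has_field_derivative_iff intro: filterlim_mono at_le)
    have R: "((\<lambda>y. (g y - g c) / (y - c)) \<longlongrightarrow> g' c) (at_right c)"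
      using g[of c] by (auto simp: has_field_derivative_iff intro: filterlim_mono at_le)
    have "((\<lambda>y. (?h y - ?h c) / (y - c)) \<longlongrightarrow> f' c) (at c)"
    proof (rule filterlim_split_at)
      show "((\<lambda>y. (?h y - ?h c) / (y - c)) \<longlongrightarrow> f' c) (at_left c)"
        by (rule Lim_transform_eventually[OF L]) (auto simp: eventually_at_filter)
      show "((\<lambda>y. (?h y - ?h c) / (y - c)) \<longlongrightarrow> f' c) (at_right c)"
        unfolding eq(2)
        by (rule Lim_transform_eventually[OF R]) (auto simp: eventually_at_filter eq(1))
    qed
    then show ?thesis using 3 by (simp add: has_field_derivative_iff)
  qed
qed

text \<open>
  Beyond the end points the second derivative is frozen at its boundary values.  The extension is
  therefore of class \<open>C\<^sup>2\<close>, and bounds for the second derivative on \<open>{a..b}\<close> hold on the whole line.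
  Here \<open>f1\<close> and \<open>f2\<close> are meant to be the first two derivatives of \<open>f\<close>.
\<close>

definition parabola_extension ::
    "real \<Rightarrow> real \<Rightarrow> (real \<Rightarrow> real) \<Rightarrow> (real \<Rightarrow> real) \<Rightarrow> (real \<Rightarrow> real) \<Rightarrow> real \<Rightarrow> real" where
  "parabola_extension a b f f1 f2 x =
     (if x \<le> b then if x \<le> a then f a + f1 a * (x - a) + f2 a / 2 * (x - a)\<^sup>2 else f x
      else f b + f1 b * (x - b) + f2 b / 2 * (x - b)\<^sup>2)"

definition affine_extension :: "real \<Rightarrow> real \<Rightarrow> (real \<Rightarrow> real) \<Rightarrow> (real \<Rightarrow> real) \<Rightarrow> real \<Rightarrow> real" where
  "affine_extension a b f1 f2 x =
     (if x \<le> b then if x \<le> a then f1 a + f2 a * (x - a) else f1 x else f1 b + f2 b * (x - b))"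

lemma extension_derivatives:
  fixes f f1 f2 :: "real \<Rightarrow> real"
  assumes "a < b" and f: "\<And>x. (f has_real_derivative f1 x) (at x)"
    and f1: "\<And>x. (f1 has_real_derivative f2 x) (at x)"
  shows "(parabola_extension a b f f1 f2 has_real_derivative affine_extension a b f1 f2 x) (at x)"
    and "(affine_extension a b f1 f2 has_real_derivative f2 (max a (min b x))) (at x)"
proof -
  have par: "((\<lambda>x. f c + f1 c * (x - c) + f2 c / 2 * (x - c)\<^sup>2) has_real_derivative f1 c + f2 c * (x - c)) (at x)" for c x
    by (auto intro!: derivative_eq_intros)
  have aff: "((\<lambda>x. f1 c + f2 c * (x - c)) has_real_derivative f2 c) (at x)" for c x
    by (auto intro!: derivative_eq_intros)
  show "(parabola_extension a b f f1 f2 has_real_derivative affine_extension a b f1 f2 x) (at x)"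
    unfolding parabola_extension_def affine_extension_def
    by (intro glue_has_derivative par f) (use \<open>a < b\<close> in auto)
  have "(affine_extension a b f1 f2 has_real_derivative
      (if x \<le> b then if x \<le> a then f2 a else f2 x else f2 b)) (at x)"
    unfolding affine_extension_def
    by (intro glue_has_derivative aff f1) (use \<open>a < b\<close> in auto)
  also have "(if x \<le> b then if x \<le> a then f2 a else f2 x else f2 b) = f2 (max a (min b x))"
    using \<open>a < b\<close> by (auto simp: max_def min_def)
  finally show "(affine_extension a b f1 f2 has_real_derivative f2 (max a (min b x))) (at x)" .
qed

lemma C_class_has_derivative:
  assumes "C_class k f" "j < k"
  shows "((deriv ^^ j) f has_real_derivative (deriv ^^ Suc j) f x) (at x)"
  using assms by (simp add: C_class_def differentiable_on_def DERIV_deriv_iff_real_differentiable)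

lemma C_class_2I:
  assumes f: "\<And>x. (f has_real_derivative f1 x) (at x)" and f1: "\<And>x. (f1 has_real_derivative f2 x) (at x)"
    and f2: "continuous_on UNIV f2"
  shows "C_class 2 f"
proof -
  have "deriv f = f1" "deriv f1 = f2" using f f1 by (auto intro!: ext DERIV_imp_deriv)
  moreover have "f differentiable at x" "f1 differentiable at x" for x
    using f f1 by (auto simp: real_differentiable_def)
  ultimately show ?thesis
    using f2 by (auto simp: C_class_def numeral_2_eq_2 less_Suc_eq differentiable_on_def)
qed

lemma free_dq_bound:
  assumes f: "\<And>x. (f has_real_derivative f' x) (at x)" and b: "\<And>x. x \<in> {a..b} \<Longrightarrow> \<bar>f' x\<bar> \<le> L"
    and "x \<in> {a..b}" "y \<in> {a..b}"
  shows "\<bar>free_dq f x y\<bar> \<le> L"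
proof (cases "x = y")
  case True
  then show ?thesis using b[of x] assms(3) DERIV_imp_deriv[OF f[of x]] by (simp add: free_dq_def)
next
  case False
  have "\<bar>f x - f y\<bar> \<le> L * \<bar>x - y\<bar>" by (rule abs_diff_le_of_deriv_le[of a b f f']) (use assms in auto)
  then show ?thesis using False by (simp add: free_dq_def abs_divide divide_le_eq)
qed

section \<open>The moment map of a uniformly convex potential\<close>

lemma strong_convexity_coercive_deriv2_ge:
  fixes u u1 u2 :: "real \<Rightarrow> real"
  assumes \<epsilon>: "\<epsilon> > 0" and cv: "convex_on UNIV (\<lambda>x. u x - \<epsilon> / 2 * x\<^sup>2)"
    and u: "\<And>x. (u has_real_derivative u1 x) (at x)" and u1: "\<And>x. (u1 has_real_derivative u2 x) (at x)"
  shows "coercive u" "\<epsilon> \<le> u2 x"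
proof -
  define g where "g x = u x - \<epsilon> / 2 * x\<^sup>2" for x
  define g1 where "g1 x = u1 x - \<epsilon> * x" for x
  have cvg: "convex_on UNIV g" using cv by (simp add: g_def[abs_def])
  have g: "(g has_real_derivative g1 x) (at x)" for x
    unfolding g_def g1_def by (auto intro!: derivative_eq_intros u)
  have g1: "(g1 has_real_derivative u2 x - \<epsilon>) (at x)" for x
    unfolding g1_def by (auto intro!: derivative_eq_intros u1)
  have tangent: "g z \<ge> g x + g1 x * (z - x)" for x z
    using convex_tangent[OF cvg g] .
  have "mono g1" by (rule convex_deriv_mono[OF cvg g])
  then have "0 \<le> u2 x - \<epsilon>" by (intro mono_on_imp_deriv_nonneg[OF _ g1]) auto
  then show "\<epsilon> \<le> u2 x" by simp
  have "1 * \<bar>x\<bar> - ((\<bar>g1 0\<bar> + 1)\<^sup>2 / (2 * \<epsilon>) - g 0) \<le> u x" for x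
  proof -
    define k where "k = \<bar>g1 0\<bar> + 1"
    have "- (\<bar>g1 0\<bar> * \<bar>x\<bar>) \<le> g1 0 * x" by (simp add: abs_mult[symmetric])
    then have "g 0 - \<bar>g1 0\<bar> * \<bar>x\<bar> + \<epsilon> / 2 * x\<^sup>2 \<le> u x" using tangent[of 0 x] by (simp add: g_def)
    moreover have "k * \<bar>x\<bar> \<le> k\<^sup>2 / (2 * \<epsilon>) + \<epsilon> / 2 * x\<^sup>2"
    proof -
      have "0 \<le> (k - \<epsilon> * \<bar>x\<bar>)\<^sup>2 / (2 * \<epsilon>)" using \<epsilon> by simp
      also have "(k - \<epsilon> * \<bar>x\<bar>)\<^sup>2 / (2 * \<epsilon>) = k\<^sup>2 / (2 * \<epsilon>) + \<epsilon> / 2 * x\<^sup>2 - k * \<bar>x\<bar>"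
        using \<epsilon> by (simp add: power2_diff power_mult_distrib field_simps) (simp add: power2_eq_square)
      finally show ?thesis by simp
    qed
    ultimately show ?thesis unfolding k_def[symmetric] by (simp add: k_def distrib_right)
  qed
  then show "coercive u" unfolding coercive_def by (intro exI[of _ 1]) auto
qed

text \<open>
  A function with mean \<open>0\<close> that has a constant sign vanishes almost everywhere, contrary to the
  fact that the push-forward has no atoms.
\<close>

lemma centered_push_forward_signs:
  fixes T :: "'a \<Rightarrow> real"
  assumes prob: "prob_space \<nu>" and T: "integrable \<nu> T" "(\<integral>x. T x \<partial>\<nu>) = 0"
    and ne: "AE (x, y) in \<nu> \<Otimes>\<^sub>M \<nu>. T x \<noteq> T y"
  shows "\<not> (AE x in \<nu>. 0 \<le> T x)" "\<not> (AE x in \<nu>. T x \<le> 0)"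
proof -
  interpret prob_space \<nu> by fact
  interpret P: pair_prob_space \<nu> \<nu> ..
  have contra: False if z: "AE x in \<nu>. T x = 0"
  proof -
    have "AE x in \<nu>. AE y in \<nu>. T x \<noteq> T y" using P.AE_pair[OF ne] by simp
    then have "AE x in \<nu>. False"
    proof (rule eventually_elim2[OF _ z])
      fix x assume x: "AE y in \<nu>. T x \<noteq> T y" "T x = 0"
      have "AE y in \<nu>. False" by (rule eventually_elim2[OF x(1) z]) (use x(2) in simp)
      then show False by simp
    qed
    then show False by simp
  qed
  show "\<not> (AE x in \<nu>. 0 \<le> T x)"
    using contra integral_nonneg_eq_0_iff_AE[OF T(1)] T(2) by auto
  show "\<not> (AE x in \<nu>. T x \<le> 0)"
  proof
    assume le: "AE x in \<nu>. T x \<le> 0"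
    have "integrable \<nu> (\<lambda>x. - T x)" using T by simp
    from integral_nonneg_eq_0_iff_AE[OF this] have "AE x in \<nu>. - T x = 0" using le T(2) by simp
    then show False using contra by simp
  qed
qed

lemma deriv_sign_at_maximum:
  fixes f f' :: "real \<Rightarrow> real"
  assumes f: "(f has_real_derivative D) (at x)" and ab: "a < b" "x \<in> {a..b}"
    and max: "\<And>y. y \<in> {a..b} \<Longrightarrow> f y \<le> f x"
  shows "D = 0 \<or> (x = b \<and> D \<ge> 0) \<or> (x = a \<and> D \<le> 0)"
proof -
  have "D \<ge> 0" if "a < x"
  proof (rule ccontr)
    assume "\<not> D \<ge> 0"
    then obtain d where d: "d > 0" "\<And>h. 0 < h \<Longrightarrow> h < d \<Longrightarrow> f x < f (x - h)"
      using DERIV_neg_dec_left[OF f] by auto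
    define h where "h = min (d / 2) (x - a)"
    have h: "0 < h" "h < d" "x - h \<in> {a..b}" using d(1) that ab by (auto simp: h_def)
    show False using d(2)[OF h(1,2)] max[OF h(3)] by simp
  qed
  moreover have "D \<le> 0" if "x < b"
  proof (rule ccontr)
    assume "\<not> D \<le> 0"
    then obtain d where d: "d > 0" "\<And>h. 0 < h \<Longrightarrow> h < d \<Longrightarrow> f x < f (x + h)"
      using DERIV_pos_inc_right[OF f] by auto
    define h where "h = min (d / 2) (b - x)"
    have h: "0 < h" "h < d" "x + h \<in> {a..b}" using d(1) that ab by (auto simp: h_def)
    show False using d(2)[OF h(1,2)] max[OF h(3)] by simp
  qed
  ultimately show ?thesis using ab by force
qed

text \<open>
  Difference of the two Euler--Lagrange equations, the one for the push-forward pulled back by \<open>T\<close>.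
\<close>

lemma moment_map_euler_lagrange:
  fixes u \<phi> T :: "real \<Rightarrow> real"
  assumes Gu: "free_gibbs u (distr \<nu> borel T)" and finu: "finite_energy u (distr \<nu> borel T)"
    and um[measurable]: "u \<in> borel_measurable borel"
    and G: "free_gibbs \<phi> \<nu>" and fin: "finite_energy \<phi> \<nu>"
    and \<phi>m[measurable]: "\<phi> \<in> borel_measurable borel"
    and Tm[measurable]: "T \<in> borel_measurable borel" and mono: "mono T"
  shows "\<exists>C. AE x in \<nu>. u (T x) - \<phi> x = 2 * (\<integral>y. ln ((T x - T y) / (x - y)) \<partial>\<nu>) + C"
proof -
  let ?N = "\<nu> \<Otimes>\<^sub>M \<nu>"
  have rd: "real_distribution \<nu>" using fin by (simp add: finite_energy_def)
  interpret real_distribution \<nu> by fact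
  interpret P: pair_prob_space \<nu> \<nu> ..
  have Tm': "T \<in> borel_measurable \<nu>" by simp
  note finT = finu[unfolded finite_energy_distr(1)[OF prob_space_axioms Tm' um]]
  have finI: "AE (x, y) in ?N. x \<noteq> y" "integrable ?N (\<lambda>(x, y). ln \<bar>x - y\<bar>)"
    using fin by (auto simp: finite_energy_def)
  obtain c where c: "AE x in \<nu>. \<phi> x - 2 * (\<integral>y. ln \<bar>x - y\<bar> \<partial>\<nu>) = c"
    using free_gibbs_euler_lagrange[OF G fin \<phi>m] by blast
  obtain c' where "AE x in distr \<nu> borel T. u x - 2 * (\<integral>y. ln \<bar>x - y\<bar> \<partial>distr \<nu> borel T) = c'"
    using free_gibbs_euler_lagrange[OF Gu finu um] by blast
  then have "AE x in \<nu>. u (T x) - 2 * (\<integral>y. ln \<bar>T x - y\<bar> \<partial>distr \<nu> borel T) = c'"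
    by (rule AE_distrD[OF Tm'])
  then have c': "AE x in \<nu>. u (T x) - 2 * (\<integral>y. ln \<bar>T x - T y\<bar> \<partial>\<nu>) = c'"
    by (simp add: integral_distr)
  have 1: "AE x in \<nu>. AE y in \<nu>. T x \<noteq> T y" "AE x in \<nu>. AE y in \<nu>. x \<noteq> y"
    using P.AE_pair[OF finT[THEN conjunct1]] P.AE_pair[OF finI(1)] by simp_all
  have 2: "AE x in \<nu>. integrable \<nu> (\<lambda>y. ln \<bar>T x - T y\<bar>)" "AE x in \<nu>. integrable \<nu> (\<lambda>y. ln \<bar>x - y\<bar>)"
    using P.AE_integrable_fst[OF finT[THEN conjunct2, THEN conjunct1]] P.AE_integrable_fst[OF finI(2)] by simp_all
  have "AE x in \<nu>. u (T x) - \<phi> x = 2 * (\<integral>y. ln ((T x - T y) / (x - y)) \<partial>\<nu>) + (c' - c)"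
    using c c' 1 2
  proof eventually_elim
    case (elim x)
    have "AE y in \<nu>. ln ((T x - T y) / (x - y)) = ln \<bar>T x - T y\<bar> - ln \<bar>x - y\<bar>"
      using elim(3,4)
    proof eventually_elim
      case (elim y)
      have "(T x - T y) / (x - y) = \<bar>T x - T y\<bar> / \<bar>x - y\<bar>"
        using monoD[OF mono, of x y] monoD[OF mono, of y x] elim
        by (cases "x < y") (auto simp: minus_divide_divide[of "T x - T y" "x - y", symmetric])
      then show ?case using elim by (simp add: ln_div)
    qed
    then have "(\<integral>y. ln ((T x - T y) / (x - y)) \<partial>\<nu>) = (\<integral>y. ln \<bar>T x - T y\<bar> - ln \<bar>x - y\<bar> \<partial>\<nu>)"
      by (intro integral_cong_AE) auto
    also have "\<dots> = (\<integral>y. ln \<bar>T x - T y\<bar> \<partial>\<nu>) - (\<integral>y. ln \<bar>x - y\<bar> \<partial>\<nu>)"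
      using elim(5,6) by simp
    finally show ?case using elim(1,2) by simp
  qed
  then show ?thesis by blast
qed

theorem proposition4:
  fixes u \<phi> :: "real \<Rightarrow> real" and \<nu>\<^sub>u \<nu>\<^sub>\<phi> :: "real measure" and \<epsilon> :: real
  assumes "\<epsilon> > 0"
    and "C_class 2 u"
    and "convex_on UNIV (\<lambda>x. u x - \<epsilon> / 2 * x\<^sup>2)"
    and "free_gibbs u \<nu>\<^sub>u"
    and "centered \<nu>\<^sub>u"
    and "free_moment_map \<nu>\<^sub>u \<phi>"
    and "free_gibbs \<phi> \<nu>\<^sub>\<phi>"
    and "C_class 4 \<phi>"
  shows "(inverse \<epsilon>)-lipschitz_on (msupport \<nu>\<^sub>\<phi>) (deriv \<phi>) \<and>
    (SUP (x, y) \<in> msupport \<nu>\<^sub>\<phi> \<times> msupport \<nu>\<^sub>\<phi>. ereal \<bar>free_dq (deriv \<phi>) x y\<bar>)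
      \<le> ereal (inverse \<epsilon>) \<and>
    (\<exists>\<psi>. C_class 2 \<psi> \<and> free_moment_map \<nu>\<^sub>u \<psi> \<and> free_gibbs \<psi> \<nu>\<^sub>\<phi> \<and>
       (\<forall>x\<in>msupport \<nu>\<^sub>\<phi>. \<psi> x = \<phi> x) \<and>
       (inverse \<epsilon>)-lipschitz_on UNIV (deriv \<psi>) \<and>
       (SUP (x, y) \<in> UNIV. ereal \<bar>free_dq (deriv \<psi>) x y\<bar>) \<le> ereal (inverse \<epsilon>))"
proof -
  define T where "T = deriv \<phi>"
  define T1 where "T1 = deriv T"
  define T2 where "T2 = deriv T1"
  define T3 where "T3 = deriv T2"
  have \<phi>: "(\<phi> has_real_derivative T x) (at x)" and T: "(T has_real_derivative T1 x) (at x)"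
    and T1: "(T1 has_real_derivative T2 x) (at x)" and T2: "(T2 has_real_derivative T3 x) (at x)" for x
    using C_class_has_derivative[OF assms(8), of 0 x] C_class_has_derivative[OF assms(8), of 1 x]
      C_class_has_derivative[OF assms(8), of 2 x] C_class_has_derivative[OF assms(8), of 3 x]
    by (simp_all add: T_def T1_def T2_def T3_def eval_nat_numeral)
  have T3: "continuous_on UNIV T3"
    using assms(8) by (simp add: C_class_def T_def T1_def T2_def T3_def eval_nat_numeral)
  define u1 where "u1 = deriv u"
  define u2 where "u2 = deriv u1"
  have u: "(u has_real_derivative u1 x) (at x)" and u1: "(u1 has_real_derivative u2 x) (at x)" for x
    using C_class_has_derivative[OF assms(2), of 0 x] C_class_has_derivative[OF assms(2), of 1 x]
    by (simp_all add: u1_def u2_def eval_nat_numeral)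
  have cont: "continuous_on UNIV \<phi>" "continuous_on UNIV T" "continuous_on UNIV T1" "continuous_on UNIV u"
    using continuous_on_of_derivative[OF \<phi>] continuous_on_of_derivative[OF T]
      continuous_on_of_derivative[OF T1] continuous_on_of_derivative[OF u] .
  have meas[measurable]: "\<phi> \<in> borel_measurable borel" "T \<in> borel_measurable borel" "u \<in> borel_measurable borel"
    using cont by (auto intro: borel_measurable_continuous_onI)
  define \<nu> where "\<nu> = \<nu>\<^sub>\<phi>"
  have G: "free_gibbs \<phi> \<nu>" using assms(7) by (simp add: \<nu>_def)
  have cv: "convex_on UNIV \<phi>" and \<mu>: "\<nu>\<^sub>u = distr \<nu> borel T"
    using assms(6) free_gibbs_unique[OF G] by (auto simp: free_moment_map_def T_def)
  have rd: "real_distribution \<nu>" using G by (simp add: free_gibbs_def)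
  interpret real_distribution \<nu> by (rule rd)
  have Tm: "T \<in> borel_measurable \<nu>" by simp
  note tangent = convex_tangent[OF cv \<phi>]
  have mono: "mono T" by (rule convex_deriv_mono[OF cv \<phi>])
  have T1_nonneg: "T1 x \<ge> 0" for x by (rule mono_on_imp_deriv_nonneg[OF mono T]) auto
  note uu = strong_convexity_coercive_deriv2_ge[OF assms(1,3) u u1]
  have Gu: "free_gibbs u (distr \<nu> borel T)" using assms(4) by (simp add: \<mu>)
  have finu: "finite_energy u (distr \<nu> borel T)"
    by (rule free_gibbs_finite_energy[OF Gu uu(1) meas(3)])
  have iT: "integrable \<nu> T" "(\<integral>x. T x \<partial>\<nu>) = 0"
    using assms(5) by (simp_all add: centered_def \<mu> integrable_distr_eq integral_distr)
  have Tne: "AE (x, y) in \<nu> \<Otimes>\<^sub>M \<nu>. T x \<noteq> T y"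
    using finu unfolding finite_energy_distr(1)[OF prob_space_axioms Tm meas(3)] by blast
  note signs = centered_push_forward_signs[OF prob_space_axioms iT Tne]
  have "\<exists>x1. T x1 < 0" "\<exists>x2. T x2 > 0" using signs by (meson AE_I2 not_le)+
  then have co: "coercive \<phi>" using coercive_of_slopes[of \<phi> T, OF tangent] by blast
  have fin: "finite_energy \<phi> \<nu>" by (rule free_gibbs_finite_energy[OF G co meas(1)])
  obtain a b where ab: "a < b" and S: "msupport \<nu> = {a..b}"
    by (rule free_gibbs_support_interval[OF G fin cv cont(1) co])
  have supp: "AE x in \<nu>. x \<in> {a..b}" using AE_msupport[OF rd] by (simp add: S)
  have mass: "measure \<nu> {x - d<..<x + d} > 0" if "x \<in> {a..b}" "d > 0" for x d
    using that msupport_iff[OF rd, of x] by (simp add: S)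
  have "\<exists>x\<in>{a..b}. T x < 0" "\<exists>x\<in>{a..b}. T x > 0"
    using signs eventually_mono[OF supp] by (meson not_le)+
  then obtain x1 x2 where x12: "x1 \<in> {a..b}" "T x1 < 0" "x2 \<in> {a..b}" "T x2 > 0" by blast
  obtain x0 where x0: "x0 \<in> {a..b}" and max: "\<And>x. x \<in> {a..b} \<Longrightarrow> T1 x \<le> T1 x0"
    using continuous_attains_sup[of "{a..b}" T1] continuous_on_subset[OF cont(3)] ab by auto
  have pos: "T1 x0 > 0"
  proof (rule ccontr)
    assume "\<not> T1 x0 > 0"
    then have z: "\<bar>T1 x\<bar> \<le> 0" if "x \<in> {a..b}" for x using max[OF that] T1_nonneg[of x] by simp
    have "\<bar>T x1 - T x2\<bar> \<le> 0 * \<bar>x1 - x2\<bar>"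
      by (rule abs_diff_le_of_deriv_le[OF T z x12(1,3)])
    then show False using x12 by simp
  qed
  obtain C where ident: "AE x in \<nu>. u (T x) - \<phi> x = 2 * (\<integral>y. ln ((T x - T y) / (x - y)) \<partial>\<nu>) + C"
    using moment_map_euler_lagrange[OF Gu finu meas(3) G fin meas(1,2) mono] by blast
  have bdd: "AE x in \<nu>. \<bar>x\<bar> \<le> \<bar>a\<bar> + \<bar>b\<bar>" using supp by eventually_elim auto
  have "T2 x0 = 0 \<or> (x0 = b \<and> T2 x0 \<ge> 0) \<or> (x0 = a \<and> T2 x0 \<le> 0)"
    by (rule deriv_sign_at_maximum[OF T1 ab x0 max])
  then have bdry: "T2 x0 = 0 \<or> (integrable \<nu> (\<lambda>y. 1 / (x0 - y)) \<and>
      T2 x0 * (T x0 - 2 * (\<integral>y. 1 / (x0 - y) \<partial>\<nu>)) \<ge> 0)"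
  proof (elim disjE conjE)
    assume "x0 = b" "T2 x0 \<ge> 0"
    have "AE y in \<nu>. 1 * (b - y) \<ge> 0" using supp by eventually_elim simp
    from free_gibbs_endpoint[OF G fin cv \<phi> cont(2) bdd, of 1 b, OF _ _ this] ab S
    show ?thesis using \<open>x0 = b\<close> \<open>T2 x0 \<ge> 0\<close> by (auto intro: mult_nonneg_nonneg)
  next
    assume "x0 = a" "T2 x0 \<le> 0"
    have "AE y in \<nu>. - 1 * (a - y) \<ge> 0" using supp by eventually_elim simp
    from free_gibbs_endpoint[OF G fin cv \<phi> cont(2) bdd, of "- 1" a, OF _ _ this] ab S
    show ?thesis using \<open>x0 = a\<close> \<open>T2 x0 \<le> 0\<close> by (auto intro: mult_nonpos_nonpos)
  qed simp
  have "u2 (T x0) * T1 x0 \<le> 1"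
    by (rule second_order_maximum_principle[OF rd supp finite_energy_no_atoms[OF fin] \<phi> T T1 T2 T3
        T1_nonneg u u1 x0 pos max mass[OF x0] ident bdry])
  moreover have "\<epsilon> * T1 x0 \<le> u2 (T x0) * T1 x0" using uu(2) pos by (intro mult_right_mono) auto
  ultimately have "T1 x0 \<le> inverse \<epsilon>" using assms(1) by (simp add: field_simps)
  then have T1_le: "\<bar>T1 x\<bar> \<le> inverse \<epsilon>" if "x \<in> {a..b}" for x
    using max[OF that] T1_nonneg[of x] by simp
  have inv: "inverse \<epsilon> \<ge> 0" using assms(1) by simp

  \<comment> \<open>The potential on the whole line.  It is strictly convex near \<open>x0\<close>, where \<open>\<nu>\<close> has positive mass,
     and this makes \<open>\<nu>\<close> the only minimizer.\<close>
  define \<psi> where "\<psi> = parabola_extension a b \<phi> T T1"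
  define \<psi>1 where "\<psi>1 = affine_extension a b T T1"
  define \<psi>2 where "\<psi>2 x = T1 (max a (min b x))" for x
  have \<psi>: "(\<psi> has_real_derivative \<psi>1 x) (at x)" and \<psi>1: "(\<psi>1 has_real_derivative \<psi>2 x) (at x)" for x
    unfolding \<psi>_def \<psi>1_def \<psi>2_def using extension_derivatives[OF ab \<phi> T] by auto
  have \<psi>2_bounds: "0 \<le> \<psi>2 x" "\<bar>\<psi>2 x\<bar> \<le> inverse \<epsilon>" for x
    unfolding \<psi>2_def using ab by (auto intro!: T1_nonneg T1_le)
  have c\<psi>2: "continuous_on UNIV \<psi>2"
    unfolding \<psi>2_def by (intro continuous_on_compose2[OF cont(3)] continuous_intros) auto
  have C2: "C_class 2 \<psi>" by (rule C_class_2I[OF \<psi> \<psi>1 c\<psi>2])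
  have d\<psi>: "deriv \<psi> = \<psi>1" using \<psi> by (auto intro!: ext DERIV_imp_deriv)
  have agree: "\<psi> x = \<phi> x \<and> \<psi>1 x = T x" if "x \<in> {a..b}" for x
    using that ab by (cases "x = a") (auto simp: \<psi>_def \<psi>1_def parabola_extension_def affine_extension_def)
  have cv\<psi>: "convex_on UNIV \<psi>" by (rule f''_ge0_imp_convex[OF _ \<psi> \<psi>1 \<psi>2_bounds(1)]) auto
  have co\<psi>: "coercive \<psi>"
    by (rule coercive_of_slopes[of \<psi> \<psi>1, OF convex_tangent[OF cv\<psi> \<psi>], of x1 x2]) (use agree x12 in auto)
  obtain d where d: "d > 0" "\<And>x. \<bar>x - x0\<bar> < d \<Longrightarrow> \<psi>2 x > 0"
  proof -
    have "isCont T1 x0" by (rule DERIV_isCont[OF T1])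
    then have "\<forall>\<^sub>F x in at x0. T1 x > 0"
      using pos by (intro order_tendstoD(1)[of T1 "T1 x0"]) (auto simp: isCont_def)
    then obtain d where d: "d > 0" "\<And>x. x \<noteq> x0 \<Longrightarrow> dist x x0 < d \<Longrightarrow> T1 x > 0"
      unfolding eventually_at by auto
    show thesis
    proof (rule that[OF d(1)])
      fix x assume "\<bar>x - x0\<bar> < d"
      then have "dist (max a (min b x)) x0 < d" using x0 by (auto simp: dist_real_def)
      then show "\<psi>2 x > 0" using d(2)[of "max a (min b x)"] pos
        by (cases "max a (min b x) = x0") (auto simp: \<psi>2_def)
    qed
  qed
  have strict: "\<psi>1 x < \<psi>1 z" if "x \<in> {x0 - d<..<x0 + d}" "z \<in> {x0 - d<..<x0 + d}" "x < z" for x z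
  proof (rule DERIV_pos_imp_increasing[OF that(3)])
    fix y assume "x \<le> y" "y \<le> z"
    then have "\<bar>y - x0\<bar> < d" using that by (auto simp: abs_less_iff)
    then show "\<exists>D. (\<psi>1 has_real_derivative D) (at y) \<and> D > 0" using \<psi>1 d(2) by blast
  qed
  have G\<psi>: "free_gibbs \<psi> \<nu>"
    by (rule free_gibbs_change_potential[OF G fin \<phi> cont(2) supp \<psi> cv\<psi> co\<psi> agree mass[OF x0 d(1)] strict])
  have c\<psi>: "continuous_on UNIV \<psi>" "continuous_on UNIV \<psi>1"
    using continuous_on_of_derivative[OF \<psi>] continuous_on_of_derivative[OF \<psi>1] .
  have [measurable]: "\<psi>1 \<in> borel_measurable borel" using c\<psi>(2) by (rule borel_measurable_continuous_onI)
  have "distr \<nu> borel T = distr \<nu> borel \<psi>1"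
    by (rule distr_cong_AE) (use eventually_mono[OF supp] agree in auto)
  then have M\<psi>: "free_moment_map \<nu>\<^sub>u \<psi>"
    unfolding free_moment_map_def d\<psi> \<mu> using cv\<psi> G\<psi> c\<psi>(1)
    by (auto intro!: closed_Collect_le exI[of _ \<nu>])
  have lip: "(inverse \<epsilon>)-lipschitz_on {a..b} T"
    by (rule lipschitz_onI[OF _ inv]) (use abs_diff_le_of_deriv_le[of a b T T1] T T1_le in \<open>auto simp: dist_real_def\<close>)
  have lip\<psi>: "(inverse \<epsilon>)-lipschitz_on UNIV \<psi>1"
  proof (rule lipschitz_onI[OF _ inv])
    fix x y
    show "dist (\<psi>1 x) (\<psi>1 y) \<le> inverse \<epsilon> * dist x y"
      unfolding dist_real_def
      by (rule abs_diff_le_of_deriv_le[of "min x y" "max x y" \<psi>1 \<psi>2]) (use \<psi>1 \<psi>2_bounds in auto)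
  qed
  have dq: "(SUP (x, y) \<in> {a..b} \<times> {a..b}. ereal \<bar>free_dq T x y\<bar>) \<le> ereal (inverse \<epsilon>)"
    by (rule SUP_least) (use free_dq_bound[OF T T1_le] in auto)
  have dq\<psi>: "(SUP (x, y) \<in> UNIV. ereal \<bar>free_dq \<psi>1 x y\<bar>) \<le> ereal (inverse \<epsilon>)"
  proof (rule SUP_least)
    fix p :: "real \<times> real"
    show "(case p of (x, y) \<Rightarrow> ereal \<bar>free_dq \<psi>1 x y\<bar>) \<le> ereal (inverse \<epsilon>)"
      using free_dq_bound[OF \<psi>1 \<psi>2_bounds(2), of "fst p" "min (fst p) (snd p)" "max (fst p) (snd p)" "snd p"]
      by (simp add: case_prod_unfold)
  qed
  show ?thesis
    unfolding \<nu>_def[symmetric] S T_def[symmetric]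
    using lip dq C2 M\<psi> G\<psi> agree lip\<psi> dq\<psi> unfolding d\<psi>[symmetric] by blast
qed

end
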